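(* Let $M$ be a compact smooth manifold of dimension $d\ge1$ that is Hausdorff, connected and without boundary, and let $1\le r\le\infty$ with $r\ne d+1$. Then the diffeomorphism group $\mathrm{Diff}^r(M)$ is not a group of isometries of a locally compact metric space.
   Context: $\mathrm{Diff}^r(M)$ is the group of all $C^r$-diffeomorphisms of $M$ onto itself, a Polish group with the compact-open $C^r$-topology. A Polish group $G$ is called a group of isometries of a locally compact metric space if it is isomorphic, as a topological group, to a closed subgroup of the isometry group $\mathrm{Iso}(Y,\rho)$ of some locally compact metric space $(Y,\rho)$, with the Polish topology of pointwise convergence. *)

theory Defs
  imports "HOL-Analysis.Analysis" "HOL-Algebra.Bij"
begin

subsection \<open>Maps of class \<open>C\<^sup>r\<close> on open subsets of Euclidean spaces\<close>

text \<open>The iterated directional derivative: if \<open>f\<close> is \<open>k\<close> times differentiable near \<open>x\<close>, then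
  \<open>iter_deriv [v\<^sub>1, \<dots>, v\<^sub>k] f x\<close> is the value on \<open>(v\<^sub>1, \<dots>, v\<^sub>k)\<close> of the \<open>k\<close>-th
  derivative of \<open>f\<close> at \<open>x\<close>, a \<open>k\<close>-linear map.\<close>

primrec iter_deriv ::
  "'a::euclidean_space list \<Rightarrow> ('a \<Rightarrow> 'b::euclidean_space) \<Rightarrow> 'a \<Rightarrow> 'b"
where
  "iter_deriv [] f = f"
| "iter_deriv (v # vs) f = (\<lambda>x. frechet_derivative (iter_deriv vs f) (at x) v)"

text \<open>Only used for open \<open>S\<close>; the order \<open>r\<close> may be \<open>\<infinity>\<close>.\<close>

definition Cr_on ::
  "enat \<Rightarrow> 'a::euclidean_space set \<Rightarrow> ('a \<Rightarrow> 'b::euclidean_space) \<Rightarrow> bool"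
where
  "Cr_on r S f \<longleftrightarrow>
     (\<forall>vs. enat (length vs) < r \<longrightarrow> (\<forall>x\<in>S. iter_deriv vs f differentiable (at x))) \<and>
     (\<forall>vs. enat (length vs) \<le> r \<longrightarrow> continuous_on S (iter_deriv vs f))"


subsection \<open>Smooth manifolds\<close>

text \<open>A chart \<open>(U, \<phi>)\<close> consists of an open set and a homeomorphism of it onto an open subset of
  the model space \<open>'e\<close>, so that the manifold has dimension \<open>DIM('e)\<close> and no boundary. The values
  of \<open>\<phi>\<close> outside \<open>U\<close> are irrelevant.\<close>

type_synonym ('m, 'e) chart = "'m set \<times> ('m \<Rightarrow> 'e)"

definition is_chart :: "'m topology \<Rightarrow> ('m, 'e::euclidean_space) chart \<Rightarrow> bool" where
  "is_chart M = (\<lambda>(U, \<phi>). openin M U \<and> open (\<phi> ` U) \<and>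
     homeomorphic_map (subtopology M U) (top_of_set (\<phi> ` U)) \<phi>)"

text \<open>The atlas is not required to be maximal. Maps of class \<open>C\<^sup>r\<close> and the \<open>C\<^sup>r\<close>-topology
  below depend only on the smooth structure that the atlas generates.\<close>

definition smooth_manifold ::
  "'m topology \<Rightarrow> ('m, 'e::euclidean_space) chart set \<Rightarrow> bool"
where
  "smooth_manifold M A \<longleftrightarrow>
     (\<forall>c\<in>A. is_chart M c) \<and>
     (\<Union>(U, \<phi>)\<in>A. U) = topspace M \<and>
     (\<forall>(U, \<phi>)\<in>A. \<forall>(V, \<psi>)\<in>A. Cr_on \<infinity> (\<phi> ` (U \<inter> V)) (\<psi> \<circ> inv_into U \<phi>))"

definition local_rep ::
  "('m, 'e::euclidean_space) chart \<Rightarrow> ('m, 'e) chart \<Rightarrow> ('m \<Rightarrow> 'm) \<Rightarrow> 'e \<Rightarrow> 'e"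
where
  "local_rep c c' f = snd c' \<circ> f \<circ> inv_into (fst c) (snd c)"

text \<open>As in \<^const>\<open>Bij\<close>, self-maps are extensional, so that they are determined by their values
  on the manifold.\<close>

definition Cr_maps ::
  "'m topology \<Rightarrow> ('m, 'e::euclidean_space) chart set \<Rightarrow> enat \<Rightarrow> ('m \<Rightarrow> 'm) set"
where
  "Cr_maps M A r = {f \<in> extensional (topspace M). continuous_map M M f \<and>
     (\<forall>(U, \<phi>)\<in>A. \<forall>(V, \<psi>)\<in>A.
        Cr_on r (\<phi> ` {x\<in>U. f x \<in> V}) (local_rep (U, \<phi>) (V, \<psi>) f))}"


subsection \<open>The compact-open \<open>C\<^sup>r\<close>-topology\<close>

text \<open>The set of all \<open>g\<close> that map \<open>K\<close> into the domain of the chart \<open>c'\<close> and whose local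
  representative there is \<open>\<epsilon>\<close>-close to that of \<open>f\<close>, together with all derivatives up to order \<open>k\<close>
  in the operator norm for multilinear maps.\<close>

definition Cr_nbhd ::
  "'m topology \<Rightarrow> ('m, 'e::euclidean_space) chart set \<Rightarrow> enat \<Rightarrow> nat \<Rightarrow> ('m \<Rightarrow> 'm) \<Rightarrow>
   ('m, 'e) chart \<Rightarrow> ('m, 'e) chart \<Rightarrow> 'm set \<Rightarrow> real \<Rightarrow> ('m \<Rightarrow> 'm) set"
where
  "Cr_nbhd M A r k f c c' K \<epsilon> = {g \<in> Cr_maps M A r. g ` K \<subseteq> fst c' \<and>
     (\<forall>x \<in> snd c ` K. \<forall>vs. length vs \<le> k \<and> (\<forall>v\<in>set vs. norm v \<le> 1) \<longrightarrow>
        norm (iter_deriv vs (local_rep c c' g) x - iter_deriv vs (local_rep c c' f) x) < \<epsilon>)}"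

text \<open>For \<open>r = \<infinity>\<close> this is the union of the topologies induced by the \<open>C\<^sup>k\<close>-topologies for
  finite \<open>k\<close>.\<close>

definition Cr_topology ::
  "'m topology \<Rightarrow> ('m, 'e::euclidean_space) chart set \<Rightarrow> enat \<Rightarrow> ('m \<Rightarrow> 'm) topology"
where
  "Cr_topology M A r = topology_generated_by
     {Cr_nbhd M A r k f c c' K \<epsilon> | k f c c' K \<epsilon>.
        enat k \<le> r \<and> f \<in> Cr_maps M A r \<and> c \<in> A \<and> c' \<in> A \<and>
        compactin M K \<and> K \<subseteq> fst c \<and> f ` K \<subseteq> fst c' \<and> 0 < \<epsilon>}"


subsection \<open>The diffeomorphism group\<close>

definition Diff ::
  "'m topology \<Rightarrow> ('m, 'e::euclidean_space) chart set \<Rightarrow> enat \<Rightarrow> ('m \<Rightarrow> 'm) set"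
where
  "Diff M A r = {f \<in> Bij (topspace M). f \<in> Cr_maps M A r \<and>
     restrict (inv_into (topspace M) f) (topspace M) \<in> Cr_maps M A r}"

definition Diff_group ::
  "'m topology \<Rightarrow> ('m, 'e::euclidean_space) chart set \<Rightarrow> enat \<Rightarrow> ('m \<Rightarrow> 'm) monoid"
where
  "Diff_group M A r = BijGroup (topspace M) \<lparr>carrier := Diff M A r\<rparr>"

definition Diff_topology ::
  "'m topology \<Rightarrow> ('m, 'e::euclidean_space) chart set \<Rightarrow> enat \<Rightarrow> ('m \<Rightarrow> 'm) topology"
where
  "Diff_topology M A r = subtopology (Cr_topology M A r) (Diff M A r)"


subsection \<open>Groups of isometries of locally compact metric spaces\<close>

definition Iso :: "'y metric \<Rightarrow> ('y \<Rightarrow> 'y) set" where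
  "Iso Y = {f \<in> Bij (mspace Y).
     \<forall>x\<in>mspace Y. \<forall>y\<in>mspace Y. mdist Y (f x) (f y) = mdist Y x y}"

definition Iso_group :: "'y metric \<Rightarrow> ('y \<Rightarrow> 'y) monoid" where
  "Iso_group Y = BijGroup (mspace Y) \<lparr>carrier := Iso Y\<rparr>"

text \<open>The product topology is the topology of pointwise convergence.\<close>

definition Iso_topology :: "'y metric \<Rightarrow> ('y \<Rightarrow> 'y) topology" where
  "Iso_topology Y = subtopology (product_topology (\<lambda>_. mtopology_of Y) (mspace Y)) (Iso Y)"

text \<open>The type argument bounds the metric spaces to those whose points are in \<open>'y\<close>, since types
  cannot be quantified inside a formula; a theorem in which \<open>'y\<close> is a type variable speaks about
  all metric spaces.\<close>

definition group_of_isometries_locally_compact ::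
  "'y itself \<Rightarrow> 'g monoid \<Rightarrow> 'g topology \<Rightarrow> bool"
where
  "group_of_isometries_locally_compact _ G T \<longleftrightarrow>
     (\<exists>(Y :: 'y metric) H h.
        locally_compact_space (mtopology_of Y) \<and>
        subgroup H (Iso_group Y) \<and> closedin (Iso_topology Y) H \<and>
        h \<in> iso G (Iso_group Y \<lparr>carrier := H\<rparr>) \<and>
        homeomorphic_map T (subtopology (Iso_topology Y) H) h)"

end

theory Submission
  imports Defs "HOL-Real_Asymp.Real_Asymp"
begin

text \<open>Suppose that the diffeomorphism group acts as a closed group of isometries on a locally compact
  space. Points whose distance is smaller than a radius of compactness generate pseudo-components,
  on which the isometries moving a given point a little act in a bounded way, i.e. with relatively
  compact orbits. A neighbourhood of the identity contains all diffeomorphisms fixing certain pseudo-components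
  pointwise. These form a normal subgroup of an open subgroup, so if the neighbourhood is small in the
  \<open>C\<^sup>0\<close>-sense, then the subgroup is trivial: conjugating by a flow supported in a chart enlarges any
  displacement.

  On the other hand, a chart contains infinitely many disjoint spherical shells, and the affine group
  of the line acts smoothly with support in any one of them. If its translations \<open>b t\<close> were bounded for
  arbitrarily large \<open>t\<close>, then the relation \<open>a s \<circ> b t \<circ> a (- s) = b (exp s * t)\<close> would force \<open>b\<close> to act trivially on the
  pseudo-components. Hence the translations in \<open>n\<close> shells form a properly embedded group \<open>\<real>\<^sup>n\<close>, for
  every \<open>n\<close>. This contradicts the doubling property of orbits in a locally compact space, whose constant does
  not depend on \<open>n\<close>.\<close>

section \<open>Calculus of maps of class \<open>C\<^sup>r\<close>\<close>

text \<open>The obstacle is recurrence: an isometric flow, such as a line winding in a torus, may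
  return near the identity at arbitrarily large times, and counting its points then yields nothing.
  The dilations exclude this. Moreover an isometry need not preserve the pseudo-components. Those
  that displace \<open>F\<close> little do, and so do flows, being products of small steps; hence
  all diffeomorphisms used are built from flows. The flows are smooth jointly in time and space,
  which makes them continuous in the C^r topology for every \<open>r\<close> at once. For compact
  supports, translations and dilations of the line are carried to a bounded interval by
  \<open>arctan\<close>, \<open>arsinh\<close> and \<open>arsinh\<close>. After a single
  \<open>arsinh\<close> a dilation would still be asymptotic to a nonzero shift, which is not flat
  at the end points; the second one damps it exponentially. Concentric shells give infinitely many
  commuting copies in one chart, in every dimension. How many are used is decided only after the
  doubling constant \<open>Q\<close> is known: \<open>n = 2 * Q\<close> makes \<open>2 ^ n\<close>
  exceed \<open>2 * Q\<close>.\<close>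

primrec Ck :: "nat \<Rightarrow> 'a::euclidean_space set \<Rightarrow> ('a \<Rightarrow> 'b::euclidean_space) \<Rightarrow> bool" where
  "Ck 0 S f = continuous_on S f"
| "Ck (Suc k) S f = ((\<forall>x\<in>S. f differentiable (at x)) \<and>
     (\<forall>v. Ck k S (\<lambda>x. frechet_derivative f (at x) v)))"

lemma iter_deriv_append: "iter_deriv (us @ vs) f = iter_deriv us (iter_deriv vs f)"
  by (induction us) auto

text \<open>The last entry of the list is the direction differentiated first. \<open>Ck\<close>
  peels off this first derivative, \<open>iter_deriv\<close> the outermost one; the former suits
  inductions over products and composites with \<open>f\<close> generalised.\<close>

lemma Ck_iff_iter_deriv:
  "Ck k S f \<longleftrightarrow> (\<forall>vs. length vs < k \<longrightarrow> (\<forall>x\<in>S. iter_deriv vs f differentiable (at x))) \<and>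
     (\<forall>vs. length vs = k \<longrightarrow> continuous_on S (iter_deriv vs f))"
proof (induction k arbitrary: f)
  case 0
  then show ?case by simp
next
  case (Suc k)
  have shift: "(\<forall>us. length us = Suc n \<longrightarrow> Q (iter_deriv us f)) \<longleftrightarrow>
      (\<forall>v us. length us = n \<longrightarrow> Q (iter_deriv us (\<lambda>x. frechet_derivative f (at x) v)))" for Q n
  proof (intro iffI allI impI)
    fix v :: 'a and us :: "'a list"
    assume *: "\<forall>us. length us = Suc n \<longrightarrow> Q (iter_deriv us f)" "length us = n"
    have "iter_deriv us (\<lambda>x. frechet_derivative f (at x) v) = iter_deriv (us @ [v]) f"
      by (simp add: iter_deriv_append)
    then show "Q (iter_deriv us (\<lambda>x. frechet_derivative f (at x) v))" using * by auto
  next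
    fix us :: "'a list"
    assume *: "\<forall>v us. length us = n \<longrightarrow> Q (iter_deriv us (\<lambda>x. frechet_derivative f (at x) v))"
      "length us = Suc n"
    from *(2) obtain u v where "us = u @ [v]" "length u = n"
      by (metis length_append_singleton length_Suc_conv_rev)
    then show "Q (iter_deriv us f)" using * by (simp add: iter_deriv_append)
  qed
  have split: "(\<forall>us. length us < Suc k \<longrightarrow> Q (iter_deriv us f)) \<longleftrightarrow>
      Q f \<and> (\<forall>n<k. \<forall>us. length us = Suc n \<longrightarrow> Q (iter_deriv us f))" for Q
    by (auto simp: less_Suc_eq_0_disj)
  show ?case
    unfolding Ck.simps Suc.IH split[of "\<lambda>g. \<forall>x\<in>S. g differentiable (at x)"]
      shift[of _ "\<lambda>g. \<forall>x\<in>S. g differentiable (at x)"] shift[of _ "continuous_on S"]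
    by auto
qed

lemma Ck_SucD: "Ck (Suc k) S f \<Longrightarrow> Ck k S f"
proof (induction k arbitrary: f)
  case 0
  then show ?case
    by (auto intro!: differentiable_imp_continuous_on simp: differentiable_on_def
        differentiable_at_withinI)
next
  case (Suc k)
  then show ?case by simp
qed

lemma Ck_mono: "Ck k S f \<Longrightarrow> m \<le> k \<Longrightarrow> Ck m S f"
  by (induction k rule: nat_induct) (auto simp: le_Suc_eq simp del: Ck.simps dest: Ck_SucD)

lemma Cr_on_iff_Ck: "Cr_on r S f \<longleftrightarrow> (\<forall>k. enat k \<le> r \<longrightarrow> Ck k S f)"
proof
  assume "Cr_on r S f"
  then show "\<forall>k. enat k \<le> r \<longrightarrow> Ck k S f"
    unfolding Cr_on_def Ck_iff_iter_deriv by (meson enat_ord_simps(2) less_le_trans)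
next
  assume *: "\<forall>k. enat k \<le> r \<longrightarrow> Ck k S f"
  show "Cr_on r S f"
    unfolding Cr_on_def
  proof (intro conjI allI impI)
    fix vs :: "'a list"
    assume "enat (length vs) < r"
    then have "Ck (Suc (length vs)) S f" using * by (simp add: Suc_ile_eq del: Ck.simps)
    then show "\<forall>x\<in>S. iter_deriv vs f differentiable (at x)"
      unfolding Ck_iff_iter_deriv by auto
  next
    fix vs :: "'a list"
    assume "enat (length vs) \<le> r"
    then have "Ck (length vs) S f" using * by simp
    then show "continuous_on S (iter_deriv vs f)"
      unfolding Ck_iff_iter_deriv by auto
  qed
qed

lemma Ck_subset: "Ck k S f \<Longrightarrow> T \<subseteq> S \<Longrightarrow> Ck k T f"
  by (induction k arbitrary: f) (auto intro: continuous_on_subset)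

lemma Ck_cong:
  assumes "open S" "\<And>x. x \<in> S \<Longrightarrow> f x = g x" "Ck k S f"
  shows "Ck k S g"
  using assms(2,3)
proof (induction k arbitrary: f g)
  case 0
  then show ?case using continuous_on_cong by (metis Ck.simps(1))
next
  case (Suc k)
  have d: "(f has_derivative frechet_derivative f (at x)) (at x)" if "x \<in> S" for x
    using Suc.prems(2) that by (simp add: frechet_derivative_works)
  have d': "(g has_derivative frechet_derivative f (at x)) (at x)" if "x \<in> S" for x
    using has_derivative_transform_within_open[OF d[OF that] assms(1) that] Suc.prems(1) by auto
  have eq: "frechet_derivative f (at x) = frechet_derivative g (at x)" if "x \<in> S" for x
    using frechet_derivative_at[OF d'[OF that]] .
  have "Ck k S (\<lambda>x. frechet_derivative g (at x) v)" for v
    by (rule Suc.IH[of "\<lambda>x. frechet_derivative f (at x) v"]) (use eq Suc.prems in auto)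
  then show ?case using d' by (auto simp only: Ck.simps differentiable_def)
qed

lemma Ck_Union:
  assumes "\<And>S. S \<in> \<S> \<Longrightarrow> open S" "\<And>S. S \<in> \<S> \<Longrightarrow> Ck k S f"
  shows "Ck k (\<Union>\<S>) f"
  using assms(2)
proof (induction k arbitrary: f)
  case 0
  then show ?case using assms(1) by (auto intro: continuous_on_open_Union)
next
  case (Suc k)
  then show ?case by auto
qed

lemma Ck_Un: "open S \<Longrightarrow> open T \<Longrightarrow> Ck k S f \<Longrightarrow> Ck k T f \<Longrightarrow> Ck k (S \<union> T) f"
  using Ck_Union[of "{S, T}" k f] by auto

lemma Ck_SucI:
  assumes "open S" "\<And>x. x \<in> S \<Longrightarrow> (f has_derivative f' x) (at x)"
    and "\<And>v. Ck k S (\<lambda>x. f' x v)"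
  shows "Ck (Suc k) S f"
proof -
  have "frechet_derivative f (at x) = f' x" if "x \<in> S" for x
    using frechet_derivative_at[OF assms(2)[OF that]] by simp
  then have "Ck k S (\<lambda>x. frechet_derivative f (at x) v)" for v
    using Ck_cong[OF assms(1) _ assms(3)[of v]] by simp
  then show ?thesis using assms(2) by (auto simp: differentiable_def)
qed

lemma Ck_SucD_derivative:
  assumes "Ck (Suc k) S f" "x \<in> S"
  shows "(f has_derivative frechet_derivative f (at x)) (at x)"
  using assms by (simp add: frechet_derivative_works)

lemma Ck_const: "open S \<Longrightarrow> Ck k S (\<lambda>x. c)"
  by (induction k arbitrary: c) auto

lemma Ck_bounded_linear:
  assumes "open S" "bounded_linear f"
  shows "Ck k S f"
proof (cases k)
  case 0
  then show ?thesis using assms by (simp add: linear_continuous_on)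
next
  case (Suc n)
  have "Ck (Suc n) S f"
    by (rule Ck_SucI[OF assms(1), of _ "\<lambda>_. f"])
      (use assms in \<open>auto intro: bounded_linear_imp_has_derivative Ck_const\<close>)
  then show ?thesis using Suc by simp
qed

lemma Ck_bounded_linear_comp:
  assumes "open S" "bounded_linear L" "Ck k S f"
  shows "Ck k S (\<lambda>x. L (f x))"
  using assms(3)
proof (induction k arbitrary: f)
  case 0
  then show ?case using assms by (auto intro: bounded_linear.continuous_on)
next
  case (Suc k)
  show ?case
    by (rule Ck_SucI[OF assms(1), of _ "\<lambda>x v. L (frechet_derivative f (at x) v)"])
      (use Suc Ck_SucD_derivative[OF Suc.prems] assms(2)
       in \<open>auto intro: bounded_linear.has_derivative\<close>)
qed

lemma Ck_add:
  assumes "open S" "Ck k S f" "Ck k S g"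
  shows "Ck k S (\<lambda>x. f x + g x)"
  using assms(2,3)
proof (induction k arbitrary: f g)
  case 0
  then show ?case by (auto intro: continuous_intros)
next
  case (Suc k)
  show ?case
    by (rule Ck_SucI[OF assms(1), of _
          "\<lambda>x v. frechet_derivative f (at x) v + frechet_derivative g (at x) v"])
      (use Suc Ck_SucD_derivative[OF Suc.prems(1)] Ck_SucD_derivative[OF Suc.prems(2)]
       in \<open>auto intro: has_derivative_add\<close>)
qed

lemma Ck_sum:
  assumes "open S" "\<And>i. i \<in> I \<Longrightarrow> Ck k S (f i)"
  shows "Ck k S (\<lambda>x. \<Sum>i\<in>I. f i x)"
  using assms(2)
  by (induction I rule: infinite_finite_induct) (auto intro: Ck_const Ck_add assms(1))

lemma Ck_bounded_bilinear:
  assumes "open S" "bounded_bilinear B" "Ck k S f" "Ck k S g"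
  shows "Ck k S (\<lambda>x. B (f x) (g x))"
  using assms(3,4)
proof (induction k arbitrary: f g)
  case 0
  then show ?case using assms by (auto intro: bounded_bilinear.continuous_on)
next
  case (Suc k)
  show ?case
  proof (rule Ck_SucI[OF assms(1), of _ "\<lambda>x v. B (f x) (frechet_derivative g (at x) v)
          + B (frechet_derivative f (at x) v) (g x)"])
    fix v
    have "Ck k S f" "Ck k S g" using Suc.prems Ck_SucD by blast+
    then show "Ck k S (\<lambda>x. B (f x) (frechet_derivative g (at x) v)
          + B (frechet_derivative f (at x) v) (g x))"
      using Suc by (auto intro!: Ck_add assms(1))
  qed (use Ck_SucD_derivative[OF Suc.prems(1)] Ck_SucD_derivative[OF Suc.prems(2)] in
      \<open>auto intro: bounded_bilinear.FDERIV[OF assms(2)]\<close>)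
qed

lemma Ck_Pair:
  assumes "open S" "Ck k S f" "Ck k S g"
  shows "Ck k S (\<lambda>x. (f x, g x))"
  using assms(2,3)
proof (induction k arbitrary: f g)
  case 0
  then show ?case by (auto intro: continuous_intros)
next
  case (Suc k)
  show ?case
    by (rule Ck_SucI[OF assms(1), of _
          "\<lambda>x v. (frechet_derivative f (at x) v, frechet_derivative g (at x) v)"])
      (use Suc Ck_SucD_derivative[OF Suc.prems(1)] Ck_SucD_derivative[OF Suc.prems(2)]
       in \<open>auto intro: has_derivative_Pair\<close>)
qed

text \<open>In the chain rule the vector fed to the derivative of \<open>g\<close> depends on the
  point, which the induction hypothesis does not cover. Expanding it in \<open>Basis\<close> leaves
  scalar functions times fixed-direction derivatives of \<open>g\<close> composed with
  \<open>f\<close>.\<close>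

lemma Ck_compose:
  assumes "open S" "open T" "f \<in> S \<rightarrow> T" "Ck k S f" "Ck k T g"
  shows "Ck k S (\<lambda>x. g (f x))"
  using assms(4,5)
proof (induction k arbitrary: g)
  case 0
  then show ?case using assms(3)
    by (auto intro: continuous_on_compose2[of T g S f])
next
  case (Suc k)
  have Dg: "(g has_derivative frechet_derivative g (at (f x))) (at (f x))" if "x \<in> S" for x
    using Ck_SucD_derivative[OF Suc.prems(2)] that assms(3) by auto
  have eq: "frechet_derivative g (at (f x)) (frechet_derivative f (at x) v) =
      (\<Sum>b\<in>Basis. (frechet_derivative f (at x) v \<bullet> b) *\<^sub>R frechet_derivative g (at (f x)) b)"
    if "x \<in> S" for x v
  proof -
    interpret linear "frechet_derivative g (at (f x))"
      using Dg[OF that] has_derivative_linear by blast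
    have "frechet_derivative g (at (f x)) (frechet_derivative f (at x) v) =
      frechet_derivative g (at (f x)) (\<Sum>b\<in>Basis. (frechet_derivative f (at x) v \<bullet> b) *\<^sub>R b)"
      by (simp add: euclidean_representation)
    then show ?thesis by (simp only: sum scale)
  qed
  show ?case
  proof (rule Ck_SucI[OF assms(1), of _
        "\<lambda>x v. frechet_derivative g (at (f x)) (frechet_derivative f (at x) v)"])
    fix x assume "x \<in> S"
    show "((\<lambda>x. g (f x)) has_derivative
        (\<lambda>v. frechet_derivative g (at (f x)) (frechet_derivative f (at x) v))) (at x)"
      using has_derivative_compose[OF Ck_SucD_derivative[OF Suc.prems(1) \<open>x \<in> S\<close>] Dg[OF \<open>x \<in> S\<close>]] .
  next
    fix v
    have "Ck k S (\<lambda>x. frechet_derivative g (at (f x)) b)" for b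
      using Suc.IH[OF Ck_SucD[OF Suc.prems(1)], of "\<lambda>y. frechet_derivative g (at y) b"] Suc.prems(2)
      by simp
    moreover have "Ck k S (\<lambda>x. frechet_derivative f (at x) v \<bullet> b)" for b
      using Suc.prems(1) by (auto intro: Ck_bounded_linear_comp[OF assms(1) bounded_linear_inner_left])
    ultimately have "Ck k S (\<lambda>x. \<Sum>b\<in>Basis. (frechet_derivative f (at x) v \<bullet> b) *\<^sub>R
        frechet_derivative g (at (f x)) b)"
      by (intro Ck_sum[OF assms(1)] Ck_bounded_bilinear[OF assms(1) bounded_bilinear_scaleR])
    then show "Ck k S (\<lambda>x. frechet_derivative g (at (f x)) (frechet_derivative f (at x) v))"
      by (rule Ck_cong[OF assms(1), rotated]) (simp add: eq)
  qed
qed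

lemma Ck_SucI_real:
  fixes f :: "real \<Rightarrow> real"
  assumes "open S" "\<And>x. x \<in> S \<Longrightarrow> (f has_real_derivative f' x) (at x)" "Ck k S f'"
  shows "Ck (Suc k) S f"
  by (rule Ck_SucI[OF assms(1), of _ "\<lambda>x v. f' x * v"])
    (use assms in \<open>auto simp: has_field_derivative_def
      intro: Ck_bounded_linear_comp[OF assms(1) bounded_linear_mult_left]\<close>)

section \<open>Local criterion and closure under elementary functions\<close>

lemma Ck_local:
  assumes "\<And>x. x \<in> S \<Longrightarrow> \<exists>T. open T \<and> x \<in> T \<and> Ck k T f"
  shows "Ck k S f"
proof -
  have "Ck k (\<Union>{T. open T \<and> Ck k T f}) f" by (rule Ck_Union) auto
  then show ?thesis by (rule Ck_subset) (use assms in blast)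
qed

lemma Ck_continuous_on: "Ck k S f \<Longrightarrow> continuous_on S f"
  using Ck_mono[of k S f 0] by simp

lemma Ck_fst: "open S \<Longrightarrow> Ck k S fst"
  and Ck_snd: "open S \<Longrightarrow> Ck k S snd"
  by (simp_all add: Ck_bounded_linear bounded_linear_fst bounded_linear_snd)

lemma Ck_minus: "open S \<Longrightarrow> Ck k S f \<Longrightarrow> Ck k S (\<lambda>x. - f x)"
  by (rule Ck_bounded_linear_comp[OF _ bounded_linear_minus[OF bounded_linear_ident]])

lemma Ck_diff: "open S \<Longrightarrow> Ck k S f \<Longrightarrow> Ck k S g \<Longrightarrow> Ck k S (\<lambda>x. f x - g x)"
  using Ck_add[of S k f "\<lambda>x. - g x"] Ck_minus by auto

lemma Ck_scaleR: "open S \<Longrightarrow> Ck k S f \<Longrightarrow> Ck k S g \<Longrightarrow> Ck k S (\<lambda>x. f x *\<^sub>R g x)"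
  by (rule Ck_bounded_bilinear[OF _ bounded_bilinear_scaleR])

lemma Ck_inner: "open S \<Longrightarrow> Ck k S f \<Longrightarrow> Ck k S g \<Longrightarrow> Ck k S (\<lambda>x. f x \<bullet> g x)"
  by (rule Ck_bounded_bilinear[OF _ bounded_bilinear_inner])

lemma Ck_mult: "open S \<Longrightarrow> Ck k S f \<Longrightarrow> Ck k S g \<Longrightarrow> Ck k S (\<lambda>x. f x * g x)"
  for f g :: "'a::euclidean_space \<Rightarrow> real"
  by (rule Ck_bounded_bilinear[OF _ bounded_bilinear_mult])

lemma Ck_compose_real:
  fixes g :: "real \<Rightarrow> real"
  assumes "open S" "Ck k S f" "Ck k T g" "open T" "\<And>x. x \<in> S \<Longrightarrow> f x \<in> T"
  shows "Ck k S (\<lambda>x. g (f x))"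
  using Ck_compose[of S T f k g] assms by auto

lemma Ck_exp_UNIV: "Ck k UNIV (exp :: real \<Rightarrow> real)"
proof (induction k)
  case (Suc k)
  then show ?case by (intro Ck_SucI_real[where f' = exp]) auto
qed (auto intro: continuous_intros)

lemma Ck_inverse_nonzero: "Ck k (- {0}) (inverse :: real \<Rightarrow> real)"
proof (induction k)
  case 0
  then show ?case by (auto intro!: continuous_intros)
next
  case (Suc k)
  show ?case
  proof (rule Ck_SucI_real[where f' = "\<lambda>x. - (inverse x * inverse x)"])
    show "Ck k (- {0}) (\<lambda>x::real. - (inverse x * inverse x))"
      by (intro Ck_minus Ck_mult Suc) auto
  qed (auto intro!: derivative_eq_intros)
qed

lemma Ck_inverse:
  "open S \<Longrightarrow> Ck k S f \<Longrightarrow> (\<And>x. x \<in> S \<Longrightarrow> f x \<noteq> 0) \<Longrightarrow> Ck k S (\<lambda>x. inverse (f x :: real))"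
  by (rule Ck_compose_real[OF _ _ Ck_inverse_nonzero]) auto

lemma Ck_divide:
  "open S \<Longrightarrow> Ck k S f \<Longrightarrow> Ck k S g \<Longrightarrow> (\<And>x. x \<in> S \<Longrightarrow> g x \<noteq> 0) \<Longrightarrow> Ck k S (\<lambda>x. f x / g x :: real)"
  unfolding divide_inverse by (intro Ck_mult Ck_inverse)

lemma Ck_ln_pos: "Ck k {0<..} (ln :: real \<Rightarrow> real)"
proof (cases k)
  case 0
  then show ?thesis by (auto intro!: continuous_intros)
next
  case (Suc n)
  have "Ck n {0<..} (inverse :: real \<Rightarrow> real)"
    using Ck_inverse_nonzero by (rule Ck_subset) auto
  then show ?thesis unfolding Suc
    by (intro Ck_SucI_real[where f' = inverse]) (auto intro!: derivative_eq_intros simp: divide_inverse)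
qed

lemma Ck_sqrt_pos: "Ck k {0<..} sqrt"
proof (induction k)
  case 0
  then show ?case by (auto intro!: continuous_intros)
next
  case (Suc k)
  show ?case
  proof (rule Ck_SucI_real[where f' = "\<lambda>x. inverse (sqrt x) / 2"])
    show "Ck k {0<..} (\<lambda>x. inverse (sqrt x) / 2)"
      by (intro Ck_divide Ck_inverse Ck_const Suc) auto
  qed (auto intro!: derivative_eq_intros)
qed

lemma Ck_arctan_UNIV: "Ck k UNIV (arctan :: real \<Rightarrow> real)"
proof (cases k)
  case 0
  then show ?thesis by (auto intro!: continuous_intros)
next
  case (Suc n)
  have nz: "1 + x * x \<noteq> 0" for x :: real
    using zero_le_square[of x] by linarith
  show ?thesis unfolding Suc
    by (rule Ck_SucI_real[where f' = "\<lambda>x. inverse (1 + x * x)"])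
      (use nz in \<open>auto intro!: derivative_eq_intros Ck_inverse Ck_add Ck_const Ck_mult
        Ck_bounded_linear[OF _ bounded_linear_ident] simp: power2_eq_square\<close>)
qed

lemma Ck_sin_cos: "Ck k UNIV (sin :: real \<Rightarrow> real) \<and> Ck k UNIV (cos :: real \<Rightarrow> real)"
proof (induction k)
  case (Suc k)
  have "Ck (Suc k) UNIV (sin :: real \<Rightarrow> real)"
    by (rule Ck_SucI_real[where f' = cos]) (use Suc in \<open>auto intro!: derivative_eq_intros\<close>)
  moreover have "Ck (Suc k) UNIV (cos :: real \<Rightarrow> real)"
    by (rule Ck_SucI_real[where f' = "\<lambda>x. - sin x"])
      (use Suc in \<open>auto intro!: derivative_eq_intros Ck_minus\<close>)
  ultimately show ?case by blast
qed (auto intro: continuous_intros)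

lemma Ck_ln:
  "open S \<Longrightarrow> Ck k S f \<Longrightarrow> (\<And>x. x \<in> S \<Longrightarrow> f x > 0) \<Longrightarrow> Ck k S (\<lambda>x. ln (f x :: real))"
  by (rule Ck_compose_real[OF _ _ Ck_ln_pos]) auto

lemma Ck_sqrt:
  "open S \<Longrightarrow> Ck k S f \<Longrightarrow> (\<And>x. x \<in> S \<Longrightarrow> f x > 0) \<Longrightarrow> Ck k S (\<lambda>x. sqrt (f x))"
  by (rule Ck_compose_real[OF _ _ Ck_sqrt_pos]) auto

lemma Ck_arctan: "open S \<Longrightarrow> Ck k S f \<Longrightarrow> Ck k S (\<lambda>x. arctan (f x))"
  by (rule Ck_compose_real[OF _ _ Ck_arctan_UNIV]) auto

lemma Ck_exp: "open S \<Longrightarrow> Ck k S f \<Longrightarrow> Ck k S (\<lambda>x. exp (f x :: real))"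
  by (rule Ck_compose_real[OF _ _ Ck_exp_UNIV]) auto

lemma Ck_sin: "open S \<Longrightarrow> Ck k S f \<Longrightarrow> Ck k S (\<lambda>x. sin (f x :: real))"
  by (rule Ck_compose_real[OF _ _ conjunct1[OF Ck_sin_cos]]) auto

lemma Ck_cos: "open S \<Longrightarrow> Ck k S f \<Longrightarrow> Ck k S (\<lambda>x. cos (f x :: real))"
  by (rule Ck_compose_real[OF _ _ conjunct2[OF Ck_sin_cos]]) auto

lemma Ck_norm:
  "open S \<Longrightarrow> Ck k S f \<Longrightarrow> (\<And>x. x \<in> S \<Longrightarrow> f x \<noteq> 0) \<Longrightarrow> Ck k S (\<lambda>x. norm (f x))"
  unfolding norm_eq_sqrt_inner by (intro Ck_sqrt Ck_inner) auto

lemma Ck_sinh: "open S \<Longrightarrow> Ck k S f \<Longrightarrow> Ck k S (\<lambda>x. sinh (f x :: real))"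
  unfolding sinh_def by (simp, intro Ck_divide Ck_diff Ck_exp Ck_const Ck_minus) auto

lemma Ck_arsinh:
  assumes "open S" "Ck k S f"
  shows "Ck k S (\<lambda>x. arsinh (f x :: real))"
proof -
  have "Ck k S (\<lambda>x. ln (f x + sqrt (f x * f x + 1)))"
  proof (intro Ck_ln Ck_add Ck_sqrt Ck_mult Ck_const assms)
    fix x
    show "f x * f x + 1 > 0" using zero_le_square[of "f x"] by linarith
    show "f x + sqrt (f x * f x + 1) > 0"
      using arsinh_real_aux[of "f x"] by (simp add: power2_eq_square)
  qed
  then show ?thesis by (simp add: arsinh_real_def power2_eq_square)
qed

section \<open>A flat function\<close>

text \<open>\<open>flat 0\<close> is the classical flat function \<open>exp (- 1 / x)\<close>. The
  powers in the denominator make the family closed under differentiation up to linear combinations,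
  so one induction gives smoothness of all its members.\<close>

definition flat :: "nat \<Rightarrow> real \<Rightarrow> real" where
  "flat m x = (if x > 0 then exp (- 1 / x) / x ^ m else 0)"

lemma flat_derivative:
  "(flat m has_real_derivative flat (m + 2) x - m * flat (m + 1) x) (at x)"
proof -
  consider "x > 0" | "x < 0" | "x = 0" by linarith
  then show ?thesis
  proof cases
    case 1
    define i where "i = inverse x"
    have "((\<lambda>x. exp (- inverse x) * inverse x ^ m) has_real_derivative
        exp (- i) * (i * i) * i ^ m + exp (- i) * (m * i ^ (m - 1) * - (i * i))) (at x)"
      unfolding i_def using 1 by (auto intro!: derivative_eq_intros simp: power2_eq_square)
    also have "exp (- i) * (i * i) * i ^ m + exp (- i) * (m * i ^ (m - 1) * - (i * i)) =
        flat (m + 2) x - m * flat (m + 1) x"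
      using 1 by (cases m) (simp_all add: flat_def i_def divide_inverse power_inverse algebra_simps)
    finally have "((\<lambda>x. exp (- inverse x) * inverse x ^ m) has_real_derivative
        flat (m + 2) x - m * flat (m + 1) x) (at x)" .
    then show ?thesis
      by (rule has_field_derivative_transform_within_open[where S = "{0<..}"]) (use 1 in \<open>auto simp: flat_def divide_inverse power_inverse\<close>)
  next
    case 2
    have "((\<lambda>x. 0) has_real_derivative 0) (at x)" by simp
    then have "(flat m has_real_derivative 0) (at x)"
      by (rule has_field_derivative_transform_within_open[where S = "{..<0}"]) (use 2 in \<open>auto simp: flat_def\<close>)
    then show ?thesis using 2 by (simp add: flat_def)
  next
    case 3
    have "((\<lambda>h::real. exp (- 1 / h) / h ^ m / h) \<longlongrightarrow> 0) (at_right 0)" by real_asymp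
    then have "((\<lambda>h. flat m h / h) \<longlongrightarrow> 0) (at_right 0)"
      by (rule Lim_transform_eventually) (auto simp: eventually_at_filter flat_def)
    moreover have "((\<lambda>h. flat m h / h) \<longlongrightarrow> 0) (at_left 0)"
      by (rule Lim_transform_eventually[OF tendsto_const]) (auto simp: eventually_at_filter flat_def)
    ultimately have "((\<lambda>h. flat m h / h) \<longlongrightarrow> 0) (at 0)"
      by (simp add: filterlim_split_at)
    then show ?thesis using 3 by (simp add: has_field_derivative_iff flat_def)
  qed
qed

lemma Ck_flat_UNIV: "Ck k UNIV (flat m)"
proof (induction k arbitrary: m)
  case 0
  then show ?case using flat_derivative
    by (auto intro!: DERIV_continuous_on simp: has_field_derivative_at_within)
next
  case (Suc k)
  show ?case
    by (rule Ck_SucI_real[OF _ flat_derivative])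
      (intro open_UNIV Ck_diff Ck_mult Ck_const Suc)+
qed

lemma Ck_flat: "open S \<Longrightarrow> Ck k S f \<Longrightarrow> Ck k S (\<lambda>x. flat m (f x))"
  by (rule Ck_compose_real[OF _ _ Ck_flat_UNIV]) auto

lemmas Ck_intros = Ck_const Ck_add Ck_diff Ck_minus Ck_mult Ck_scaleR Ck_inner Ck_inverse
  Ck_divide Ck_ln Ck_sqrt Ck_arctan Ck_exp Ck_sin Ck_cos Ck_norm Ck_sinh Ck_arsinh Ck_flat
  Ck_fst Ck_snd Ck_bounded_linear[OF _ bounded_linear_ident] Ck_Pair


section \<open>Flows on an interval that are tangent to the identity at the end points\<close>

text \<open>For \<open>m > 0\<close> and \<open>u = exp (- q)\<close> one has \<open>arsinh (m * exp q) = q + arsinh_rem u m\<close>, and the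
  remainder stays smooth down to \<open>u = 0\<close>, i.e. up to \<open>q = \<infinity>\<close>.\<close>

definition arsinh_rem :: "real \<Rightarrow> real \<Rightarrow> real" where
  "arsinh_rem u m = ln (m + sqrt (m * m + u * u))"

lemma arsinh_rem:
  assumes "m > 0"
  shows "arsinh (m * exp q) = q + arsinh_rem (exp (- q)) m"
proof -
  have pos: "m + sqrt (m * m + exp (- q) * exp (- q)) > 0"
    using assms by (simp add: add_pos_nonneg)
  have "exp q * sqrt (m * m + exp (- q) * exp (- q)) = sqrt ((m * exp q)\<^sup>2 + 1)"
  proof -
    have "exp q * sqrt (m * m + exp (- q) * exp (- q)) =
        sqrt (exp q * exp q * (m * m + exp (- q) * exp (- q)))"
      by (simp add: real_sqrt_mult)
    also have "exp q * exp q * (m * m + exp (- q) * exp (- q)) = (m * exp q)\<^sup>2 + 1"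
      by (simp add: power2_eq_square algebra_simps flip: exp_add)
    finally show ?thesis .
  qed
  then have "m * exp q + sqrt ((m * exp q)\<^sup>2 + 1) =
      exp q * (m + sqrt (m * m + exp (- q) * exp (- q)))"
    by (simp only: distrib_left mult.commute)
  then show ?thesis
    using pos by (simp add: arsinh_real_def arsinh_rem_def ln_mult)
qed

lemma Ck_arsinh_rem:
  assumes "open S" "Ck k S f" "Ck k S g" "\<And>x. x \<in> S \<Longrightarrow> g x > 0"
  shows "Ck k S (\<lambda>x. arsinh_rem (f x) (g x))"
  unfolding arsinh_rem_def
  by (intro Ck_intros assms) (use assms(4) in \<open>auto intro!: add_pos_nonneg\<close>)

text \<open>The double hyperbolic sine makes transported translations and dilations infinitely tangent to
  the identity at the end points \<open>- pi / 2\<close> and \<open>pi / 2\<close>.\<close>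

definition transport :: "(real \<Rightarrow> real) \<Rightarrow> real \<Rightarrow> real" where
  "transport \<alpha> z = (if \<bar>z\<bar> < pi / 2 then arctan (arsinh (arsinh (\<alpha> (sinh (sinh (tan z)))))) else z)"

lemma transport_bounds: "\<bar>z\<bar> < pi / 2 \<Longrightarrow> \<bar>transport \<alpha> z\<bar> < pi / 2"
  using arctan_bounded[of "arsinh (arsinh (\<alpha> (sinh (sinh (tan z)))))"] unfolding transport_def by auto

lemma transport_outside: "\<bar>z\<bar> \<ge> pi / 2 \<Longrightarrow> transport \<alpha> z = z"
  by (simp add: transport_def)

lemma transport_comp: "transport \<alpha> (transport \<beta> z) = transport (\<lambda>x. \<alpha> (\<beta> x)) z"
proof (cases "\<bar>z\<bar> < pi / 2")
  case True
  show ?thesis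
    using transport_bounds[OF True, of \<beta>] True by (simp add: transport_def tan_arctan)
qed (simp add: transport_def)

lemma transport_id: "transport (\<lambda>x. x) z = z"
  by (auto simp: transport_def arsinh_sinh_real arctan_tan abs_less_iff)

lemma transport_minus: "transport (\<lambda>x. - \<alpha> (- x)) z = - transport \<alpha> (- z)"
  by (simp add: transport_def arctan_minus)

text \<open>At the right end \<open>q = tan z\<close> tends to infinity, so the map is rewritten in
  \<open>\<zeta> = 1 / q\<close>, which is smooth across the end. All exponentials become flat
  functions of \<open>\<zeta>\<close>; they vanish identically beyond the end, where the same
  formula returns \<open>z\<close>. The hypotheses on \<open>m\<close> make
  \<open>\<alpha> t\<close> asymptotically linear with a smooth remainder: a first
  \<open>arsinh\<close> leaves a bounded shift \<open>d1\<close>, and the second damps it by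
  \<open>exp (- q)\<close>.\<close>

lemma transport_smooth_end:
  fixes m \<alpha> :: "real \<Rightarrow> real \<Rightarrow> real"
  assumes m: "\<And>k. Ck k UNIV (\<lambda>y. m (fst y) (snd y))" "\<And>t. m t 0 > 0"
    and \<alpha>: "\<And>t p. \<alpha> t (sinh p) = m t (exp (- p)) * exp p"
    and z0: "z0 \<ge> pi / 2"
  shows "\<exists>T. open T \<and> (t0, z0) \<in> T \<and> Ck k T (\<lambda>y. transport (\<alpha> (fst y)) (snd y))"
proof (cases "z0 > pi / 2")
  case True
  define T :: "(real \<times> real) set" where "T = UNIV \<times> {pi/2<..}"
  have "open T" unfolding T_def by (intro open_Times) auto
  have "Ck k T (\<lambda>y. transport (\<alpha> (fst y)) (snd y))"
    by (rule Ck_cong[OF \<open>open T\<close> _ Ck_snd[OF \<open>open T\<close>]]) (auto simp: T_def transport_def)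
  then show ?thesis using True \<open>open T\<close> by (auto simp: T_def)
next
  case False
  then have z0: "z0 = pi / 2" using z0 by simp
  define T0 :: "(real \<times> real) set" where "T0 = UNIV \<times> {0<..<pi}"
  define \<zeta> :: "real \<times> real \<Rightarrow> real" where "\<zeta> = (\<lambda>y. cos (snd y) / sin (snd y))"
  \<comment> \<open>Inside the interval \<open>u\<close> and \<open>v\<close> are
    \<open>exp (- q)\<close> and \<open>exp (- sinh q)\<close>; the formula for \<open>v\<close>
    comes from \<open>sinh q = 1 / (2 * u) - u / 2\<close>.\<close>
  define u where "u = (\<lambda>y. flat 0 (\<zeta> y))"
  define v where "v = (\<lambda>y. flat 0 (2 * u y) * exp (u y / 2))"
  define m1 where "m1 = (\<lambda>y. m (fst y) (v y))"
  define T1 where "T1 = {y\<in>T0. m1 y \<in> {0<..}}"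
  \<comment> \<open>The cofactor in \<open>sinh q + d1 = m2 * exp q\<close>. At \<open>u = 0\<close>
    it equals \<open>1 / 2\<close> whatever \<open>m\<close> is, and there the second remainder is
    \<open>ln 1 = 0\<close>.\<close>
  define m2 where "m2 = (\<lambda>y. (1 - u y * u y) / 2 + u y * arsinh_rem (v y) (m1 y))"
  define T2 where "T2 = {y\<in>T1. m2 y \<in> {0<..}}"
  \<comment> \<open>The argument of the final \<open>arctan\<close> is
    \<open>q + d2 = den / \<zeta>\<close>, so the value is
    \<open>pi / 2 - arctan (\<zeta> / den)\<close>, which makes sense at \<open>\<zeta> = 0\<close>
    too.\<close>
  define den where "den = (\<lambda>y. 1 + \<zeta> y * arsinh_rem (u y) (m2 y))"
  define T3 where "T3 = {y\<in>T2. den y \<in> {0<..}}"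
  have preimage: "open {y\<in>T. f y \<in> {0<..}}" if "open T" "Ck k T f"
    for T :: "(real \<times> real) set" and f :: "real \<times> real \<Rightarrow> real"
    using continuous_open_preimage[OF Ck_continuous_on[OF that(2)] that(1), of "{0<..}"]
    by (simp add: vimage_def Collect_conj_eq[symmetric] Int_def)
  have T0: "open T0" unfolding T0_def by (intro open_Times) auto
  have sin_pos: "sin (snd y) > 0" if "y \<in> T0" for y
    using that by (auto simp: T0_def intro: sin_gt_zero)
  have \<zeta>: "Ck k T0 \<zeta>" unfolding \<zeta>_def
    by (intro Ck_intros T0) (use sin_pos in force)
  have u: "Ck k T0 u" unfolding u_def by (intro Ck_intros T0 \<zeta>)
  have v: "Ck k T0 v" unfolding v_def by (intro Ck_intros T0 u) auto
  have m1: "Ck k T0 m1"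
  proof -
    have "Ck k T0 (\<lambda>y. (fst y, v y))" by (intro Ck_intros T0 v)
    from Ck_compose[OF T0 open_UNIV _ this m(1)] show ?thesis by (simp add: m1_def)
  qed
  have T1: "open T1" "T1 \<subseteq> T0" using preimage[OF T0 m1] by (auto simp: T1_def)
  have m2: "Ck k T1 m2" unfolding m2_def
    by (intro Ck_intros Ck_arsinh_rem T1 Ck_subset[OF u] Ck_subset[OF v] Ck_subset[OF m1])
      (auto simp: T1_def)
  have T2: "open T2" "T2 \<subseteq> T1" using preimage[OF T1(1) m2] by (auto simp: T2_def)
  have T20: "T2 \<subseteq> T0" using T1 T2 by auto
  have den: "Ck k T2 den" unfolding den_def
    by (intro Ck_intros Ck_arsinh_rem T2(1) Ck_subset[OF \<zeta> T20] Ck_subset[OF u T20] Ck_subset[OF m2 T2(2)])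
      (auto simp: T2_def)
  have T3: "open T3" "T3 \<subseteq> T2" "T3 \<subseteq> T0" using preimage[OF T2(1) den] T20 by (auto simp: T3_def)
  have flat0: "flat 0 x = 0" if "x \<le> 0" for x using that by (simp add: flat_def)
  have rem0: "arsinh_rem 0 (1 / 2) = 0" by (simp add: arsinh_rem_def real_sqrt_divide)
  have "\<zeta> (t0, z0) = 0" by (simp add: \<zeta>_def z0)
  then have "(t0, z0) \<in> T3"
    using m(2) by (simp add: T3_def T2_def T1_def T0_def den_def m2_def m1_def v_def u_def flat0 z0)
  have eq: "pi / 2 - arctan (\<zeta> y / den y) = transport (\<alpha> (fst y)) (snd y)" if y: "y \<in> T3" for y
  proof -
    define z where "z = snd y"
    have z: "0 < z" "z < pi" using T3(3) y by (auto simp: T0_def z_def)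
    have \<zeta>_cot: "\<zeta> y = tan (pi / 2 - z)" by (simp add: \<zeta>_def z_def tan_cot' cot_def)
    have pos: "m1 y > 0" "m2 y > 0" "den y > 0" using y by (auto simp: T3_def T2_def T1_def)
    show ?thesis
    proof (cases "z < pi / 2")
      case False
      then have "sin z > 0" "cos z \<le> 0"
        using z sin_ge_zero[of "z - pi / 2"] by (auto intro: sin_gt_zero simp: sin_diff)
      then have "\<zeta> y \<le> 0" by (simp add: \<zeta>_def z_def divide_nonpos_pos)
      then have "den y = 1" by (simp add: den_def m2_def u_def flat0 rem0)
      then have "pi / 2 - arctan (\<zeta> y / den y) = pi / 2 - (pi / 2 - z)"
        using z by (simp add: \<zeta>_cot arctan_tan)
      then show ?thesis using False transport_outside[of z] by (simp add: z_def)
    next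
      case True
      define q where "q = tan z"
      define d1 where "d1 = arsinh_rem (v y) (m1 y)"
      define d2 where "d2 = arsinh_rem (u y) (m2 y)"
      have q: "q > 0" using True z by (simp add: q_def tan_gt_zero)
      have \<zeta>q: "\<zeta> y = inverse q" by (simp add: \<zeta>_cot q_def tan_cot)
      have uq: "u y = exp (- q)" using q by (simp add: u_def \<zeta>q flat_def divide_inverse)
      have vq: "v y = exp (- sinh q)"
        by (simp add: v_def flat_def uq sinh_def flip: exp_add)
          (simp add: exp_minus field_simps)
      have "arsinh (\<alpha> (fst y) (sinh (sinh q))) = sinh q + d1"
        unfolding \<alpha> d1_def vq m1_def
        by (rule arsinh_rem) (use pos(1) in \<open>simp add: m1_def vq\<close>)
      also have "\<dots> = m2 y * exp q"
        by (simp add: m2_def d1_def[symmetric] uq sinh_def algebra_simps divide_simps flip: exp_add)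
      also have "arsinh \<dots> = q + d2" unfolding d2_def uq by (rule arsinh_rem[OF pos(2)])
      also have "q + d2 = inverse (\<zeta> y / den y)"
        using q pos(3) by (simp add: den_def d2_def[symmetric] \<zeta>q field_simps)
      also have "arctan \<dots> = pi / 2 - arctan (\<zeta> y / den y)"
        using arctan_inverse[of "\<zeta> y / den y"] pos(3) q by (simp add: \<zeta>q)
      finally show ?thesis using True z by (simp add: transport_def z_def q_def abs_less_iff)
    qed
  qed
  have "Ck k T3 (\<lambda>y. pi / 2 - arctan (\<zeta> y / den y))"
    by (intro Ck_intros T3 Ck_subset[OF \<zeta> T3(3)] Ck_subset[OF den T3(2)]) (auto simp: T3_def)
  then have "Ck k T3 (\<lambda>y. transport (\<alpha> (fst y)) (snd y))"
    by (rule Ck_cong[OF T3(1), rotated]) (rule eq)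
  then show ?thesis using T3(1) \<open>(t0, z0) \<in> T3\<close> by blast
qed


text \<open>The left end is reduced to the right one by the reflection in
  \<open>transport_minus\<close>, which replaces \<open>\<alpha> t x\<close> by
  \<open>- \<alpha> t (- x)\<close>; hence the second cofactor \<open>m'\<close>. Inside the
  interval the defining formula is smooth.\<close>

lemma Ck_transport:
  fixes m m' \<alpha> :: "real \<Rightarrow> real \<Rightarrow> real"
  assumes m: "\<And>k. Ck k UNIV (\<lambda>y. m (fst y) (snd y))" "\<And>t. m t 0 > 0"
    and \<alpha>: "\<And>t p. \<alpha> t (sinh p) = m t (exp (- p)) * exp p"
    and m': "\<And>k. Ck k UNIV (\<lambda>y. m' (fst y) (snd y))" "\<And>t. m' t 0 > 0"
    and \<alpha>': "\<And>t p. - \<alpha> t (- sinh p) = m' t (exp (- p)) * exp p"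
    and smooth: "\<And>k. Ck k UNIV (\<lambda>y. \<alpha> (fst y) (snd y))"
  shows "Ck k UNIV (\<lambda>y. transport (\<alpha> (fst y)) (snd y))"
proof (rule Ck_local)
  fix y0 :: "real \<times> real"
  obtain t0 z0 where y0: "y0 = (t0, z0)" by force
  consider "z0 \<ge> pi / 2" | "- z0 \<ge> pi / 2" | "\<bar>z0\<bar> < pi / 2" by linarith
  then show "\<exists>T. open T \<and> y0 \<in> T \<and> Ck k T (\<lambda>y. transport (\<alpha> (fst y)) (snd y))"
  proof cases
    case 1
    show ?thesis unfolding y0 by (rule transport_smooth_end[OF m \<alpha> 1])
  next
    case 2
    let ?\<beta> = "\<lambda>t x. - \<alpha> t (- x)"
    obtain T where T: "open T" "(t0, - z0) \<in> T" "Ck k T (\<lambda>y. transport (?\<beta> (fst y)) (snd y))"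
      using transport_smooth_end[of m' ?\<beta>, OF m' \<alpha>' 2] by blast
    define N :: "real \<times> real \<Rightarrow> real \<times> real" where "N = (\<lambda>y. (fst y, - snd y))"
    have N: "Ck k UNIV N" for k unfolding N_def by (intro Ck_intros) auto
    have "open (N -` T)"
      using Ck_continuous_on[OF N] T(1) by (simp add: continuous_on_open_vimage)
    moreover have "Ck k (N -` T) (\<lambda>y. - transport (?\<beta> (fst (N y))) (snd (N y)))"
      by (intro Ck_minus Ck_compose[where f = N, OF calculation T(1) _ _ T(3)] calculation
          Ck_subset[OF N]) auto
    then have "Ck k (N -` T) (\<lambda>y. transport (\<alpha> (fst y)) (snd y))"
      by (simp add: transport_minus N_def)
    ultimately show ?thesis using T(2) by (auto simp: y0 N_def)
  next
    case 3
    define T :: "(real \<times> real) set" where "T = UNIV \<times> {- (pi / 2)<..<pi / 2}"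
    have T: "open T" unfolding T_def by (intro open_Times) auto
    have cos: "cos (snd y) \<noteq> 0" if "y \<in> T" for y
      using that cos_gt_zero_pi[of "snd y"] by (auto simp: T_def)
    have "Ck k T (\<lambda>y. (fst y, sinh (sinh (sin (snd y) / cos (snd y)))))"
      by (intro Ck_intros T cos)
    from Ck_compose[OF T open_UNIV _ this smooth]
    have "Ck k T (\<lambda>y. \<alpha> (fst y) (sinh (sinh (tan (snd y)))))" by (simp add: tan_def)
    then have "Ck k T (\<lambda>y. arctan (arsinh (arsinh (\<alpha> (fst y) (sinh (sinh (tan (snd y))))))))"
      by (intro Ck_intros T)
    then have "Ck k T (\<lambda>y. transport (\<alpha> (fst y)) (snd y))"
      by (rule Ck_cong[OF T, rotated]) (auto simp: T_def transport_def abs_less_iff)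
    moreover have "y0 \<in> T" using 3 by (auto simp: y0 T_def abs_less_iff)
    ultimately show ?thesis using T by blast
  qed
qed

lemma sinh_exp: "sinh p = (1 - exp (- p) * exp (- p)) / 2 * exp p" for p :: real
  by (simp add: sinh_def algebra_simps diff_divide_distrib flip: exp_add)

text \<open>The cofactors arise by factoring \<open>exp p\<close> out of \<open>sinh p + t\<close>
  and \<open>sinh p - t\<close>, with \<open>v\<close> standing for \<open>exp (- p)\<close>; both
  are \<open>1 / 2\<close> at \<open>v = 0\<close>.\<close>

lemma Ck_transport_translation: "Ck k UNIV (\<lambda>y. transport (\<lambda>x. x + fst y) (snd y))"
proof (rule Ck_transport[where \<alpha> = "\<lambda>t x. x + t"
      and m = "\<lambda>t v. (1 - v * v) / 2 + v * t" and m' = "\<lambda>t v. (1 - v * v) / 2 - v * t"])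
  show "sinh p + t = ((1 - exp (- p) * exp (- p)) / 2 + exp (- p) * t) * exp p"
    and "- (- sinh p + t) = ((1 - exp (- p) * exp (- p)) / 2 - exp (- p) * t) * exp p" for t p :: real
    by (simp_all add: sinh_exp[of p] distrib_right left_diff_distrib flip: exp_add)
qed (auto intro!: Ck_intros)

lemma Ck_transport_dilation: "Ck k UNIV (\<lambda>y. transport (\<lambda>x. exp (fst y) * x) (snd y))"
proof (rule Ck_transport[where \<alpha> = "\<lambda>t x. exp t * x"
      and m = "\<lambda>t v. exp t * ((1 - v * v) / 2)" and m' = "\<lambda>t v. exp t * ((1 - v * v) / 2)"])
  show "exp t * sinh p = exp t * ((1 - exp (- p) * exp (- p)) / 2) * exp p"
    and "- (exp t * - sinh p) = exp t * ((1 - exp (- p) * exp (- p)) / 2) * exp p" for t p :: real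
    by (simp_all add: sinh_exp[of p])
qed (auto intro!: Ck_intros)

section \<open>Radial flows on Euclidean space\<close>

text \<open>\<open>transport \<alpha>\<close> acting on the distance from \<open>c\<close>, with
  directions kept: the interval of half-length \<open>pi / 2\<close> becomes the band of radii
  within \<open>\<mu> * (pi / 2)\<close> of \<open>R\<close>. In dimension one the shell is a pair
  of intervals.\<close>

definition shell ::
  "'e::euclidean_space \<Rightarrow> real \<Rightarrow> real \<Rightarrow> (real \<Rightarrow> real) \<Rightarrow> 'e \<Rightarrow> 'e" where
  "shell c R \<mu> \<alpha> x =
     c + ((R + \<mu> * transport \<alpha> ((norm (x - c) - R) / \<mu>)) / norm (x - c)) *\<^sub>R (x - c)"

lemma shell_center: "shell c R \<mu> \<alpha> c = c"
  by (simp add: shell_def)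

lemma shell_outside:
  assumes "\<mu> > 0" "\<bar>norm (x - c) - R\<bar> \<ge> \<mu> * (pi / 2)"
  shows "shell c R \<mu> \<alpha> x = x"
proof (cases "x = c")
  case False
  have "\<bar>(norm (x - c) - R) / \<mu>\<bar> \<ge> pi / 2"
    using assms by (simp add: abs_divide pos_le_divide_eq mult.commute)
  then show ?thesis using False assms(1) by (simp add: shell_def transport_outside)
qed (simp add: shell_center)

lemma transport_scaled_bounds:
  assumes "\<mu> > 0" "\<bar>r - R\<bar> < \<mu> * (pi / 2)"
  shows "\<bar>(R + \<mu> * transport \<alpha> ((r - R) / \<mu>)) - R\<bar> < \<mu> * (pi / 2)"
proof -
  have "\<bar>(r - R) / \<mu>\<bar> < pi / 2"
    using assms by (simp add: abs_divide pos_divide_less_eq mult.commute)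
  from transport_bounds[OF this, of \<alpha>] show ?thesis
    using assms(1) by (simp add: abs_mult)
qed

lemma norm_shell:
  assumes "\<mu> > 0" "R > \<mu> * (pi / 2)" "x \<noteq> c"
  shows "norm (shell c R \<mu> \<alpha> x - c) = R + \<mu> * transport \<alpha> ((norm (x - c) - R) / \<mu>)"
proof -
  let ?r = "R + \<mu> * transport \<alpha> ((norm (x - c) - R) / \<mu>)"
  have "?r > 0"
  proof (cases "\<bar>norm (x - c) - R\<bar> < \<mu> * (pi / 2)")
    case True
    from transport_scaled_bounds[OF assms(1) this, of \<alpha>] show ?thesis using assms(2) by linarith
  next
    case False
    then have "\<bar>(norm (x - c) - R) / \<mu>\<bar> \<ge> pi / 2"
      using assms by (simp add: abs_divide pos_le_divide_eq mult.commute)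
    then show ?thesis using assms(1,3) by (simp add: transport_outside)
  qed
  then show ?thesis using assms(3) by (simp add: shell_def)
qed

lemma shell_inside:
  assumes "\<mu> > 0" "R > \<mu> * (pi / 2)" "\<bar>norm (x - c) - R\<bar> < \<mu> * (pi / 2)"
  shows "\<bar>norm (shell c R \<mu> \<alpha> x - c) - R\<bar> < \<mu> * (pi / 2)"
proof -
  have "x \<noteq> c" using assms by auto
  then show ?thesis
    using norm_shell[OF assms(1,2)] transport_scaled_bounds[OF assms(1,3)] by metis
qed

lemma shell_comp:
  assumes "\<mu> > 0" "R > \<mu> * (pi / 2)"
  shows "shell c R \<mu> \<alpha> (shell c R \<mu> \<beta> x) = shell c R \<mu> (\<lambda>x. \<alpha> (\<beta> x)) x"
proof (cases "x = c")
  case False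
  define r where "r = norm (x - c)"
  define r' where "r' = norm (shell c R \<mu> \<beta> x - c)"
  have r': "r' = R + \<mu> * transport \<beta> ((r - R) / \<mu>)"
    unfolding r'_def r_def by (rule norm_shell[OF assms False])
  have "shell c R \<mu> \<beta> x - c = (r' / r) *\<^sub>R (x - c)"
    unfolding r' by (simp add: shell_def r_def)
  moreover have "r' \<noteq> 0"
  proof
    assume "r' = 0"
    then have "shell c R \<mu> \<beta> x = c" by (simp add: r'_def)
    moreover have "\<not> \<bar>norm (x - c) - R\<bar> < \<mu> * (pi / 2)"
      using shell_inside[OF assms, of x c \<beta>] \<open>r' = 0\<close> assms by (auto simp: r'_def)
    ultimately show False using shell_outside[OF assms(1), of x c R \<beta>] False by auto
  qed
  moreover have "(r' - R) / \<mu> = transport \<beta> ((r - R) / \<mu>)" using assms(1) by (simp add: r')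
  ultimately have "shell c R \<mu> \<alpha> (shell c R \<mu> \<beta> x) =
      c + ((R + \<mu> * transport \<alpha> (transport \<beta> ((r - R) / \<mu>))) / r) *\<^sub>R (x - c)"
    unfolding shell_def[of c R \<mu> \<alpha> "shell c R \<mu> \<beta> x"] r'_def[symmetric] by simp
  then show ?thesis by (simp add: transport_comp shell_def r_def)
qed (simp add: shell_center)

lemma shell_id: "\<mu> > 0 \<Longrightarrow> shell c R \<mu> (\<lambda>x. x) x = x"
  by (cases "x = c") (simp_all add: shell_def transport_id)

text \<open>Each map is the identity off its own band of radii and preserves that band.\<close>

lemma shell_commute:
  assumes \<mu>: "\<mu> > 0" "\<mu>' > 0" and R: "R > \<mu> * (pi / 2)" "R' > \<mu>' * (pi / 2)"
    and disjoint: "\<bar>R - R'\<bar> \<ge> \<mu> * (pi / 2) + \<mu>' * (pi / 2)"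
  shows "shell c R \<mu> \<alpha> (shell c R' \<mu>' \<beta> x) = shell c R' \<mu>' \<beta> (shell c R \<mu> \<alpha> x)"
proof (cases "\<bar>norm (x - c) - R\<bar> < \<mu> * (pi / 2)")
  case True
  then have "\<bar>norm (x - c) - R'\<bar> \<ge> \<mu>' * (pi / 2)" using disjoint by linarith
  moreover have "\<bar>norm (shell c R \<mu> \<alpha> x - c) - R'\<bar> \<ge> \<mu>' * (pi / 2)"
    using shell_inside[OF \<mu>(1) R(1) True, of \<alpha>] disjoint by linarith
  ultimately show ?thesis using \<mu> by (simp add: shell_outside)
next
  case False
  then have x: "shell c R \<mu> \<alpha> x = x" using \<mu> by (simp add: shell_outside)
  have "\<bar>norm (shell c R' \<mu>' \<beta> x - c) - R\<bar> \<ge> \<mu> * (pi / 2)"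
  proof (cases "\<bar>norm (x - c) - R'\<bar> < \<mu>' * (pi / 2)")
    case True
    then show ?thesis using shell_inside[OF \<mu>(2) R(2) True, of \<beta>] disjoint by linarith
  next
    case F: False
    then show ?thesis using False \<mu> by (simp add: shell_outside)
  qed
  then show ?thesis using \<mu> by (simp add: x shell_outside)
qed

text \<open>The norm is not smooth at \<open>c\<close>, but \<open>R > \<mu> * (pi / 2)\<close>
  leaves a ball around \<open>c\<close> on which the map is the identity at all times.\<close>

lemma Ck_shell:
  assumes "\<mu> > 0" "R > \<mu> * (pi / 2)"
    and "Ck k UNIV (\<lambda>y. transport (\<alpha> (fst y)) (snd y))"
  shows "Ck k UNIV (\<lambda>y. shell c R \<mu> (\<alpha> (fst y :: real)) (snd y))"
proof (rule Ck_local)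
  fix y0 :: "real \<times> 'a"
  show "\<exists>T. open T \<and> y0 \<in> T \<and> Ck k T (\<lambda>y. shell c R \<mu> (\<alpha> (fst y)) (snd y))"
  proof (cases "snd y0 = c")
    case True
    define T :: "(real \<times> 'a) set" where "T = UNIV \<times> ball c (R - \<mu> * (pi / 2))"
    have T: "open T" unfolding T_def by (intro open_Times) auto
    have "Ck k T (\<lambda>y. shell c R \<mu> (\<alpha> (fst y)) (snd y))"
    proof (rule Ck_cong[OF T _ Ck_snd[OF T]])
      fix y assume "y \<in> T"
      then have "norm (snd y - c) < R - \<mu> * (pi / 2)"
        by (auto simp: T_def dist_norm norm_minus_commute)
      then show "snd y = shell c R \<mu> (\<alpha> (fst y)) (snd y)"
        using assms by (intro shell_outside[symmetric]) linarith+
    qed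
    then show ?thesis using T True assms(2) by (intro exI[of _ T]) (auto simp: T_def mem_Times_iff)
  next
    case False
    define T :: "(real \<times> 'a) set" where "T = UNIV \<times> (- {c})"
    have T: "open T" unfolding T_def by (intro open_Times) auto
    have nz: "snd y - c \<noteq> 0" if "y \<in> T" for y using that by (auto simp: T_def)
    have "Ck k T (\<lambda>y. (fst y, (norm (snd y - c) - R) / \<mu>))"
      by (intro Ck_intros T nz) (use assms in auto)
    from Ck_compose[OF T open_UNIV _ this assms(3)]
    have "Ck k T (\<lambda>y. transport (\<alpha> (fst y)) ((norm (snd y - c) - R) / \<mu>))" by simp
    then have "Ck k T (\<lambda>y. shell c R \<mu> (\<alpha> (fst y)) (snd y))"
      unfolding shell_def using nz by (intro Ck_intros T) auto
    then show ?thesis using T False by (intro exI[of _ T]) (auto simp: T_def mem_Times_iff)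
  qed
qed

text \<open>Smoothness is joint in time and space: this yields the continuity of the flow in time
  with respect to all C^k topologies.\<close>

definition smooth_flow :: "'e::euclidean_space set \<Rightarrow> (real \<Rightarrow> 'e \<Rightarrow> 'e) \<Rightarrow> bool" where
  "smooth_flow K F \<longleftrightarrow> (\<forall>k. Ck k UNIV (\<lambda>y. F (fst y) (snd y))) \<and>
     (\<forall>s t x. F (s + t) x = F s (F t x)) \<and> (\<forall>x. F 0 x = x) \<and> (\<forall>t x. x \<notin> K \<longrightarrow> F t x = x)"

lemma smooth_flow_invariant:
  assumes "smooth_flow K F" "x \<in> K"
  shows "F t x \<in> K"
proof (rule ccontr)
  assume "F t x \<notin> K"
  then have "F (- t) (F t x) = F t x" using assms(1) by (simp add: smooth_flow_def)
  moreover have "F (- t) (F t x) = x"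
    using assms(1) unfolding smooth_flow_def by (metis add.left_inverse)
  ultimately show False using \<open>F t x \<notin> K\<close> assms(2) by simp
qed

abbreviation "shift_flow c R \<mu> t \<equiv> shell c R \<mu> (\<lambda>x. x + t)"
abbreviation "dilation_flow c R \<mu> s \<equiv> shell c R \<mu> (\<lambda>x. exp s * x)"

lemma
  assumes "\<mu> > 0" "R > \<mu> * (pi / 2)" "R + \<mu> * (pi / 2) \<le> \<rho>"
  shows smooth_flow_shift: "smooth_flow (cball c \<rho>) (shift_flow c R \<mu>)"
    and smooth_flow_dilation: "smooth_flow (cball c \<rho>) (dilation_flow c R \<mu>)"
proof -
  have out: "shell c R \<mu> \<alpha> x = x" if "x \<notin> cball c \<rho>" for \<alpha> x
  proof (rule shell_outside[OF assms(1)])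
    have "norm (x - c) > \<rho>" using that by (simp add: dist_norm norm_minus_commute)
    then show "\<bar>norm (x - c) - R\<bar> \<ge> \<mu> * (pi / 2)" using assms(3) by linarith
  qed
  show "smooth_flow (cball c \<rho>) (shift_flow c R \<mu>)"
    unfolding smooth_flow_def
    by (intro conjI allI impI Ck_shell[OF assms(1,2) Ck_transport_translation])
      (simp_all add: shell_comp[OF assms(1,2)] shell_id[OF assms(1)] out add_ac)
  have "(\<lambda>x. exp (s + t) * x) = (\<lambda>x. exp s * (exp t * x))" "(\<lambda>x. exp 0 * x) = (\<lambda>x. x)" for s t :: real
    by (auto simp: exp_add)
  note exp_rules = this
  show "smooth_flow (cball c \<rho>) (dilation_flow c R \<mu>)"
    unfolding smooth_flow_def
    by (intro conjI allI impI Ck_shell[OF assms(1,2) Ck_transport_dilation])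
      (simp_all only: shell_comp[OF assms(1,2)] shell_id[OF assms(1)] out exp_rules not_False_eq_True)
qed

lemma dilation_shift_conj:
  assumes "\<mu> > 0" "R > \<mu> * (pi / 2)"
  shows "dilation_flow c R \<mu> s (shift_flow c R \<mu> t x) =
    shift_flow c R \<mu> (exp s * t) (dilation_flow c R \<mu> s x)"
  by (simp add: shell_comp[OF assms] distrib_left)

text \<open>A shell centred at \<open>p\<close> that contains both radii \<open>norm (q - p)\<close>
  and \<open>\<rho>\<close> does it: in the coordinate \<open>\<Theta>\<close> the shift flow is
  translation, hence transitive on the radii of the band, while the centre stays fixed.\<close>

lemma exists_smooth_flow_pushing:
  fixes p q :: "'e::euclidean_space"
  assumes "p \<noteq> q" "norm (q - p) < \<rho>"
  obtains F t where "smooth_flow (cball p (2 * \<rho>)) F" "\<And>t. F t p = p" "norm (F t q - p) = \<rho>"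
proof -
  define a where "a = norm (q - p) / 2"
  \<comment> \<open>These values make the band consist of the radii between \<open>a\<close> and
    \<open>2 * \<rho>\<close>; it contains \<open>2 * a = norm (q - p)\<close> and
    \<open>\<rho>\<close>.\<close>
  define \<mu> where "\<mu> = (2 * \<rho> - a) / pi"
  define R where "R = (a + 2 * \<rho>) / 2"
  have a: "0 < a" "2 * a < \<rho>" "norm (q - p) = 2 * a" using assms by (auto simp: a_def)
  have \<mu>: "\<mu> > 0" "\<mu> * (pi / 2) = (2 * \<rho> - a) / 2" using a by (auto simp: \<mu>_def)
  have R: "R > \<mu> * (pi / 2)" "R + \<mu> * (pi / 2) \<le> 2 * \<rho>" 
    using a unfolding \<mu>(2) R_def by (simp_all add: field_simps)
  define z0 where "z0 = (2 * a - R) / \<mu>"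
  define z1 where "z1 = (\<rho> - R) / \<mu>"
  have z: "\<bar>z0\<bar> < pi / 2" "\<bar>z1\<bar> < pi / 2"
    unfolding z0_def z1_def abs_divide using \<mu> a
    by (auto simp: pos_divide_less_eq mult.commute[of "pi / 2"] R_def abs_less_iff field_simps)
  define \<Theta> where "\<Theta> = (\<lambda>z. sinh (sinh (tan z)) :: real)"
  define t where "t = \<Theta> z1 - \<Theta> z0"
  have "transport (\<lambda>x. x + t) z0 = z1"
    using z by (simp add: transport_def t_def \<Theta>_def arsinh_sinh_real arctan_tan abs_less_iff)
  then have "norm (shift_flow p R \<mu> t q - p) = R + \<mu> * z1"
    using norm_shell[OF \<mu>(1) R(1), of q p "\<lambda>x. x + t"] assms(1) a(3) by (simp add: z0_def)
  then have "norm (shift_flow p R \<mu> t q - p) = \<rho>" using \<mu>(1) by (simp add: z1_def)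
  then show thesis using that smooth_flow_shift[OF \<mu>(1) R, of p] shell_center by blast
qed

lemma shift_flow_nontrivial:
  fixes c :: "'e::euclidean_space"
  assumes "\<mu> > 0" "R > \<mu> * (pi / 2)"
  obtains x where "norm (x - c) = R" "shift_flow c R \<mu> 1 x \<noteq> x"
proof -
  obtain v :: 'e where v: "v \<in> Basis" using nonempty_Basis by blast
  have R: "R > 0" using assms pi_gt_zero by (smt (verit) mult_pos_pos half_gt_zero)
  define x where "x = c + R *\<^sub>R v"
  have x: "norm (x - c) = R" using v R by (simp add: x_def)
  moreover have "x \<noteq> c" using x R by auto
  ultimately have "norm (shift_flow c R \<mu> 1 x - c) = R + \<mu> * transport (\<lambda>x. x + 1) 0"
    using norm_shell[OF assms, of x c "\<lambda>x. x + 1"] by simp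
  moreover have "transport (\<lambda>x. x + 1) 0 \<noteq> 0" by (simp add: transport_def)
  ultimately have "shift_flow c R \<mu> 1 x \<noteq> x" using x assms(1) by auto
  with x show thesis using that by blast
qed

section \<open>Convergence of iterated derivatives\<close>

lemma frechet_derivative_cong:
  assumes "open S" "x \<in> S" "\<And>x. x \<in> S \<Longrightarrow> f x = g x"
  shows "frechet_derivative f (at x) = frechet_derivative g (at x)"
proof -
  have "(f has_derivative D) (at x) \<longleftrightarrow> (g has_derivative D) (at x)" for D
    using has_derivative_transform_within_open[OF _ assms(1,2)] assms(3) by metis
  then show ?thesis unfolding frechet_derivative_def by simp
qed

lemma iter_deriv_cong:
  assumes "open S" "\<And>x. x \<in> S \<Longrightarrow> f x = g x" "x \<in> S"
  shows "iter_deriv vs f x = iter_deriv vs g x"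
  using assms(3)
proof (induction vs arbitrary: x)
  case (Cons v vs)
  have "frechet_derivative (iter_deriv vs f) (at x) = frechet_derivative (iter_deriv vs g) (at x)"
    by (rule frechet_derivative_cong[OF assms(1) Cons.prems Cons.IH])
  then show ?case by simp
qed (simp add: assms(2))

lemma iter_deriv_differentiable:
  assumes "Ck n S g" "length vs < n" "x \<in> S"
  shows "(iter_deriv vs g has_derivative frechet_derivative (iter_deriv vs g) (at x)) (at x)"
  using assms by (simp add: Ck_iff_iter_deriv frechet_derivative_works[symmetric])

lemma iter_deriv_linear_combination:
  assumes "open S" "\<And>b. b \<in> B \<Longrightarrow> Ck n S (g b)" "length vs \<le> n" "x \<in> S"
  shows "iter_deriv vs (\<lambda>x. \<Sum>b\<in>B. c b *\<^sub>R g b x) x = (\<Sum>b\<in>B. c b *\<^sub>R iter_deriv vs (g b) x)"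
  using assms(3,4)
proof (induction vs arbitrary: x)
  case (Cons v vs)
  have "frechet_derivative (iter_deriv vs (\<lambda>x. \<Sum>b\<in>B. c b *\<^sub>R g b x)) (at x) =
      frechet_derivative (\<lambda>x. \<Sum>b\<in>B. c b *\<^sub>R iter_deriv vs (g b) x) (at x)"
    by (rule frechet_derivative_cong[OF assms(1) Cons.prems(2)]) (use Cons in simp)
  also have "\<dots> = (\<lambda>v. \<Sum>b\<in>B. c b *\<^sub>R frechet_derivative (iter_deriv vs (g b)) (at x) v)"
    by (rule frechet_derivative_at[symmetric],
        intro has_derivative_sum has_derivative_scaleR_right iter_deriv_differentiable[OF assms(2)])
      (use Cons.prems in auto)
  finally show ?case by simp
qed simp

text \<open>Spatial derivatives at a fixed time are joint derivatives in directions
  \<open>(0, v)\<close>, so their dependence on time is part of the joint continuity.\<close>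

lemma iter_deriv_slice:
  fixes F :: "real \<times> 'a::euclidean_space \<Rightarrow> 'b::euclidean_space"
  assumes "open \<Omega>" "Ck n \<Omega> F" "length vs \<le> n" "(t, y) \<in> \<Omega>"
  shows "iter_deriv vs (\<lambda>y. F (t, y)) y = iter_deriv (map (Pair 0) vs) F (t, y)"
  using assms(3,4)
proof (induction vs arbitrary: y)
  case (Cons v vs)
  let ?G = "iter_deriv (map (Pair 0) vs) F"
  have "open (Pair t -` \<Omega>)" using assms(1) by (intro open_vimage continuous_intros) auto
  then have "frechet_derivative (iter_deriv vs (\<lambda>y. F (t, y))) (at y) =
      frechet_derivative (\<lambda>y. ?G (t, y)) (at y)"
    by (rule frechet_derivative_cong) (use Cons in auto)
  also have "\<dots> = (\<lambda>v. frechet_derivative ?G (at (t, y)) (0, v))"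
  proof (rule frechet_derivative_at[symmetric])
    have "((\<lambda>y. (t, y)) has_derivative (\<lambda>v. (0, v))) (at y)"
      by (auto intro!: derivative_eq_intros)
    from has_derivative_compose[OF this iter_deriv_differentiable[OF assms(2), of "map (Pair 0) vs"]]
    show "((\<lambda>y. ?G (t, y)) has_derivative (\<lambda>v. frechet_derivative ?G (at (t, y)) (0, v))) (at y)"
      using Cons.prems by simp
  qed
  finally show ?case by simp
qed simp

text \<open>Continuity in the base point is given for fixed directions only. Varying directions are
  reduced to fixed ones by multilinearity, one direction at a time.\<close>

lemma iter_deriv_tendsto:
  assumes "open S" "Ck n S g" "\<And>j. length (vs j) = n" "length ws = n"
    and "\<And>i. i < n \<Longrightarrow> (\<lambda>j. vs j ! i) \<longlonglongrightarrow> ws ! i"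
    and "y \<longlonglongrightarrow> y0" "y0 \<in> S"
  shows "(\<lambda>j. iter_deriv (vs j) g (y j)) \<longlonglongrightarrow> iter_deriv ws g y0"
  using assms(2-5)
proof (induction n arbitrary: g vs ws)
  case 0
  then have "isCont g y0" using assms(1,7) by (simp add: continuous_on_eq_continuous_at)
  then show ?case using assms(6) 0 by (simp add: isCont_tendsto_compose)
next
  case (Suc n)
  \<comment> \<open>The last direction belongs to the innermost derivative; removing it leaves
    derivatives of \<open>?D b\<close>, to which the induction hypothesis applies.\<close>
  define us where "us j = butlast (vs j)" for j
  define v where "v j = last (vs j)" for j
  have vs: "vs j = us j @ [v j]" "length (us j) = n" for j
    using Suc.prems(2)[of j] by (auto simp: us_def v_def intro!: append_butlast_last_id[symmetric])
  obtain us' v' where ws: "ws = us' @ [v']" "length us' = n"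
    using Suc.prems(3) by (metis length_Suc_conv_rev)
  have lim: "(\<lambda>j. us j ! i) \<longlonglongrightarrow> us' ! i" if "i < n" for i
    using Suc.prems(4)[of i] that by (simp add: vs ws nth_append)
  have limv: "v \<longlonglongrightarrow> v'" using Suc.prems(4)[of n] by (simp add: vs ws nth_append)
  let ?D = "\<lambda>b x. frechet_derivative g (at x) b"
  have D: "Ck n S (?D b)" for b using Suc.prems(1) by simp
  have expand: "iter_deriv (u @ [a]) g x = (\<Sum>b\<in>Basis. (a \<bullet> b) *\<^sub>R iter_deriv u (?D b) x)"
    if "x \<in> S" "length u = n" for u a x
  proof -
    have "?D a x = (\<Sum>b\<in>Basis. (a \<bullet> b) *\<^sub>R ?D b x)" if "x \<in> S" for x
    proof -
      interpret linear "frechet_derivative g (at x)"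
        using Ck_SucD_derivative[OF Suc.prems(1) that] has_derivative_linear by blast
      have "?D a x = ?D (\<Sum>b\<in>Basis. (a \<bullet> b) *\<^sub>R b) x" by (simp add: euclidean_representation)
      then show ?thesis by (simp only: sum scale)
    qed
    then have "iter_deriv u (?D a) x = iter_deriv u (\<lambda>x. \<Sum>b\<in>Basis. (a \<bullet> b) *\<^sub>R ?D b x) x"
      by (rule iter_deriv_cong[OF assms(1) _ that(1)])
    then show ?thesis
      using iter_deriv_linear_combination[OF assms(1) D _ that(1), where B = Basis and vs = u and c = "\<lambda>b. a \<bullet> b"] that(2)
      by (simp add: iter_deriv_append)
  qed
  have ev: "eventually (\<lambda>j. y j \<in> S) sequentially"
    using topological_tendstoD[OF assms(6,1,7)] .
  have "(\<lambda>j. \<Sum>b\<in>Basis. (v j \<bullet> b) *\<^sub>R iter_deriv (us j) (?D b) (y j)) \<longlonglongrightarrow>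
      (\<Sum>b\<in>Basis. (v' \<bullet> b) *\<^sub>R iter_deriv us' (?D b) y0)"
    by (intro tendsto_sum tendsto_scaleR tendsto_inner limv tendsto_const
        Suc.IH[OF D vs(2) ws(2)] lim)
  then show ?case
    unfolding ws(1) expand[OF assms(7) ws(2)]
    by (rule Lim_transform_eventually)
      (rule eventually_mono[OF ev], simp only: vs(1) expand[OF _ vs(2)])
qed

lemma convergent_subsequence_bounded_lists:
  fixes vs :: "nat \<Rightarrow> 'a::euclidean_space list"
  assumes "\<And>j. length (vs j) = n" "\<And>j. \<forall>v\<in>set (vs j). norm v \<le> 1"
  shows "\<exists>\<sigma> ws. strict_mono (\<sigma> :: nat \<Rightarrow> nat) \<and> length ws = n \<and>
    (\<forall>i<n. (\<lambda>j. vs (\<sigma> j) ! i) \<longlonglongrightarrow> ws ! i)"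
  using assms
proof (induction n arbitrary: vs)
  case 0
  show ?case by (rule exI[of _ id]) (auto simp: strict_mono_def)
next
  case (Suc n)
  have hd_tl: "vs j = hd (vs j) # tl (vs j)" for j
    using Suc.prems(1)[of j] by (cases "vs j") auto
  have "length (tl (vs j)) = n" "\<forall>v\<in>set (tl (vs j)). norm v \<le> 1" for j
    using Suc.prems(1,2)[of j] by (cases "vs j"; auto)+
  from Suc.IH[of "\<lambda>j. tl (vs j)", OF this] obtain \<sigma> ws where \<sigma>: "strict_mono (\<sigma> :: nat \<Rightarrow> nat)"
    "length ws = n" "\<forall>i<n. (\<lambda>j. tl (vs (\<sigma> j)) ! i) \<longlonglongrightarrow> ws ! i"
    by blast
  have "hd (vs j) \<in> cball 0 1" for j
    using Suc.prems(2)[of j] hd_tl[of j] by (metis dist_0_norm list.set_intros(1) mem_cball)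
  then obtain w \<tau> where \<tau>: "strict_mono (\<tau> :: nat \<Rightarrow> nat)" "(\<lambda>j. hd (vs (\<sigma> (\<tau> j)))) \<longlonglongrightarrow> w"
    using compact_cball[of 0 1, unfolded compact_def, rule_format, of "\<lambda>j. hd (vs (\<sigma> j))"]
    by (auto simp: o_def)
  have "(\<lambda>j. vs ((\<sigma> \<circ> \<tau>) j) ! i) \<longlonglongrightarrow> (w # ws) ! i" if "i < Suc n" for i
  proof (cases i)
    case 0
    then show ?thesis using \<tau>(2) hd_tl by (metis (no_types, lifting) comp_apply ext nth_Cons_0)
  next
    case (Suc m)
    then have "(\<lambda>j. tl (vs (\<sigma> j)) ! m) \<longlonglongrightarrow> ws ! m" using \<sigma>(3) that by auto
    from LIMSEQ_subseq_LIMSEQ[OF this \<tau>(1)] have "(\<lambda>j. tl (vs (\<sigma> (\<tau> j))) ! m) \<longlonglongrightarrow> ws ! m"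
      by (simp add: o_def)
    moreover have "tl (vs j) ! m = vs j ! i" for j
      using hd_tl[of j] Suc by (metis nth_Cons_Suc)
    ultimately show ?thesis using Suc by simp
  qed
  then show ?case using \<sigma>(2) strict_mono_o[OF \<sigma>(1) \<tau>(1)]
    by (intro exI[of _ "\<sigma> \<circ> \<tau>"] exI[of _ "w # ws"]) (auto simp: o_def)
qed

text \<open>A compactness argument over \<open>K\<close> times the unit balls of directions:
  failures at times tending to 0 would accumulate at a point and directions where the strict
  inequality \<open>close\<close> holds at time 0.\<close>

lemma eventually_iter_deriv_close:
  fixes F :: "real \<times> 'a::euclidean_space \<Rightarrow> 'b::euclidean_space"
  assumes \<Omega>: "open \<Omega>" "Ck n \<Omega> F" and S: "open S" "Ck n S f"
    and K: "compact K" "K \<subseteq> S" "Pair 0 ` K \<subseteq> \<Omega>"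
    and close: "\<And>x vs. x \<in> K \<Longrightarrow> length vs = n \<Longrightarrow> \<forall>v\<in>set vs. norm v \<le> 1 \<Longrightarrow>
      norm (iter_deriv vs (\<lambda>y. F (0, y)) x - iter_deriv vs f x) < \<epsilon>"
  shows "eventually (\<lambda>t. \<forall>x\<in>K. (t, x) \<in> \<Omega> \<and> (\<forall>vs. length vs = n \<and> (\<forall>v\<in>set vs. norm v \<le> 1) \<longrightarrow>
      norm (iter_deriv vs (\<lambda>y. F (t, y)) x - iter_deriv vs f x) < \<epsilon>)) (nhds 0)"
proof -
  define P where "P = (\<lambda>t x vs. (t, x) \<in> \<Omega> \<and> (length vs = n \<and> (\<forall>v\<in>set vs. norm v \<le> 1) \<longrightarrow>
      norm (iter_deriv vs (\<lambda>y. F (t, y)) x - iter_deriv vs f x) < \<epsilon>))"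
  have "eventually (\<lambda>t. \<forall>x\<in>K. \<forall>vs. P t x vs) (nhds 0)"
  proof (rule ccontr)
    assume neg: "\<not> ?thesis"
    have "\<exists>t. dist t 0 < inverse (real (Suc j)) \<and> (\<exists>x\<in>K. \<exists>vs. \<not> P t x vs)" for j
    proof -
      have "\<not> (\<forall>t. dist t 0 < inverse (real (Suc j)) \<longrightarrow> (\<forall>x\<in>K. \<forall>vs. P t x vs))"
        using neg positive_imp_inverse_positive[of "real (Suc j)"] unfolding eventually_nhds_metric by auto
      then show ?thesis by blast
    qed
    then obtain t where t: "\<And>j. dist (t j) 0 < inverse (real (Suc j))"
      and "\<And>j. \<exists>x\<in>K. \<exists>vs. \<not> P (t j) x vs" by metis
    then obtain x vs where x: "\<And>j. x j \<in> K" and bad: "\<And>j. \<not> P (t j) (x j) (vs j)" by metis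
    have t0: "t \<longlonglongrightarrow> 0"
    proof (subst tendsto_dist_iff, rule tendsto_sandwich[OF _ _ tendsto_const LIMSEQ_inverse_real_of_nat])
      show "eventually (\<lambda>j. dist (t j) 0 \<le> inverse (real (Suc j))) sequentially"
        using t by (intro always_eventually allI less_imp_le)
    qed simp
    \<comment> \<open>A failure may also consist in leaving \<open>\<Omega>\<close>, and then the
      directions are arbitrary. Zeros replace inadmissible lists so that a convergent subsequence
      exists in any case.\<close>
    define ws where "ws j = (if length (vs j) = n \<and> (\<forall>v\<in>set (vs j). norm v \<le> 1)
      then vs j else replicate n 0)" for j
    have "length (ws j) = n" "\<forall>v\<in>set (ws j). norm v \<le> 1" for j
      by (auto simp: ws_def)
    from convergent_subsequence_bounded_lists[of ws, OF this] obtain \<sigma> u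
      where \<sigma>: "strict_mono (\<sigma> :: nat \<Rightarrow> nat)" "length u = n" "\<forall>i<n. (\<lambda>j. ws (\<sigma> j) ! i) \<longlonglongrightarrow> u ! i"
      by blast
    obtain x0 \<tau> where \<tau>: "x0 \<in> K" "strict_mono (\<tau> :: nat \<Rightarrow> nat)" "(\<lambda>j. x (\<sigma> (\<tau> j))) \<longlonglongrightarrow> x0"
      using K(1)[unfolded compact_def, rule_format, of "\<lambda>j. x (\<sigma> j)"] x by (auto simp: o_def)
    define \<kappa> where "\<kappa> = \<sigma> \<circ> \<tau>"
    have \<kappa>: "strict_mono \<kappa>" unfolding \<kappa>_def by (intro strict_mono_o \<sigma> \<tau>)
    have lx: "(\<lambda>j. x (\<kappa> j)) \<longlonglongrightarrow> x0" using \<tau>(3) by (simp add: \<kappa>_def)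
    have lt: "(\<lambda>j. t (\<kappa> j)) \<longlonglongrightarrow> 0" using LIMSEQ_subseq_LIMSEQ[OF t0 \<kappa>] by (simp add: o_def)
    have lw: "(\<lambda>j. ws (\<kappa> j) ! i) \<longlonglongrightarrow> u ! i" if "i < n" for i
      using LIMSEQ_subseq_LIMSEQ[OF _ \<tau>(2)] \<sigma>(3) that unfolding \<kappa>_def o_def by blast
    have wsl: "length (ws j) = n" and wsn: "\<forall>v\<in>set (ws j). norm v \<le> 1" for j
      by (auto simp: ws_def)
    have lw': "(\<lambda>j. map (Pair (0::real)) (ws (\<kappa> j)) ! i) \<longlonglongrightarrow> map (Pair 0) u ! i" if "i < n" for i
      using tendsto_Pair[OF tendsto_const lw[OF that], of "0::real"] that \<sigma>(2) by (simp add: wsl)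
    have x0: "(0, x0) \<in> \<Omega>" "x0 \<in> S" using \<tau>(1) K by auto
    have ev: "eventually (\<lambda>j. (t (\<kappa> j), x (\<kappa> j)) \<in> \<Omega>) sequentially"
      using topological_tendstoD[OF tendsto_Pair[OF lt lx] \<Omega>(1) x0(1)] .
    have "(\<lambda>j. iter_deriv (map (Pair 0) (ws (\<kappa> j))) F (t (\<kappa> j), x (\<kappa> j))) \<longlonglongrightarrow>
        iter_deriv (map (Pair 0) u) F (0, x0)"
      by (rule iter_deriv_tendsto[OF \<Omega> _ _ lw' tendsto_Pair[OF lt lx] x0(1)]) (simp_all add: wsl \<sigma>(2))
    moreover have "(\<lambda>j. iter_deriv (ws (\<kappa> j)) f (x (\<kappa> j))) \<longlonglongrightarrow> iter_deriv u f x0"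
      by (rule iter_deriv_tendsto[OF S _ _ lw lx x0(2)]) (simp_all add: wsl \<sigma>(2))
    ultimately have "(\<lambda>j. norm (iter_deriv (map (Pair 0) (ws (\<kappa> j))) F (t (\<kappa> j), x (\<kappa> j))
        - iter_deriv (ws (\<kappa> j)) f (x (\<kappa> j)))) \<longlonglongrightarrow>
        norm (iter_deriv (map (Pair 0) u) F (0, x0) - iter_deriv u f x0)"
      by (intro tendsto_intros)
    moreover have "norm (iter_deriv (map (Pair 0) u) F (0, x0) - iter_deriv u f x0) < \<epsilon>"
    proof -
      have "norm v \<le> 1" if v: "v \<in> set u" for v
      proof -
        obtain i where i: "i < n" "v = u ! i" using v \<sigma>(2) by (auto simp: in_set_conv_nth)
        show ?thesis unfolding i(2)
          by (rule Lim_bounded[OF tendsto_norm[OF lw[OF i(1)]], of 0])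
            (simp add: bspec[OF wsn nth_mem] wsl i(1))
      qed
      then show ?thesis
        using close[OF \<tau>(1) \<sigma>(2)] iter_deriv_slice[OF \<Omega>, of u 0 x0] x0(1) \<sigma>(2) by auto
    qed
    ultimately have "eventually (\<lambda>j. norm (iter_deriv (map (Pair 0) (ws (\<kappa> j))) F (t (\<kappa> j), x (\<kappa> j))
        - iter_deriv (ws (\<kappa> j)) f (x (\<kappa> j))) < \<epsilon>) sequentially"
      using order_tendstoD(2) by blast
    with ev have "eventually (\<lambda>j. P (t (\<kappa> j)) (x (\<kappa> j)) (vs (\<kappa> j))) sequentially"
    proof eventually_elim
      case (elim j)
      then show ?case
        using iter_deriv_slice[OF \<Omega>, of "ws (\<kappa> j)" "t (\<kappa> j)" "x (\<kappa> j)"] wsl[of "\<kappa> j"]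
        unfolding P_def by (auto simp: ws_def)
    qed
    then show False using bad by (auto simp: eventually_sequentially)
  qed
  then show ?thesis by (rule eventually_mono) (auto simp: P_def)
qed

section \<open>Flows supported in a chart\<close>

lemma is_chartD:
  assumes "is_chart M (U, \<phi>)"
  shows "openin M U" "open (\<phi> ` U)" "U \<subseteq> topspace M" "inj_on \<phi> U"
    and "\<And>W. openin M W \<Longrightarrow> W \<subseteq> U \<Longrightarrow> open (\<phi> ` W)"
    and "\<And>W. open W \<Longrightarrow> openin M {x\<in>U. \<phi> x \<in> W}"
    and "\<And>K. K \<subseteq> U \<Longrightarrow> compactin M K \<longleftrightarrow> compact (\<phi> ` K)"
proof -
  show U: "openin M U" "open (\<phi> ` U)" using assms by (auto simp: is_chart_def)
  have h: "homeomorphic_map (subtopology M U) (top_of_set (\<phi> ` U)) \<phi>"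
    using assms by (simp add: is_chart_def)
  show sub: "U \<subseteq> topspace M" using U(1) by (rule openin_subset)
  then have top: "topspace (subtopology M U) = U" by auto
  show "inj_on \<phi> U" using homeomorphic_imp_injective_map[OF h] top by simp
  show "open (\<phi> ` W)" if "openin M W" "W \<subseteq> U" for W
  proof -
    have "openin (subtopology M U) W" using that U(1) by (simp add: openin_open_subtopology)
    then have "openin (top_of_set (\<phi> ` U)) (\<phi> ` W)"
      using homeomorphic_map_openness[OF h, of W] that sub top by auto
    then show ?thesis using U(2) openin_open_trans by blast
  qed
  show "openin M {x\<in>U. \<phi> x \<in> W}" if "open W" for W
  proof -
    have "openin (top_of_set (\<phi> ` U)) (\<phi> ` U \<inter> W)" using that by (auto simp: openin_open)
    from openin_continuous_map_preimage[OF homeomorphic_imp_continuous_map[OF h] this]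
    moreover have "{x\<in>topspace (subtopology M U). \<phi> x \<in> \<phi> ` U \<inter> W} = {x\<in>U. \<phi> x \<in> W}"
      unfolding top by blast
    ultimately have "openin (subtopology M U) {x\<in>U. \<phi> x \<in> W}" by (simp only:)
    then show ?thesis using U(1) by (simp add: openin_open_subtopology)
  qed
  show "compactin M K \<longleftrightarrow> compact (\<phi> ` K)" if "K \<subseteq> U" for K
  proof -
    have "compactin M K \<longleftrightarrow> compactin (subtopology M U) K"
      using that by (simp add: compactin_subtopology)
    also have "\<dots> \<longleftrightarrow> compactin (top_of_set (\<phi> ` U)) (\<phi> ` K)"
      using homeomorphic_map_compactness[OF h, of K] that sub top by auto
    also have "\<dots> \<longleftrightarrow> compact (\<phi> ` K)" using that by (simp add: compactin_subtopology image_mono)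
    finally show ?thesis .
  qed
qed

definition chart_lift :: "'m topology \<Rightarrow> 'm set \<Rightarrow> ('m \<Rightarrow> 'e) \<Rightarrow> ('e \<Rightarrow> 'e) \<Rightarrow> 'm \<Rightarrow> 'm" where
  "chart_lift M U \<phi> f = (\<lambda>x\<in>topspace M. if x \<in> U then inv_into U \<phi> (f (\<phi> x)) else x)"

locale chart_flow =
  fixes M :: "'m topology" and A :: "('m, 'e::euclidean_space) chart set"
    and U :: "'m set" and \<phi> :: "'m \<Rightarrow> 'e" and K :: "'e set" and F :: "real \<Rightarrow> 'e \<Rightarrow> 'e"
  assumes manifold: "smooth_manifold M A" and Hausdorff: "Hausdorff_space M"
    and chart: "(U, \<phi>) \<in> A" and K: "compact K" "K \<subseteq> \<phi> ` U" and F: "smooth_flow K F"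
begin

abbreviation "L t \<equiv> chart_lift M U \<phi> (F t)"

lemma charts: "c \<in> A \<Longrightarrow> is_chart M c"
  using manifold by (auto simp: smooth_manifold_def)

lemmas U = is_chartD[OF charts[OF chart]]

lemma transition:
  assumes "(V, \<psi>) \<in> A" "(V', \<psi>') \<in> A"
  shows "Ck k (\<psi> ` (V \<inter> V')) (\<psi>' \<circ> inv_into V \<psi>)"
proof -
  have "\<forall>(U, \<phi>)\<in>A. \<forall>(V, \<psi>)\<in>A. Cr_on \<infinity> (\<phi> ` (U \<inter> V)) (\<psi> \<circ> inv_into U \<phi>)"
    using manifold unfolding smooth_manifold_def by (elim conjE)
  from bspec[OF this assms(1)]
  have "\<forall>(V', \<psi>')\<in>A. Cr_on \<infinity> (\<psi> ` (V \<inter> V')) (\<psi>' \<circ> inv_into V \<psi>)"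
    by (simp only: case_prod_conv)
  from bspec[OF this assms(2)]
  have "Cr_on \<infinity> (\<psi> ` (V \<inter> V')) (\<psi>' \<circ> inv_into V \<psi>)"
    by (simp only: case_prod_conv)
  then show ?thesis by (simp add: Cr_on_iff_Ck)
qed

lemma F_comp: "F (s + t) x = F s (F t x)" and F_0: "F 0 x = x"
  and F_outside: "x \<notin> K \<Longrightarrow> F t x = x" and F_smooth: "Ck k UNIV (\<lambda>y. F (fst y) (snd y))"
  using F by (auto simp: smooth_flow_def)

lemma F_image: "y \<in> \<phi> ` U \<Longrightarrow> F t y \<in> \<phi> ` U"
  using smooth_flow_invariant[OF F, of y t] F_outside[of y t] K(2) by (cases "y \<in> K") auto

lemma L_chart: "x \<in> U \<Longrightarrow> L t x \<in> U" "x \<in> U \<Longrightarrow> \<phi> (L t x) = F t (\<phi> x)"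
  using F_image[of "\<phi> x" t] U(3) by (auto simp: chart_lift_def inv_into_into f_inv_into_f)

lemma L_outside: "x \<in> topspace M \<Longrightarrow> x \<notin> U \<Longrightarrow> L t x = x"
  by (simp add: chart_lift_def)

lemma L_outside_K: "x \<in> topspace M \<Longrightarrow> \<not> (x \<in> U \<and> \<phi> x \<in> K) \<Longrightarrow> L t x = x"
  using F_outside U(4) by (auto simp: chart_lift_def)

lemma L_topspace: "x \<in> topspace M \<Longrightarrow> L t x \<in> topspace M"
  using L_chart(1)[of x t] L_outside[of x t] U(3) by (cases "x \<in> U") auto

lemma L_comp: "x \<in> topspace M \<Longrightarrow> L (s + t) x = L s (L t x)"
proof (cases "x \<in> U")
  case True
  have "\<phi> (L (s + t) x) = \<phi> (L s (L t x))" using True by (simp add: L_chart F_comp)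
  then show ?thesis by (rule inj_onD[OF U(4)]) (simp_all add: True L_chart(1))
qed (simp add: L_outside)

lemma L_0: "L 0 = (\<lambda>x\<in>topspace M. x)"
  using U(4) by (auto simp: chart_lift_def F_0 restrict_def)

lemma L_inverse: "x \<in> topspace M \<Longrightarrow> L (- t) (L t x) = x"
  using L_comp[of x "- t" t] L_0 by simp

definition supp :: "'m set" where "supp = {x\<in>U. \<phi> x \<in> K}"

text \<open>Here the Hausdorff property enters: a compact support is closed in all of
  \<open>M\<close>, so extending a flow of the chart by the identity creates no discontinuity at the
  boundary of \<open>U\<close>.\<close>

lemma closedin_supp: "closedin M supp"
proof -
  have "\<phi> ` supp = K" using K(2) by (auto simp: supp_def)
  then have "compactin M supp" using U(7)[of supp] K(1) by (auto simp: supp_def)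
  then show ?thesis using Hausdorff compactin_imp_closedin by blast
qed

lemma F_continuous: "continuous_on UNIV (F t)"
proof -
  have "continuous_on UNIV ((\<lambda>y. F (fst y) (snd y)) \<circ> Pair t)"
    using Ck_continuous_on[OF F_smooth]
    by (intro continuous_on_compose continuous_intros) (auto intro: continuous_on_subset)
  then show ?thesis by (simp add: o_def)
qed

lemma L_continuous: "continuous_map M M (L t)"
  unfolding continuous_map
proof (intro conjI allI impI)
  show "L t ` topspace M \<subseteq> topspace M" using L_topspace by blast
  fix W assume W: "openin M W"
  have "open (F t -` (\<phi> ` (U \<inter> W)))"
    using F_continuous U(5)[of "U \<inter> W"] W U(1)
    by (simp add: continuous_on_open_vimage openin_Int)
  then have "openin M {x\<in>U. \<phi> x \<in> F t -` (\<phi> ` (U \<inter> W))}" by (rule U(6))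
  then have "openin M ({x\<in>U. \<phi> x \<in> F t -` (\<phi> ` (U \<inter> W))} \<union> (W - supp))"
    using closedin_supp W by (intro openin_Un openin_diff)
  moreover have "{x\<in>topspace M. L t x \<in> W} = {x\<in>U. \<phi> x \<in> F t -` (\<phi> ` (U \<inter> W))} \<union> (W - supp)"
  proof (intro equalityI subsetI)
    fix x assume x: "x \<in> {x\<in>topspace M. L t x \<in> W}"
    show "x \<in> {x\<in>U. \<phi> x \<in> F t -` (\<phi> ` (U \<inter> W))} \<union> (W - supp)"
    proof (cases "x \<in> U")
      case True
      then have "\<phi> (L t x) \<in> \<phi> ` (U \<inter> W)" using x L_chart(1)[OF True, of t] by (intro imageI) simp
      then show ?thesis using True by (simp add: L_chart(2))
    next
      case False
      then show ?thesis using x L_outside[of x t] by (auto simp: supp_def)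
    qed
  next
    fix x assume x: "x \<in> {x\<in>U. \<phi> x \<in> F t -` (\<phi> ` (U \<inter> W))} \<union> (W - supp)"
    show "x \<in> {x\<in>topspace M. L t x \<in> W}"
    proof (cases "x \<in> W - supp")
      case True
      then have "x \<in> topspace M" using openin_subset[OF W] by auto
      then show ?thesis using True L_outside_K[of x t] by (auto simp: supp_def)
    next
      case False
      then obtain x' where x': "x \<in> U" "x' \<in> U \<inter> W" "F t (\<phi> x) = \<phi> x'" using x by auto
      then have "L t x = x'" using L_chart[OF x'(1), of t] U(4) by (metis IntD1 inj_onD)
      then show ?thesis using x' U(3) by auto
    qed
  qed
  ultimately show "openin M {x\<in>topspace M. L t x \<in> W}" by simp
qed

definition joint_domain :: "('m, 'e) chart \<Rightarrow> ('m, 'e) chart \<Rightarrow> (real \<times> 'e) set" where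
  "joint_domain c c' = {y. snd y \<in> snd c ` fst c \<and> L (fst y) (inv_into (fst c) (snd c) (snd y)) \<in> fst c'}"

definition joint_rep :: "('m, 'e) chart \<Rightarrow> ('m, 'e) chart \<Rightarrow> real \<times> 'e \<Rightarrow> 'e" where
  "joint_rep c c' y = local_rep c c' (L (fst y)) (snd y)"

text \<open>The domain is covered by two open pieces: on \<open>O1\<close> the map is the flow
  between two transition maps through the chart \<open>\<phi>\<close>; on \<open>O2\<close>, off the
  support, it is a bare transition map. Time is an ordinary variable throughout.\<close>

lemma joint_smooth:
  assumes c: "c \<in> A" "c' \<in> A"
  shows "open (joint_domain c c')" "Ck k (joint_domain c c') (joint_rep c c')"
proof -
  obtain V \<psi> where c_eq: "c = (V, \<psi>)" by force
  obtain V' \<psi>' where c'_eq: "c' = (V', \<psi>')" by force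
  have cA: "(V, \<psi>) \<in> A" "(V', \<psi>') \<in> A" using c c_eq c'_eq by auto
  note V = is_chartD[OF charts[OF cA(1)]] and V' = is_chartD[OF charts[OF cA(2)]]
  let ?i = "inv_into V \<psi>"
  have inv: "?i (\<psi> x) = x" if "x \<in> V" for x using that V(4) by simp
  define P :: "(real \<times> 'e) set" where "P = UNIV \<times> \<psi> ` (V \<inter> U)"
  define T :: "real \<times> 'e \<Rightarrow> 'e" where "T = (\<lambda>y. (\<phi> \<circ> ?i) (snd y))"
  define G where "G = (\<lambda>y. F (fst y) (T y))"
  define O1 where "O1 = {y\<in>P. G y \<in> \<phi> ` (U \<inter> V')}"
  define O2 :: "(real \<times> 'e) set" where "O2 = UNIV \<times> \<psi> ` (V \<inter> V' - supp)"
  have VU: "open (\<psi> ` (V \<inter> U))" using V(5)[of "V \<inter> U"] V(1) U(1) by (simp add: openin_Int)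
  then have P: "open P" unfolding P_def by (intro open_Times) auto
  have UV': "open (\<phi> ` (U \<inter> V'))" using U(5)[of "U \<inter> V'"] V'(1) U(1) by (simp add: openin_Int)
  have T: "Ck k P T" for k
    unfolding T_def
    by (rule Ck_compose[OF P VU _ Ck_snd[OF P] transition[OF cA(1) chart]]) (auto simp: P_def)
  have G: "Ck k P G" for k
  proof -
    have "Ck k P (\<lambda>y. (fst y, T y))" by (intro Ck_intros P T)
    from Ck_compose[OF P open_UNIV _ this F_smooth] show ?thesis by (simp add: G_def)
  qed
  have O1: "open O1" "O1 \<subseteq> P"
    using continuous_open_preimage[OF Ck_continuous_on[OF G] P UV']
    by (auto simp: O1_def vimage_def Int_def)
  have O2: "open O2"
    unfolding O2_def using V(5)[of "V \<inter> V' - supp"] V(1) V'(1) closedin_supp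
    by (intro open_Times) (auto intro: openin_diff openin_Int)
  have rep1: "joint_rep c c' y = (\<psi>' \<circ> inv_into U \<phi>) (G y)" if "y \<in> P" for y
  proof -
    obtain t x where y: "y = (t, \<psi> x)" and x: "x \<in> V" "x \<in> U" using \<open>y \<in> P\<close> by (auto simp: P_def)
    have "G y = \<phi> (L t x)" using x by (simp add: G_def T_def y inv L_chart)
    then have "inv_into U \<phi> (G y) = L t x" using inv_into_f_f[OF U(4) L_chart(1)[OF x(2)]] by simp
    then show ?thesis using x by (simp add: joint_rep_def local_rep_def c_eq c'_eq y inv)
  qed
  have rep2: "joint_rep c c' y = (\<psi>' \<circ> ?i) (snd y)" if "y \<in> O2" for y
  proof -
    obtain t x where y: "y = (t, \<psi> x)" and x: "x \<in> V" "x \<in> V'" "x \<notin> supp"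
      using \<open>y \<in> O2\<close> by (auto simp: O2_def)
    then show ?thesis
      using L_outside_K[of x t] V(3) by (auto simp: joint_rep_def local_rep_def c_eq c'_eq inv supp_def)
  qed
  have dom: "joint_domain c c' = O1 \<union> O2"
  proof (intro equalityI subsetI)
    fix y assume "y \<in> joint_domain c c'"
    then obtain t x where y: "y = (t, \<psi> x)" and x: "x \<in> V" "L t x \<in> V'"
      by (cases y) (auto simp: joint_domain_def c_eq c'_eq inv)
    show "y \<in> O1 \<union> O2"
    proof (cases "x \<in> U")
      case True
      have "G y = \<phi> (L t x)" using x True by (simp add: G_def T_def y inv L_chart)
      then show ?thesis using True x L_chart(1)[OF True, of t] by (auto simp: O1_def P_def y)
    next
      case False
      then show ?thesis using x L_outside[of x t] V(3) by (auto simp: O2_def y supp_def)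
    qed
  next
    fix y assume "y \<in> O1 \<union> O2"
    then consider "y \<in> O1" | "y \<in> O2" by blast
    then show "y \<in> joint_domain c c'"
    proof cases
      case 1
      then obtain t x where y: "y = (t, \<psi> x)" and x: "x \<in> V" "x \<in> U" by (auto simp: O1_def P_def)
      have "G y = \<phi> (L t x)" using x by (simp add: G_def T_def y inv L_chart)
      then obtain x' where "x' \<in> U \<inter> V'" "\<phi> (L t x) = \<phi> x'" using 1 by (auto simp: O1_def)
      then have "L t x \<in> V'" using L_chart(1)[OF x(2), of t] U(4) by (metis IntD1 IntD2 inj_onD)
      then show ?thesis using x by (auto simp: joint_domain_def c_eq c'_eq y inv)
    next
      case 2
      then obtain t x where y: "y = (t, \<psi> x)" and x: "x \<in> V" "x \<in> V'" "x \<notin> supp"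
        by (auto simp: O2_def)
      then show ?thesis
        using L_outside_K[of x t] V(3) by (auto simp: joint_domain_def c_eq c'_eq inv supp_def)
    qed
  qed
  have s1: "Ck k O1 (joint_rep c c')"
  proof (rule Ck_cong[OF O1(1)])
    show "Ck k O1 (\<lambda>y. (\<psi>' \<circ> inv_into U \<phi>) (G y))"
      by (rule Ck_compose[OF O1(1) UV' _ Ck_subset[OF G O1(2)] transition[OF chart cA(2)]])
        (auto simp: O1_def)
  qed (use rep1 O1(2) in auto)
  have s2: "Ck k O2 (joint_rep c c')"
  proof (rule Ck_cong[OF O2])
    have "open (\<psi> ` (V \<inter> V'))" using V(5)[of "V \<inter> V'"] V(1) V'(1) by (simp add: openin_Int)
    then show "Ck k O2 (\<lambda>y. (\<psi>' \<circ> ?i) (snd y))"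
      by (rule Ck_compose[OF O2 _ _ Ck_snd[OF O2] transition[OF cA]]) (auto simp: O2_def)
  qed (use rep2 in auto)
  show "open (joint_domain c c')" using O1 O2 by (simp add: dom open_Un)
  show "Ck k (joint_domain c c') (joint_rep c c')"
    unfolding dom by (rule Ck_Un[OF O1(1) O2 s1 s2])
qed

lemma L_Cr_maps: "L t \<in> Cr_maps M A r"
  unfolding Cr_maps_def
proof (intro CollectI conjI L_continuous)
  show "L t \<in> extensional (topspace M)" by (simp add: chart_lift_def)
  have "Cr_on r (snd c ` {x\<in>fst c. L t x \<in> fst c'}) (local_rep c c' (L t))"
    if c: "c \<in> A" "c' \<in> A" for c c'
    unfolding Cr_on_iff_Ck
  proof (intro allI impI)
    fix k
    let ?S = "Pair t -` joint_domain c c'"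
    have S: "?S = snd c ` {x\<in>fst c. L t x \<in> fst c'}"
      using is_chartD(4)[of M "fst c" "snd c"] charts[OF c(1)]
      by (auto simp: joint_domain_def)
    have open_S: "open ?S" using joint_smooth(1)[OF c] by (intro open_vimage continuous_intros) auto
    have "Ck k ?S (\<lambda>y. (t, y))"
      by (intro Ck_intros open_S)
    from Ck_compose[OF open_S joint_smooth(1)[OF c] _ this joint_smooth(2)[OF c]]
    show "Ck k (snd c ` {x\<in>fst c. L t x \<in> fst c'}) (local_rep c c' (L t))"
      unfolding S[symmetric] by (simp add: joint_rep_def)
  qed
  then show "\<forall>(U, \<phi>)\<in>A. \<forall>(V, \<psi>)\<in>A.
        Cr_on r (\<phi> ` {x\<in>U. L t x \<in> V}) (local_rep (U, \<phi>) (V, \<psi>) (L t))"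
    by fastforce
qed

lemma L_bij_betw: "bij_betw (L t) (topspace M) (topspace M)"
  using L_inverse[of _ t] L_inverse[of _ "- t"] L_topspace
  by (intro bij_betwI[where g = "L (- t)"]) auto

lemma L_Bij: "L t \<in> Bij (topspace M)"
  using L_bij_betw by (simp add: Bij_def chart_lift_def)

lemma L_Diff: "L t \<in> Diff M A r"
proof -
  have "restrict (inv_into (topspace M) (L t)) (topspace M) = L (- t)"
  proof
    fix x
    show "restrict (inv_into (topspace M) (L t)) (topspace M) x = L (- t) x"
    proof (cases "x \<in> topspace M")
      case True
      then have "inv_into (topspace M) (L t) (L t (L (- t) x)) = L (- t) x"
        using L_bij_betw L_topspace by (intro inv_into_f_f) (auto simp: bij_betw_def)
      then show ?thesis using True L_inverse[of x "- t"] by simp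
    qed (simp add: chart_lift_def)
  qed
  then show ?thesis unfolding Diff_def using L_Cr_maps L_Bij by simp
qed

lemma L_compose: "compose (topspace M) (L s) (L t) = L (s + t)"
  using L_comp by (auto simp: compose_def chart_lift_def)

text \<open>The generating sets form only a subbase and have arbitrary centres \<open>f\<close>, so
  the statement starts from \<open>L 0\<close> lying in such a set, not from \<open>f\<close> being
  the identity.\<close>

lemma eventually_L_Cr_nbhd:
  assumes id: "L 0 \<in> Cr_nbhd M A r k f c c' Q \<epsilon>"
    and kr: "enat k \<le> r" and f: "f \<in> Cr_maps M A r" and c: "c \<in> A" "c' \<in> A"
    and Q: "compactin M Q" "Q \<subseteq> fst c" "f ` Q \<subseteq> fst c'"
  shows "eventually (\<lambda>t. L t \<in> Cr_nbhd M A r k f c c' Q \<epsilon>) (nhds 0)"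
proof -
  have "is_chart M (fst c, snd c)" using charts[OF c(1)] by simp
  note V = is_chartD[OF this]
  have "is_chart M (fst c', snd c')" using charts[OF c(2)] by simp
  note V' = is_chartD[OF this]
  let ?S = "snd c ` {x\<in>fst c. f x \<in> fst c'}"
  have "openin M {x\<in>topspace M. f x \<in> fst c'}"
    using f V'(1) openin_continuous_map_preimage by (fastforce simp: Cr_maps_def)
  then have "openin M (fst c \<inter> {x\<in>topspace M. f x \<in> fst c'})" using V(1) by (intro openin_Int)
  moreover have "fst c \<inter> {x\<in>topspace M. f x \<in> fst c'} = {x\<in>fst c. f x \<in> fst c'}" using V(3) by auto
  ultimately have S: "open ?S" using V(5) by auto
  have fS: "Ck n ?S (local_rep c c' f)" if "n \<le> k" for n
  proof -
    have "\<forall>(U, \<phi>)\<in>A. \<forall>(V, \<psi>)\<in>A.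
        Cr_on r (\<phi> ` {x\<in>U. f x \<in> V}) (local_rep (U, \<phi>) (V, \<psi>) f)"
      using f by (simp add: Cr_maps_def)
    from bspec[OF bspec[OF this c(1), unfolded case_prod_beta] c(2)]
    have "Cr_on r ?S (local_rep c c' f)" by simp
    then show ?thesis unfolding Cr_on_iff_Ck using kr that order_trans[of "enat n" "enat k" r] by simp
  qed
  have K: "compact (snd c ` Q)" using V(7)[OF Q(2)] Q(1) by simp
  have KS: "snd c ` Q \<subseteq> ?S" using Q by auto
  have inv: "inv_into (fst c) (snd c) (snd c x) = x" if "x \<in> Q" for x
    using inv_into_f_f[OF V(4)] Q(2) that by auto
  have KD: "Pair 0 ` snd c ` Q \<subseteq> joint_domain c c'"
    using id Q(2) by (auto simp: Cr_nbhd_def joint_domain_def inv)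
  have "eventually (\<lambda>t. \<forall>x\<in>snd c ` Q. (t, x) \<in> joint_domain c c' \<and>
      (\<forall>vs. length vs = n \<and> (\<forall>v\<in>set vs. norm v \<le> 1) \<longrightarrow>
      norm (iter_deriv vs (\<lambda>y. joint_rep c c' (t, y)) x - iter_deriv vs (local_rep c c' f) x) < \<epsilon>)) (nhds 0)"
    if "n \<le> k" for n
    by (rule eventually_iter_deriv_close[OF joint_smooth[OF c] S fS[OF that] K KS KD])
      (use id that in \<open>auto simp: Cr_nbhd_def joint_rep_def\<close>)
  then have "eventually (\<lambda>t. \<forall>n\<in>{..k}. \<forall>x\<in>snd c ` Q. (t, x) \<in> joint_domain c c' \<and>
      (\<forall>vs. length vs = n \<and> (\<forall>v\<in>set vs. norm v \<le> 1) \<longrightarrow>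
      norm (iter_deriv vs (\<lambda>y. joint_rep c c' (t, y)) x - iter_deriv vs (local_rep c c' f) x) < \<epsilon>)) (nhds 0)"
    by (intro eventually_ball_finite) auto
  then show ?thesis
  proof (rule eventually_mono)
    fix t
    assume *: "\<forall>n\<in>{..k}. \<forall>x\<in>snd c ` Q. (t, x) \<in> joint_domain c c' \<and>
      (\<forall>vs. length vs = n \<and> (\<forall>v\<in>set vs. norm v \<le> 1) \<longrightarrow>
      norm (iter_deriv vs (\<lambda>y. joint_rep c c' (t, y)) x - iter_deriv vs (local_rep c c' f) x) < \<epsilon>)"
    have "L t x \<in> fst c'" if "x \<in> Q" for x
    proof -
      have "(t, snd c x) \<in> joint_domain c c'" using * that by auto
      then show ?thesis by (simp add: joint_domain_def inv that)
    qed
    then show "L t \<in> Cr_nbhd M A r k f c c' Q \<epsilon>"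
      unfolding Cr_nbhd_def using * L_Cr_maps by (auto simp: joint_rep_def)
  qed
qed

lemma eventually_L_open:
  assumes "openin (Diff_topology M A r) W" "L 0 \<in> W"
  shows "eventually (\<lambda>t. L t \<in> W) (nhds 0)"
proof -
  obtain W' where W': "openin (Cr_topology M A r) W'" "W = W' \<inter> Diff M A r"
    using assms(1) by (auto simp: Diff_topology_def openin_subtopology)
  have "eventually (\<lambda>t. L t \<in> W') (nhds 0)"
    using W'(1)[unfolded Cr_topology_def openin_topology_generated_by_iff] assms(2)[unfolded W'(2), THEN IntD1]
  proof (induction rule: generate_topology_on.induct)
    case (UN \<W>)
    then obtain B where "B \<in> \<W>" "L 0 \<in> B" by blast
    with UN.IH have "eventually (\<lambda>t. L t \<in> B) (nhds 0)" by blast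
    then show ?case by (rule eventually_mono) (use \<open>B \<in> \<W>\<close> in blast)
  next
    case (Basis B)
    then obtain k f c c' Q \<epsilon> where B: "B = Cr_nbhd M A r k f c c' Q \<epsilon>" and *: "enat k \<le> r"
      "f \<in> Cr_maps M A r" "c \<in> A" "c' \<in> A" "compactin M Q" "Q \<subseteq> fst c" "f ` Q \<subseteq> fst c'"
      by blast
    show ?case using eventually_L_Cr_nbhd[OF _ *] Basis.prems unfolding B by blast
  qed (auto intro: eventually_conj)
  then show ?thesis using W'(2) L_Diff by simp
qed

end

section \<open>Commuting affine actions on locally compact metric spaces\<close>

context Metric_space
begin

text \<open>In contrast to \<open>Iso\<close>, values off \<open>M\<close> are unconstrained, so
  that plain composition of functions stays in the set.\<close>

definition isometries :: "('a \<Rightarrow> 'a) set" where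
  "isometries = {g. g ` M = M \<and> (\<forall>x\<in>M. \<forall>y\<in>M. d (g x) (g y) = d x y)}"

definition subconvergent :: "(nat \<Rightarrow> 'a) \<Rightarrow> bool" where
  "subconvergent \<sigma> \<longleftrightarrow> (\<exists>l\<in>M. \<exists>s. strict_mono (s :: nat \<Rightarrow> nat) \<and> (\<lambda>n. d (\<sigma> (s n)) l) \<longlonglongrightarrow> 0)"

definition relc :: "'a \<Rightarrow> real \<Rightarrow> bool" where
  "relc x r \<longleftrightarrow> (\<forall>\<sigma>. (\<forall>n. \<sigma> n \<in> mcball x r) \<longrightarrow> subconvergent \<sigma>)"

text \<open>The pseudo-components of Gao and Kechris: the classes generated by \<open>near\<close> are respected by
  isometries, and on such a class boundedness propagates from a point to all points.\<close>

definition near :: "'a \<Rightarrow> 'a \<Rightarrow> bool" where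
  "near x z \<longleftrightarrow> x \<in> M \<and> z \<in> M \<and> (\<exists>r>d x z. relc x r)"

definition reach :: "'a set \<Rightarrow> 'a set" where
  "reach F = {z. \<exists>y\<in>F. near\<^sup>*\<^sup>* y z}"

lemma isometries_closed: "g \<in> isometries \<Longrightarrow> x \<in> M \<Longrightarrow> g x \<in> M"
  and isometries_dist: "g \<in> isometries \<Longrightarrow> x \<in> M \<Longrightarrow> y \<in> M \<Longrightarrow> d (g x) (g y) = d x y"
  and isometries_surj: "g \<in> isometries \<Longrightarrow> y \<in> M \<Longrightarrow> \<exists>x\<in>M. y = g x"
  unfolding isometries_def by auto

lemma isometries_comp: "g \<in> isometries \<Longrightarrow> h \<in> isometries \<Longrightarrow> (\<lambda>x. g (h x)) \<in> isometries"
  unfolding isometries_def by (auto simp: image_iff) (metis image_iff)+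

lemma compactin_imp_relc:
  assumes "compactin mtopology (mcball x r)"
  shows "relc x r"
  unfolding relc_def subconvergent_def
proof (intro allI impI)
  fix \<sigma> :: "nat \<Rightarrow> 'a" assume "\<forall>n. \<sigma> n \<in> mcball x r"
  then have "range \<sigma> \<subseteq> mcball x r" by auto
  then obtain l s where ls: "l \<in> mcball x r" "strict_mono (s :: nat \<Rightarrow> nat)"
    "limitin mtopology (\<sigma> \<circ> s) l sequentially"
    using assms unfolding compactin_sequentially by blast
  then have "(\<lambda>n. d (\<sigma> (s n)) l) \<longlonglongrightarrow> 0" by (simp add: limitin_metric_dist_null o_def)
  then show "\<exists>l\<in>M. \<exists>s. strict_mono (s :: nat \<Rightarrow> nat) \<and> (\<lambda>n. d (\<sigma> (s n)) l) \<longlonglongrightarrow> 0"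
    using ls by auto
qed

lemma relc_isometry:
  assumes g: "g \<in> isometries" and x: "x \<in> M" and r: "relc x r"
  shows "relc (g x) r"
  unfolding relc_def
proof (intro allI impI)
  fix \<sigma> :: "nat \<Rightarrow> 'a" assume \<sigma>: "\<forall>n. \<sigma> n \<in> mcball (g x) r"
  then have "\<forall>n. \<exists>y\<in>M. \<sigma> n = g y" using isometries_surj[OF g] by simp
  then obtain \<tau> where \<tau>: "\<And>n. \<tau> n \<in> M" "\<And>n. \<sigma> n = g (\<tau> n)" by metis
  have "\<tau> n \<in> mcball x r" for n
    using \<sigma> \<tau> x isometries_dist[OF g x \<tau>(1)] by simp
  then have "subconvergent \<tau>" using r by (simp add: relc_def)
  then obtain l s where ls: "l \<in> M" "strict_mono (s :: nat \<Rightarrow> nat)" "(\<lambda>n. d (\<tau> (s n)) l) \<longlonglongrightarrow> 0"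
    by (auto simp: subconvergent_def)
  then have "(\<lambda>n. d (\<sigma> (s n)) (g l)) \<longlonglongrightarrow> 0" using \<tau> by (simp add: isometries_dist[OF g])
  then show "subconvergent \<sigma>" using ls isometries_closed[OF g] by (auto simp: subconvergent_def)
qed

lemma near_isometry: "g \<in> isometries \<Longrightarrow> near x z \<Longrightarrow> near (g x) (g z)"
  unfolding near_def using relc_isometry by (auto simp: isometries_closed isometries_dist)

lemma reach_near: "x \<in> reach F \<Longrightarrow> near x z \<Longrightarrow> z \<in> reach F"
  unfolding reach_def by (auto intro: rtranclp.rtrancl_into_rtrancl)

lemma rtranclp_near_isometry: "near\<^sup>*\<^sup>* x z \<Longrightarrow> g \<in> isometries \<Longrightarrow> near\<^sup>*\<^sup>* (g x) (g z)"
  by (induction rule: rtranclp_induct) (auto intro: rtranclp.rtrancl_into_rtrancl near_isometry)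

lemma reach_subset: "F \<subseteq> M \<Longrightarrow> reach F \<subseteq> M"
proof
  fix z assume "F \<subseteq> M" "z \<in> reach F"
  then obtain y where "y \<in> M" "near\<^sup>*\<^sup>* y z" by (auto simp: reach_def)
  from this(2,1) show "z \<in> M" by (induction rule: rtranclp_induct) (auto simp: near_def)
qed

text \<open>Once \<open>g n x\<close> is close to its limit, the points \<open>g n z\<close> all lie
  in the ball of radius \<open>r\<close> about a single \<open>g N x\<close>. That ball is an
  isometric image of the one about \<open>x\<close>, hence relatively compact. Half of the slack
  \<open>r - d x z\<close> is spent on each of the two distances to the limit.\<close>

lemma subconvergent_near:
  assumes g: "\<And>n. g n \<in> isometries" and sub: "subconvergent (\<lambda>n. g n x)" and "near x z"
  shows "subconvergent (\<lambda>n. g n z)"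
proof -
  obtain r where r: "r > d x z" "relc x r" "x \<in> M" "z \<in> M" using \<open>near x z\<close> by (auto simp: near_def)
  obtain l s where ls: "l \<in> M" "strict_mono (s :: nat \<Rightarrow> nat)" "(\<lambda>n. d (g (s n) x) l) \<longlonglongrightarrow> 0"
    using sub by (auto simp: subconvergent_def)
  have "eventually (\<lambda>n. d (g (s n) x) l < (r - d x z) / 2) sequentially"
    using order_tendstoD(2)[OF ls(3), of "(r - d x z) / 2"] r(1) by simp
  then obtain N where N: "\<And>n. n \<ge> N \<Longrightarrow> d (g (s n) x) l < (r - d x z) / 2"
    by (auto simp: eventually_sequentially)
  have gM: "g n x \<in> M" "g n z \<in> M" for n using isometries_closed[OF g] r by auto
  have in_ball: "g (s (n + N)) z \<in> mcball (g (s N) x) r" for n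
  proof -
    have "d (g (s N) x) (g (s (n + N)) z) \<le> d (g (s N) x) l + d l (g (s (n + N)) x) + d (g (s (n + N)) x) (g (s (n + N)) z)"
      using triangle[OF gM(1) ls(1) gM(2), of "s N" "s (n + N)"]
        triangle[OF ls(1) gM(1) gM(2), of "s (n + N)" "s (n + N)"] by linarith
    also have "\<dots> \<le> r" using N[of N] N[of "n + N"] isometries_dist[OF g r(3,4)] commute[of l] by simp
    finally show ?thesis using gM by simp
  qed
  then have "subconvergent (\<lambda>n. g (s (n + N)) z)"
    using relc_isometry[OF g r(3,2), of "s N", unfolded relc_def, rule_format, of "\<lambda>n. g (s (n + N)) z"]
    by blast
  then obtain l' s' where ls': "l' \<in> M" "strict_mono (s' :: nat \<Rightarrow> nat)"
    "(\<lambda>n. d (g (s (s' n + N)) z) l') \<longlonglongrightarrow> 0"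
    by (auto simp: subconvergent_def)
  have "strict_mono (\<lambda>n. s (s' n + N))"
    using ls(2) ls'(2) by (simp add: strict_mono_def)
  then show ?thesis using ls'(1,3) unfolding subconvergent_def
    by (intro bexI[of _ l'] exI[of _ "\<lambda>n. s (s' n + N)"]) auto
qed

text \<open>Compactness is tested at one point of \<open>C\<close> at a time; no common subsequence
  for several points is asked for.\<close>

definition bounded_family :: "'a set \<Rightarrow> ('a \<Rightarrow> 'a) set \<Rightarrow> bool" where
  "bounded_family C X \<longleftrightarrow> (\<forall>g\<in>X. g \<in> isometries \<and> g ` C \<subseteq> C) \<and>
     (\<forall>\<sigma> z. (\<forall>n. \<sigma> n \<in> X) \<longrightarrow> z \<in> C \<longrightarrow> subconvergent (\<lambda>n. \<sigma> n z))"

lemma bounded_familyD: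
  assumes "bounded_family C X" "\<And>n. \<sigma> n \<in> X" "z \<in> C"
  shows "subconvergent (\<lambda>n. \<sigma> n z)"
  using assms by (simp add: bounded_family_def)

lemma bounded_family_subset: "bounded_family C X \<Longrightarrow> Y \<subseteq> X \<Longrightarrow> bounded_family C Y"
  unfolding bounded_family_def by (meson subset_eq)

end

locale locally_compact_metric = Metric_space +
  assumes relc_ex: "x \<in> M \<Longrightarrow> \<exists>r>0. relc x r"
begin

text \<open>All points \<open>g n z\<close> share the radius of compactness of \<open>z\<close>, so
  one of them is \<open>near\<close> to the limit.\<close>

lemma limit_in_reach:
  assumes "F \<subseteq> M" "z \<in> reach F" "l \<in> M" "\<And>n. g n \<in> isometries" "\<And>n. g n z \<in> reach F"
    and "(\<lambda>n. d (g n z) l) \<longlonglongrightarrow> 0"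
  shows "l \<in> reach F"
proof -
  have z: "z \<in> M" using reach_subset assms by blast
  obtain r where r: "r > 0" "relc z r" using relc_ex[OF z] by blast
  obtain n where n: "d (g n z) l < r"
    using order_tendstoD(2)[OF assms(6) r(1)] by (auto simp: eventually_sequentially)
  have "near (g n z) l"
    unfolding near_def using relc_isometry[OF assms(4) z r(2)] n isometries_closed[OF assms(4) z] assms(3)
    by blast
  then show ?thesis using reach_near assms(5) by blast
qed

text \<open>If \<open>h n z\<close> tends to \<open>l\<close> along a subsequence, then
  \<open>g n (h n z)\<close> stays as close to \<open>g n l\<close> as \<open>h n z\<close> is to
  \<open>l\<close>. As \<open>l\<close> is again in \<open>reach F\<close>, boundedness of
  \<open>X\<close> applies at \<open>l\<close>.\<close>

lemma bounded_family_comp: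
  assumes F: "F \<subseteq> M" and X: "bounded_family (reach F) X" and Y: "bounded_family (reach F) Y"
  shows "bounded_family (reach F) {\<lambda>x. g (h x) | g h. g \<in> X \<and> h \<in> Y}"
  unfolding bounded_family_def
proof (intro conjI ballI allI impI)
  fix k assume "k \<in> {\<lambda>x. g (h x) | g h. g \<in> X \<and> h \<in> Y}"
  then obtain g h where k: "k = (\<lambda>x. g (h x))" "g \<in> X" "h \<in> Y" by blast
  then show "k \<in> isometries" "k ` reach F \<subseteq> reach F"
    using X Y unfolding bounded_family_def by (auto simp: image_subset_iff intro: isometries_comp)
next
  fix \<sigma> :: "nat \<Rightarrow> 'a \<Rightarrow> 'a" and z
  assume \<sigma>: "\<forall>n. \<sigma> n \<in> {\<lambda>x. g (h x) | g h. g \<in> X \<and> h \<in> Y}" and z: "z \<in> reach F"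
  then have "\<forall>n. \<exists>g h. \<sigma> n = (\<lambda>x. g (h x)) \<and> g \<in> X \<and> h \<in> Y" by blast
  then obtain g h where gh: "\<And>n. \<sigma> n = (\<lambda>x. g n (h n x))" "\<And>n. g n \<in> X" "\<And>n. h n \<in> Y" by metis
  have iso: "g n \<in> isometries" "h n \<in> isometries" "h n z \<in> reach F" for n
    using X Y gh z unfolding bounded_family_def by (auto simp: image_subset_iff)
  have zM: "z \<in> M" using reach_subset[OF F] z by blast
  have "subconvergent (\<lambda>n. h n z)" using Y gh z by (simp add: bounded_family_def)
  then obtain l s where ls: "l \<in> M" "strict_mono (s :: nat \<Rightarrow> nat)" "(\<lambda>n. d (h (s n) z) l) \<longlonglongrightarrow> 0"
    by (auto simp: subconvergent_def)
  have l: "l \<in> reach F" by (rule limit_in_reach[where g = "\<lambda>n. h (s n)", OF F z ls(1) _ _ ls(3)]) (rule iso)+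
  have "subconvergent (\<lambda>n. g (s n) l)"
    by (rule bounded_familyD[OF X gh(2) l])
  then obtain l' s' where ls': "l' \<in> M" "strict_mono (s' :: nat \<Rightarrow> nat)"
    "(\<lambda>n. d (g (s (s' n)) l) l') \<longlonglongrightarrow> 0"
    by (auto simp: subconvergent_def)
  have hM: "h n z \<in> M" for n using isometries_closed iso zM by blast
  have lim: "(\<lambda>n. d (h (s (s' n)) z) l + d (g (s (s' n)) l) l') \<longlonglongrightarrow> 0"
    using tendsto_add[OF LIMSEQ_subseq_LIMSEQ[OF ls(3) ls'(2)] ls'(3)] by (simp add: o_def)
  have "(\<lambda>n. d (\<sigma> (s (s' n)) z) l') \<longlonglongrightarrow> 0"
  proof (rule tendsto_sandwich[OF _ _ tendsto_const lim])
    show "eventually (\<lambda>n. d (\<sigma> (s (s' n)) z) l' \<le> d (h (s (s' n)) z) l + d (g (s (s' n)) l) l') sequentially"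
    proof (intro always_eventually allI)
      fix n
      let ?k = "s (s' n)"
      have "d (g ?k (h ?k z)) l' \<le> d (g ?k (h ?k z)) (g ?k l) + d (g ?k l) l'"
        using triangle isometries_closed[OF iso(1)] hM ls(1) ls'(1) by blast
      then show "d (\<sigma> ?k z) l' \<le> d (h ?k z) l + d (g ?k l) l'"
        by (simp add: gh isometries_dist[OF iso(1) hM ls(1)])
    qed
  qed simp
  moreover have "strict_mono (\<lambda>n. s (s' n))" using ls(2) ls'(2) by (simp add: strict_mono_def)
  ultimately show "subconvergent (\<lambda>n. \<sigma> n z)" unfolding subconvergent_def
    by (intro bexI[OF _ ls'(1)] exI[of _ "\<lambda>n. s (s' n)"]) auto
qed

definition isometric_flow :: "(real \<Rightarrow> 'a \<Rightarrow> 'a) \<Rightarrow> bool" where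
  "isometric_flow a \<longleftrightarrow> (\<forall>t. a t \<in> isometries) \<and> (\<forall>s t. \<forall>x\<in>M. a (s + t) x = a s (a t x)) \<and>
     (\<forall>x\<in>M. a 0 x = x) \<and> (\<forall>x\<in>M. ((\<lambda>t. d (a t x) x) \<longlongrightarrow> 0) (nhds 0))"

text \<open>The commutation rule of the dilations \<open>x \<mapsto> exp s * x\<close> and the
  translations \<open>x \<mapsto> x + t\<close> of the line.\<close>

definition affine_relation :: "(real \<Rightarrow> 'a \<Rightarrow> 'a) \<Rightarrow> (real \<Rightarrow> 'a \<Rightarrow> 'a) \<Rightarrow> bool" where
  "affine_relation a b \<longleftrightarrow> (\<forall>s t. \<forall>x\<in>M. a s (b t x) = b (exp s * t) (a s x))"

end

text \<open>Compactness is required at radius \<open>2 * \<epsilon>\<close>, while \<open>W\<close>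
  uses \<open>\<epsilon>\<close>: the counting argument squares elements of \<open>W\<close>, which
  may double the displacement.\<close>

locale pseudo_component = locally_compact_metric +
  fixes F :: "'a set" and \<epsilon> :: real
  assumes F: "finite F" "F \<subseteq> M" and \<epsilon>: "\<epsilon> > 0"
    and compact_F: "\<And>y. y \<in> F \<Longrightarrow> compactin mtopology (mcball y (2 * \<epsilon>))"
begin

definition W :: "('a \<Rightarrow> 'a) set" where
  "W = {g\<in>isometries. \<forall>y\<in>F. d (g y) y \<le> \<epsilon>}"

abbreviation "bdd \<equiv> bounded_family (reach F)"

lemma relc_F: "y \<in> F \<Longrightarrow> relc y (2 * \<epsilon>)"
  using compact_F compactin_imp_relc by blast

lemma reach_M: "z \<in> reach F \<Longrightarrow> z \<in> M"
  using reach_subset[OF F(2)] by blast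

text \<open>Each \<open>y\<close> in \<open>F\<close> is \<open>near\<close> to \<open>g y\<close>,
  and a chain from \<open>y\<close> to \<open>z\<close> is mapped to one from \<open>g y\<close> to
  \<open>g z\<close>; joining them leads from \<open>y\<close> to \<open>g z\<close>.\<close>

lemma isometry_reach_subset:
  assumes "g \<in> isometries" "\<And>y. y \<in> F \<Longrightarrow> d (g y) y < 2 * \<epsilon>"
  shows "g ` reach F \<subseteq> reach F"
proof
  fix x assume "x \<in> g ` reach F"
  then obtain y z where y: "y \<in> F" "near\<^sup>*\<^sup>* y z" "x = g z" by (auto simp: reach_def)
  have "y \<in> M" using y F by auto
  have "near y (g y)"
    unfolding near_def using \<open>y \<in> M\<close> relc_F[OF y(1)] assms(2)[OF y(1)] isometries_closed[OF assms(1)]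
    by (auto simp: commute)
  with rtranclp_near_isometry[OF y(2) assms(1)] show "x \<in> reach F"
    using y by (auto simp: reach_def intro: converse_rtranclp_into_rtranclp)
qed

text \<open>On \<open>F\<close> the orbits stay in compact balls; \<open>subconvergent_near\<close>
  carries this along chains to every point of \<open>reach F\<close>.\<close>

lemma bdd_W: "bdd W"
  unfolding bounded_family_def
proof (intro conjI ballI allI impI)
  show "g \<in> isometries" "g ` reach F \<subseteq> reach F" if "g \<in> W" for g
    using that isometry_reach_subset[of g] \<epsilon> by (auto simp: W_def) (smt (verit) imageI subset_eq)+
next
  fix \<sigma> :: "nat \<Rightarrow> 'a \<Rightarrow> 'a" and z assume \<sigma>: "\<forall>n. \<sigma> n \<in> W" and "z \<in> reach F"
  then obtain y where y: "y \<in> F" "near\<^sup>*\<^sup>* y z" by (auto simp: reach_def)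
  have iso: "\<sigma> n \<in> isometries" for n using \<sigma> by (auto simp: W_def)
  have yM: "y \<in> M" using y F by auto
  from y(2) show "subconvergent (\<lambda>n. \<sigma> n z)"
  proof (induction rule: rtranclp_induct)
    case base
    have "\<sigma> n y \<in> mcball y (2 * \<epsilon>)" for n
    proof -
      have "d y (\<sigma> n y) \<le> \<epsilon>" using \<sigma> y(1) by (auto simp: W_def commute)
      then show ?thesis using \<epsilon> yM isometries_closed[OF iso yM, of n] by simp
    qed
    then show ?case using relc_F[OF y(1)] by (simp add: relc_def)
  next
    case (step z z')
    then show ?case using subconvergent_near[of \<sigma>, OF iso] by blast
  qed
qed

lemma eventually_W:
  assumes "isometric_flow a"
  shows "\<exists>\<delta>>0. \<forall>t. \<bar>t\<bar> \<le> \<delta> \<longrightarrow> a t \<in> W"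
proof -
  have "eventually (\<lambda>t. \<forall>y\<in>F. d (a t y) y < \<epsilon>) (nhds 0)"
    using assms F \<epsilon> by (intro eventually_ball_finite) (auto simp: isometric_flow_def intro: order_tendstoD(2))
  then obtain \<delta> where "\<delta> > 0" "\<And>t. dist t 0 < \<delta> \<Longrightarrow> \<forall>y\<in>F. d (a t y) y < \<epsilon>"
    unfolding eventually_nhds_metric by blast
  then show ?thesis using assms
    by (intro exI[of _ "\<delta> / 2"]) (auto simp: W_def isometric_flow_def less_imp_le)
qed

text \<open>The laws of flows hold on \<open>M\<close> only, so families of functions have to be
  compared up to their values elsewhere.\<close>

lemma bdd_agree:
  assumes X: "bdd X" and agree: "\<And>g. g \<in> Y \<Longrightarrow> \<exists>g'\<in>X. \<forall>x\<in>M. g x = g' x"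
  shows "bdd Y"
  unfolding bounded_family_def
proof (intro conjI ballI allI impI)
  fix g assume "g \<in> Y"
  then obtain g' where g': "g' \<in> X" "\<forall>x\<in>M. g x = g' x" using agree by blast
  then have "g' \<in> isometries" "g' ` reach F \<subseteq> reach F" using X by (auto simp: bounded_family_def)
  moreover have "g ` M = g' ` M" "g ` reach F = g' ` reach F"
    using g'(2) reach_M by (auto intro!: image_cong)
  ultimately show "g \<in> isometries" "g ` reach F \<subseteq> reach F" using g'(2) by (auto simp: isometries_def)
next
  fix \<sigma> :: "nat \<Rightarrow> 'a \<Rightarrow> 'a" and z assume \<sigma>: "\<forall>n. \<sigma> n \<in> Y" and z: "z \<in> reach F"
  then have "\<forall>n. \<exists>g'\<in>X. \<forall>x\<in>M. \<sigma> n x = g' x" using agree by blast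
  then obtain \<tau> where \<tau>: "\<And>n. \<tau> n \<in> X" "\<And>n. \<forall>x\<in>M. \<sigma> n x = \<tau> n x" by metis
  then have "subconvergent (\<lambda>n. \<tau> n z)" using X z by (simp add: bounded_family_def)
  then show "subconvergent (\<lambda>n. \<sigma> n z)" using \<tau>(2) reach_M[OF z] by simp
qed

lemma bdd_comp:
  assumes "bdd X" "bdd Y" "\<And>k. k \<in> Z \<Longrightarrow> \<exists>g\<in>X. \<exists>h\<in>Y. \<forall>x\<in>M. k x = g (h x)"
  shows "bdd Z"
proof (rule bdd_agree[OF bounded_family_comp[OF F(2) assms(1,2)]])
  fix k assume "k \<in> Z"
  then obtain g h where "g \<in> X" "h \<in> Y" "\<forall>x\<in>M. k x = g (h x)" using assms(3) by blast
  then show "\<exists>g'\<in>{\<lambda>x. g (h x) | g h. g \<in> X \<and> h \<in> Y}. \<forall>x\<in>M. k x = g' x"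
    by (intro bexI[of _ "\<lambda>x. g (h x)"]) auto
qed

text \<open>Over a bounded time interval the flow is a product of a fixed number of elements of
  \<open>W\<close>, and products of bounded families are bounded.\<close>

lemma bdd_flow:
  assumes a: "isometric_flow a"
  shows "bdd (a ` {- T..T})"
proof -
  obtain \<delta> where \<delta>: "\<delta> > 0" "\<And>t. \<bar>t\<bar> \<le> \<delta> \<Longrightarrow> a t \<in> W" using eventually_W[OF a] by blast
  have "bdd (a ` {s. \<bar>s\<bar> \<le> real (Suc k) * \<delta>})" for k
  proof (induction k)
    case 0
    show ?case by (rule bounded_family_subset[OF bdd_W]) (use \<delta>(2) in auto)
  next
    case (Suc k)
    show ?case
    proof (rule bdd_comp[OF Suc bdd_W])
      fix g assume "g \<in> a ` {s. \<bar>s\<bar> \<le> real (Suc (Suc k)) * \<delta>}"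
      then obtain s where s: "g = a s" "\<bar>s\<bar> \<le> real (Suc (Suc k)) * \<delta>" by blast
      \<comment> \<open>Equal steps: one step lies in \<open>W\<close>, the remaining
        \<open>Suc k\<close> are covered by the induction hypothesis.\<close>
      define t where "t = s / real (Suc (Suc k))"
      have t: "\<bar>t\<bar> \<le> \<delta>" using s(2) by (simp add: t_def abs_divide pos_divide_le_eq mult.commute)
      have "s - t = real (Suc k) * t" by (simp add: t_def field_simps)
      then have "\<bar>s - t\<bar> \<le> real (Suc k) * \<delta>"
        using mult_left_mono[OF t, of "real (Suc k)"] by (simp add: abs_mult)
      moreover have "a s x = a (s - t) (a t x)" if "x \<in> M" for x
        using a that unfolding isometric_flow_def by (metis diff_add_cancel)
      ultimately show "\<exists>g'\<in>a ` {s. \<bar>s\<bar> \<le> real (Suc k) * \<delta>}. \<exists>h\<in>W. \<forall>x\<in>M. g x = g' (h x)"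
        using \<delta>(2)[OF t] s(1)
        by (intro bexI[of _ "a (s - t)"] bexI[of _ "a t"] imageI CollectI) auto
    qed
  qed
  moreover obtain k where "T < real k * \<delta>" using \<delta>(1) reals_Archimedean3 by blast
  ultimately show ?thesis
    by (rule_tac bounded_family_subset[of _ "a ` {s. \<bar>s\<bar> \<le> real (Suc k) * \<delta>}"])
      (use \<delta>(1) in \<open>auto simp: distrib_right\<close>)
qed

text \<open>Holds for all times, although a single isometry with large displacement of
  \<open>F\<close> might leave \<open>reach F\<close>.\<close>

lemma isometric_flow_reach:
  assumes "isometric_flow a" "z \<in> reach F"
  shows "a t z \<in> reach F"
proof -
  have "a t \<in> a ` {- \<bar>t\<bar>..\<bar>t\<bar>}" by (rule imageI) auto
  then have "a t ` reach F \<subseteq> reach F"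
    using bdd_flow[OF assms(1), of "\<bar>t\<bar>"] unfolding bounded_family_def by blast
  then show ?thesis using assms(2) by blast
qed

text \<open>With \<open>s = ln (1 + 1 / t)\<close> the relation reads \<open>a s \<circ> b t \<circ> a (-s) \<circ> b (-t) = b 1\<close>. Hence bounded
  but arbitrarily large times \<open>t\<close> force the whole half-orbit of \<open>b\<close> to be bounded, and then \<open>t \<rightarrow> \<infinity>\<close>
  forces \<open>b 1\<close> to be trivial.\<close>

lemma affine_bounded_trivial:
  assumes a: "isometric_flow a" and b: "isometric_flow b" and ab: "affine_relation a b"
    and bdd: "bdd (b ` D)" "bdd ((\<lambda>t. b (- t)) ` D)" and D: "\<And>K. \<exists>t\<in>D. t > K"
    and z: "z \<in> reach F"
  shows "b 1 z = z"
proof -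
  have ai: "a s \<in> isometries" and bi: "b s \<in> isometries" for s
    using a b by (auto simp: isometric_flow_def)
  note aM = isometries_closed[OF ai] and bM = isometries_closed[OF bi]
  have aplus: "a (s + t) x = a s (a t x)" "b (s + t) x = b s (b t x)" "a 0 x = x" "b 0 x = x"
    if "x \<in> M" for s t x using that a b by (auto simp: isometric_flow_def)
  have conj: "a s (b t x) = b (exp s * t) (a s x)" if "x \<in> M" for s t x
    using ab that by (simp add: affine_relation_def)
  have conj': "a s (b t (a (- s) x)) = b (exp s * t) x" if "x \<in> M" for s t x
    using conj[OF aM[OF that], of s t "- s"] aplus(1)[OF that, of s "- s"] aplus(3)[OF that] by simp
  have half: "bdd (b ` {0..})"
  proof (rule bdd_comp[OF bdd_flow[OF a, of 1] bdd_comp[OF bdd(1) bdd_comp[OF bdd_flow[OF a, of 1] bdd(2)]]])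
    fix g assume "g \<in> b ` {0..}"
    then obtain u where u: "g = b u" "u \<ge> 0" by auto
    obtain t where t: "t \<in> D" "t > u + 1" using D by blast
    \<comment> \<open>For any \<open>u \<ge> 0\<close> this makes \<open>exp s * t = t + u\<close>.
      The choice \<open>t > u + 1\<close> keeps \<open>exp s\<close> below 2, so that the dilations
      used come from the fixed range \<open>\<bar>s\<bar> \<le> 1\<close>.\<close>
    define s where "s = ln (1 + u / t)"
    have pos: "1 + u / t > 0" using t u by (simp add: add_pos_nonneg)
    have es: "exp s = 1 + u / t" unfolding s_def using pos by simp
    have "1 + u / t \<le> 1 + 1" using t u by simp
    also have "\<dots> \<le> exp 1" using exp_ge_add_one_self[of 1] .
    finally have "s \<le> 1" using es by (metis exp_le_cancel_iff)
    moreover have "s \<ge> 0" unfolding s_def using t u by simp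
    moreover have "b u x = a s (b t (a (- s) (b (- t) x)))" if "x \<in> M" for x
    proof -
      have "a s (b t (a (- s) (b (- t) x))) = b (exp s * t + - t) x"
        using conj'[OF bM[OF that], of s t "- t"] aplus(2)[OF that, of "exp s * t" "- t"] by simp
      also have "exp s * t + - t = u" using t u by (simp add: es field_simps)
      finally show ?thesis by simp
    qed
    moreover have "(\<lambda>x. b t (a (- s) (b (- t) x))) \<in>
        {\<lambda>x. b t (a s (b t' x)) | s t t'. t \<in> D \<and> t' \<in> uminus ` D \<and> \<bar>s\<bar> \<le> 1}"
      by (rule CollectI, rule exI[of _ "- s"], rule exI[of _ t], rule exI[of _ "- t"])
        (use t(1) \<open>s \<le> 1\<close> \<open>s \<ge> 0\<close> in auto)
    ultimately show "\<exists>g'\<in>a ` {-1..1}. \<exists>h\<in>{\<lambda>x. b t (a s (b t' x)) | s t t'.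
        t \<in> D \<and> t' \<in> uminus ` D \<and> \<bar>s\<bar> \<le> 1}. \<forall>x\<in>M. g x = g' (h x)"
      using u(1) \<open>s \<le> 1\<close> \<open>s \<ge> 0\<close>
      by (rule_tac bexI[of _ "a s"], rule_tac bexI[of _ "\<lambda>x. b t (a (- s) (b (- t) x))"]) auto
  next
    fix k assume "k \<in> {\<lambda>x. b t (a s (b t' x)) | s t t'. t \<in> D \<and> t' \<in> uminus ` D \<and> \<bar>s\<bar> \<le> 1}"
    then obtain s t t' where "k = (\<lambda>x. b t (a s (b (- t') x)))" "t \<in> D" "t' \<in> D" "\<bar>s\<bar> \<le> 1" by auto
    then show "\<exists>g\<in>b ` D. \<exists>h\<in>{\<lambda>x. a s (b (- t') x) | s t'. t' \<in> D \<and> \<bar>s\<bar> \<le> 1}. \<forall>x\<in>M. k x = g (h x)"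
      by (rule_tac bexI[of _ "b t"], rule_tac bexI[of _ "\<lambda>x. a s (b (- t') x)"]) auto
  next
    fix k assume "k \<in> {\<lambda>x. a s (b (- t') x) | s t'. t' \<in> D \<and> \<bar>s\<bar> \<le> 1}"
    then obtain s t' where "k = (\<lambda>x. a s (b (- t') x))" "t' \<in> D" "\<bar>s\<bar> \<le> 1" by auto
    then show "\<exists>g\<in>a ` {-1..1}. \<exists>h\<in>(\<lambda>t. b (- t)) ` D. \<forall>x\<in>M. k x = g (h x)"
      by (rule_tac bexI[of _ "a s"], rule_tac bexI[of _ "b (- t')"]) (auto simp: abs_le_iff)
  qed
  define s where "s n = inverse (real (Suc n))" for n
  \<comment> \<open>Solves \<open>exp s * t = t + 1\<close> for \<open>t\<close>, now with
    \<open>s\<close> prescribed and tending to 0.\<close>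
  define t where "t n = 1 / (exp (s n) - 1)" for n
  have s_pos: "s n > 0" for n by (simp add: s_def)
  have t_pos: "t n > 0" for n using s_pos[of n] by (simp add: t_def)
  have st: "exp (s n) * t n = 1 + t n" for n using s_pos[of n] by (simp add: t_def field_simps)
  have zM: "z \<in> M" using reach_M[OF z] .
  have "subconvergent (\<lambda>n. b (t n) z)"
    by (rule bounded_familyD[OF half _ z]) (use t_pos in \<open>auto simp: less_imp_le\<close>)
  then obtain w \<sigma> where w: "w \<in> M" "strict_mono (\<sigma> :: nat \<Rightarrow> nat)" "(\<lambda>n. d (b (t (\<sigma> n)) z) w) \<longlonglongrightarrow> 0"
    by (auto simp: subconvergent_def)
  \<comment> \<open>As \<open>b 1\<close> commutes with \<open>b (t n)\<close>, its displacement at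
    \<open>z\<close> equals that at \<open>b (t n) z\<close>, where only the dilations by
    \<open>s n\<close> and \<open>- s n\<close> contribute. Their continuity is known pointwise
    only, so the moving point is compared with its limit \<open>w\<close>.\<close>
  have bound: "d (b 1 z) z \<le> d (a (- s n) z) z + 2 * d (b (t n) z) w + d (a (s n) w) w" for n
  proof -
    let ?y = "b (t n) z" and ?x = "b (t n) (a (- s n) z)"
    have yM: "?y \<in> M" and xM: "?x \<in> M" using zM aM bM by auto
    have "b 1 ?y = b (t n) (b 1 z)" using aplus(2)[OF zM] by (metis add.commute)
    then have "d (b 1 z) z = d (b 1 ?y) ?y"
      using isometries_dist[OF bi bM[OF zM] zM] by simp
    also have "b 1 ?y = a (s n) ?x"
      using conj'[OF zM, of "s n" "t n"] aplus(2)[OF zM, of 1 "t n"] st by simp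
    also have "d (a (s n) ?x) ?y \<le> d (a (s n) ?x) (a (s n) ?y) + d (a (s n) ?y) ?y"
      using triangle[OF aM[OF xM] aM[OF yM] yM] .
    also have "d (a (s n) ?x) (a (s n) ?y) = d (a (- s n) z) z"
      by (simp add: isometries_dist[OF ai xM yM] isometries_dist[OF bi aM[OF zM] zM])
    also have "d (a (s n) ?y) ?y \<le> d (a (s n) ?y) (a (s n) w) + d (a (s n) w) w + d w ?y"
      using triangle[OF aM[OF yM] aM[OF w(1)] yM] triangle[OF aM[OF w(1)] w(1) yM] by (smt (verit))
    also have "d (a (s n) ?y) (a (s n) w) = d ?y w" by (rule isometries_dist[OF ai yM w(1)])
    finally show ?thesis using commute[of w ?y] by simp
  qed
  have s0: "s \<longlonglongrightarrow> 0" unfolding s_def by (rule LIMSEQ_inverse_real_of_nat)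
  have a0: "((\<lambda>s. d (a s x) x) \<longlongrightarrow> 0) (nhds 0)" if "x \<in> M" for x
    using a that by (simp add: isometric_flow_def)
  have s0': "(\<lambda>n. s (\<sigma> n)) \<longlonglongrightarrow> 0" using LIMSEQ_subseq_LIMSEQ[OF s0 w(2)] by (simp add: o_def)
  then have s0'': "(\<lambda>n. - s (\<sigma> n)) \<longlonglongrightarrow> 0" using tendsto_minus by fastforce
  have "(\<lambda>n. d (a (- s (\<sigma> n)) z) z + 2 * d (b (t (\<sigma> n)) z) w + d (a (s (\<sigma> n)) w) w) \<longlonglongrightarrow> 0 + 2 * 0 + 0"
    by (intro tendsto_add tendsto_mult tendsto_const w(3)
        filterlim_compose[OF a0[OF zM] s0''] filterlim_compose[OF a0[OF w(1)] s0'])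
  then have "d (b 1 z) z \<le> 0"
    by (intro LIMSEQ_le_const) (auto intro!: exI[of _ 0] bound)
  then show ?thesis using zero[OF bM[OF zM] zM] nonneg[of "b 1 z" z] by (simp add: order_antisym)
qed

text \<open>The constant \<open>Q\<close> counts the colourings of \<open>F\<close> by balls of radius \<open>\<epsilon> / 2\<close> that cover the compact
  balls of radius \<open>2 * \<epsilon>\<close>.\<close>

lemma pigeonhole_isometries:
  obtains Q :: nat where "Q > 0" "\<And>(X :: 'i set) (g :: 'i \<Rightarrow> 'a \<Rightarrow> 'a). \<lbrakk>finite X;
      \<And>x. x \<in> X \<Longrightarrow> g x \<in> isometries \<and> (\<forall>y\<in>F. d (g x y) y \<le> 2 * \<epsilon>)\<rbrakk> \<Longrightarrow>
      \<exists>X'\<subseteq>X. card X \<le> Q * card X' \<and> (\<forall>x\<in>X'. \<forall>x'\<in>X'. \<forall>y\<in>F. d (g x y) (g x' y) \<le> \<epsilon>)"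
proof -
  have "\<exists>N. finite N \<and> N \<subseteq> mcball y (2 * \<epsilon>) \<and> mcball y (2 * \<epsilon>) \<subseteq> (\<Union>x\<in>N. mball x (\<epsilon> / 2))"
    if "y \<in> F" for y
    using compactin_imp_mtotally_bounded[OF compact_F[OF that]] \<epsilon>
    unfolding mtotally_bounded_def by (meson half_gt_zero)
  then have "\<forall>y\<in>F. \<exists>N. finite N \<and> N \<subseteq> mcball y (2 * \<epsilon>) \<and> mcball y (2 * \<epsilon>) \<subseteq> (\<Union>x\<in>N. mball x (\<epsilon> / 2))"
    by (intro ballI)
  from bchoice[OF this] obtain N where N': "\<forall>y\<in>F. finite (N y) \<and> N y \<subseteq> mcball y (2 * \<epsilon>) \<and>
      mcball y (2 * \<epsilon>) \<subseteq> (\<Union>x\<in>N y. mball x (\<epsilon> / 2))" ..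
  have N: "finite (N y)" "mcball y (2 * \<epsilon>) \<subseteq> (\<Union>x\<in>N y. mball x (\<epsilon> / 2))" if "y \<in> F" for y
    using bspec[OF N' that] by - (elim conjE, assumption)+
  define c where "c y p = (SOME q. q \<in> N y \<and> p \<in> mball q (\<epsilon> / 2))" for y p
  have c: "c y p \<in> N y \<and> p \<in> mball (c y p) (\<epsilon> / 2)" if "y \<in> F" "p \<in> mcball y (2 * \<epsilon>)" for y p
    unfolding c_def by (rule someI_ex) (use N(2)[OF that(1)] that(2) in blast)
  define Col where "Col = PiE F N"
  have fin: "finite Col" unfolding Col_def using F(1) N(1) by (intro finite_PiE) auto
  have FM: "y \<in> M" if "y \<in> F" for y using that F(2) by blast
  have "y \<in> mcball y (2 * \<epsilon>)" if "y \<in> F" for y using that FM \<epsilon> by auto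
  then have ne: "Col \<noteq> {}" unfolding Col_def using c by (auto simp: PiE_eq_empty_iff)
  show thesis
  proof (rule that[of "card Col"])
    show "card Col > 0" using fin ne by (simp add: card_gt_0_iff)
    fix X :: "'i set" and g :: "'i \<Rightarrow> 'a \<Rightarrow> 'a"
    assume X: "finite X" and g: "\<And>x. x \<in> X \<Longrightarrow> g x \<in> isometries \<and> (\<forall>y\<in>F. d (g x y) y \<le> 2 * \<epsilon>)"
    have gb: "g x y \<in> mcball y (2 * \<epsilon>)" if "x \<in> X" "y \<in> F" for x y
      using g[OF that(1)] that(2) FM isometries_closed by (auto simp: commute)
    define col where "col x = (\<lambda>y\<in>F. c y (g x y))" for x
    have col: "col \<in> X \<rightarrow> Col" using c gb by (auto simp: col_def Col_def)
    obtain k where k: "card X \<le> card (col -` {k} \<inter> X) * card Col"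
      using pigeonhole_card[OF col X fin ne] by blast
    have "d (g x y) (g x' y) \<le> \<epsilon>" if "x \<in> col -` {k} \<inter> X" "x' \<in> col -` {k} \<inter> X" "y \<in> F" for x x' y
    proof -
      have "col x y = col x' y" using that by auto
      then have "c y (g x y) = c y (g x' y)" using that(3) by (simp add: col_def)
      then have "g x y \<in> mball (c y (g x y)) (\<epsilon> / 2)" "g x' y \<in> mball (c y (g x y)) (\<epsilon> / 2)"
        using c[OF that(3) gb[OF _ that(3), of x]] c[OF that(3) gb[OF _ that(3), of x']] that by auto
      then show ?thesis
        using triangle[of "g x y" "c y (g x y)" "g x' y"] commute[of "g x y"] by auto
    qed
    then show "\<exists>X'\<subseteq>X. card X \<le> card Col * card X' \<and> (\<forall>x\<in>X'. \<forall>x'\<in>X'. \<forall>y\<in>F. d (g x y) (g x' y) \<le> \<epsilon>)"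
      using k by (intro exI[of _ "col -` {k} \<inter> X"]) (auto simp: mult.commute)
  qed
qed

end

section \<open>The translation action of R^n and the counting argument\<close>

locale affine_family = pseudo_component +
  fixes a b :: "nat \<Rightarrow> real \<Rightarrow> 'a \<Rightarrow> 'a"
  assumes a: "isometric_flow (a i)" and b: "isometric_flow (b i)" and ab: "affine_relation (a i) (b i)"
    and bb_commute: "i \<noteq> j \<Longrightarrow> x \<in> M \<Longrightarrow> b i s (b j t x) = b j t (b i s x)"
    and ab_commute: "i \<noteq> j \<Longrightarrow> x \<in> M \<Longrightarrow> a i s (b j t x) = b j t (a i s x)"
begin

text \<open>The vector is a function on \<open>nat\<close> of which only the first \<open>n\<close>
  values matter, so that \<open>n\<close> can vary in inductions.\<close>

primrec P :: "nat \<Rightarrow> (nat \<Rightarrow> real) \<Rightarrow> 'a \<Rightarrow> 'a" where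
  "P 0 x = (\<lambda>z. z)"
| "P (Suc n) x = (\<lambda>z. P n x (b n (x n) z))"

lemma ab_isometries: "a i s \<in> isometries" "b i s \<in> isometries"
  using a b by (auto simp: isometric_flow_def)

lemmas ab_closed = ab_isometries[THEN isometries_closed]

lemma b_add: "z \<in> M \<Longrightarrow> b i (s + t) z = b i s (b i t z)" and b_0: "z \<in> M \<Longrightarrow> b i 0 z = z"
  and a_add: "z \<in> M \<Longrightarrow> a i (s + t) z = a i s (a i t z)" and a_0: "z \<in> M \<Longrightarrow> a i 0 z = z"
  using a b by (auto simp: isometric_flow_def)

lemma P_isometries: "P n x \<in> isometries"
proof (induction n)
  case (Suc n)
  show ?case using isometries_comp[OF Suc ab_isometries(2)[of n "x n"]] by simp
qed (simp add: isometries_def)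

lemmas P_closed = P_isometries[THEN isometries_closed]

lemma P_commute:
  assumes "n \<le> m" "z \<in> M"
  shows "P n x (b m t z) = b m t (P n x z)" "a m t (P n x z) = P n x (a m t z)"
  using assms
proof (induction n arbitrary: z)
  case (Suc n)
  case 1
  then show ?case using Suc(1)[of "b n (x n) z"] bb_commute[of n m z "x n" t] ab_closed by simp
  case 2
  then show ?case using Suc(2)[of "b n (x n) z"] ab_commute[of m n z t "x n"] ab_closed by simp
qed auto

lemma P_add: "z \<in> M \<Longrightarrow> P n (\<lambda>i. x i + y i) z = P n x (P n y z)"
proof (induction n arbitrary: z)
  case (Suc n)
  then show ?case
    using P_commute(1)[of n n "b n (y n) z" y "x n"] ab_closed by (simp add: b_add)
qed simp

lemma P_cong: "(\<And>i. i < n \<Longrightarrow> x i = y i) \<Longrightarrow> P n x = P n y"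
  by (induction n) auto

lemma P_zero: "(\<And>i. i < n \<Longrightarrow> x i = 0) \<Longrightarrow> z \<in> M \<Longrightarrow> P n x z = z"
  by (induction n) (auto simp: b_0)

lemma P_single:
  "i < n \<Longrightarrow> (\<And>j. j < n \<Longrightarrow> j \<noteq> i \<Longrightarrow> x j = 0) \<Longrightarrow> z \<in> M \<Longrightarrow> P n x z = b i (x i) z"
proof (induction n)
  case (Suc n)
  show ?case
  proof (cases "i = n")
    case True
    then show ?thesis using P_zero[of n x "b n (x n) z"] Suc.prems ab_closed by auto
  next
    case False
    then show ?thesis using Suc by (auto simp: b_0)
  qed
qed simp

lemma P_conj:
  "i < n \<Longrightarrow> z \<in> M \<Longrightarrow> a i s (P n x z) = P n (\<lambda>j. if j = i then exp s * x j else x j) (a i s z)"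
proof (induction n arbitrary: z)
  case (Suc n)
  let ?x = "\<lambda>j. if j = i then exp s * x j else x j"
  show ?case
  proof (cases "i = n")
    case True
    have "P n ?x = P n x" by (rule P_cong) (use True in auto)
    then show ?thesis
      using True Suc.prems P_commute(2)[of n n "b n (x n) z" s x] ab[of n] ab_closed
      by (simp add: affine_relation_def)
  next
    case False
    then show ?thesis
      using Suc.IH[of "b n (x n) z"] Suc.prems ab_commute[of i n z s "x n"] ab_closed by simp
  qed
qed simp

lemma P_uminus: "z \<in> M \<Longrightarrow> P n x (P n (\<lambda>i. - x i) z) = z"
  using P_add[of z n x "\<lambda>i. - x i"] P_zero[of n "\<lambda>i. 0" z] by simp

lemma P_uminus_W: "P n x \<in> W \<Longrightarrow> P n (\<lambda>i. - x i) \<in> W"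
proof -
  assume "P n x \<in> W"
  have "d (P n (\<lambda>i. - x i) y) y = d (P n x y) y" if "y \<in> F" for y
  proof -
    have "y \<in> M" using that F by auto
    then have "d (P n (\<lambda>i. - x i) y) y = d (P n x (P n (\<lambda>i. - x i) y)) (P n x y)"
      using isometries_dist[OF P_isometries P_closed] by simp
    then show ?thesis using P_uminus[OF \<open>y \<in> M\<close>] by (simp add: commute)
  qed
  then show ?thesis using \<open>P n x \<in> W\<close> P_isometries by (auto simp: W_def)
qed

text \<open>The commutator of \<open>P n x\<close> with \<open>a i 1\<close> eliminates all
  coordinates except the \<open>i\<close>-th and equals \<open>b i (e * x i)\<close>. It is a
  product of four bounded factors, so if \<open>x i\<close> were unbounded over \<open>W\<close>,
  \<open>affine_bounded_trivial\<close> would make \<open>b i 1\<close> trivial.\<close>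

lemma P_proper:
  assumes "i < n" and nontrivial: "\<exists>z\<in>reach F. b i 1 z \<noteq> z"
  shows "\<exists>R. \<forall>x. P n x \<in> W \<longrightarrow> \<bar>x i\<bar> \<le> R"
proof (rule ccontr)
  assume neg: "\<not> ?thesis"
  \<comment> \<open>The dilation multiplies the \<open>i\<close>-th coordinate by
    \<open>exp 1\<close>, and the inverse of \<open>P n x\<close> subtracts it once.\<close>
  define e :: real where "e = exp 1 - 1"
  have e: "e > 0" by (simp add: e_def)
  define D where "D = {e * x i | x. P n x \<in> W}"
  have 1: "bdd {\<lambda>z. p (q z) | p q. p \<in> a i ` {-1..1} \<and> q \<in> W}"
    by (rule bounded_family_comp[OF F(2) bdd_flow[OF a[of i], of 1] bdd_W])
  have 2: "bdd {\<lambda>z. p (q z) | p q. p \<in> W \<and> q \<in> {\<lambda>z. p (q z) | p q. p \<in> a i ` {-1..1} \<and> q \<in> W}}"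
    by (rule bounded_family_comp[OF F(2) bdd_W 1])
  have "bdd (b i ` D)"
  proof (rule bdd_comp[OF bdd_flow[OF a[of i], of 1] 2])
    fix g assume "g \<in> b i ` D"
    then obtain x where x: "P n x \<in> W" "g = b i (e * x i)" by (auto simp: D_def)
    let ?y = "\<lambda>j. - x j"
    have "g z = a i 1 (P n x (a i (- 1) (P n ?y z)))" if "z \<in> M" for z
    proof -
      have "a i 1 (P n x (a i (- 1) (P n ?y z))) =
          P n (\<lambda>j. if j = i then exp 1 * x j else x j) (a i 1 (a i (- 1) (P n ?y z)))"
        using that by (intro P_conj assms ab_closed P_closed)
      also have "a i 1 (a i (- 1) (P n ?y z)) = P n ?y z"
        using a_add[of "P n ?y z" i 1 "- 1"] a_0 P_closed[OF that] by simp
      also have "P n (\<lambda>j. if j = i then exp 1 * x j else x j) (P n ?y z) =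
          P n (\<lambda>j. (if j = i then exp 1 * x j else x j) + - x j) z"
        by (rule P_add[OF that, symmetric])
      also have "\<dots> = b i (e * x i) z"
        using P_single[of i n "\<lambda>j. (if j = i then exp 1 * x j else x j) + - x j" z] assms that
        by (simp add: e_def algebra_simps)
      finally show ?thesis using x by simp
    qed
    then show "\<exists>g'\<in>a i ` {-1..1}. \<exists>h\<in>{\<lambda>z. p (q z) | p q. p \<in> W \<and> q \<in> {\<lambda>z. p (q z) | p q. p \<in> a i ` {-1..1} \<and> q \<in> W}}.
        \<forall>z\<in>M. g z = g' (h z)"
      using x(1) P_uminus_W[OF x(1)]
      by (rule_tac bexI[of _ "a i 1"], rule_tac bexI[of _ "\<lambda>z. P n x (a i (- 1) (P n ?y z))"]) fastforce+
  qed
  moreover have "(\<lambda>t. b i (- t)) ` D \<subseteq> b i ` D"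
  proof
    fix g assume "g \<in> (\<lambda>t. b i (- t)) ` D"
    then obtain x where "P n x \<in> W" "g = b i (e * - x i)" by (auto simp: D_def)
    then show "g \<in> b i ` D"
      using P_uminus_W[of n x] unfolding D_def
      by (intro image_eqI[of _ _ "e * - x i"] CollectI exI[of _ "\<lambda>j. - x j"]) auto
  qed
  moreover have "\<exists>t\<in>D. t > K" for K
  proof -
    obtain x where x: "P n x \<in> W" "\<bar>x i\<bar> > K / e" using neg by (auto simp: not_le)
    then have K: "e * \<bar>x i\<bar> > K" using e by (simp add: pos_divide_less_eq mult.commute)
    show ?thesis
    proof (cases "x i \<ge> 0")
      case True
      then show ?thesis using x(1) K by (auto simp: D_def)
    next
      case False
      then have "e * - x i > K" using K by simp
      moreover have "e * - x i \<in> D" using P_uminus_W[OF x(1)] unfolding D_def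
        by (intro CollectI exI[of _ "\<lambda>j. - x j"]) auto
      ultimately show ?thesis by blast
    qed
  qed
  ultimately have "b i 1 z = z" if "z \<in> reach F" for z
    using affine_bounded_trivial[OF a b ab _ bounded_family_subset _ that] by blast
  then show False using nontrivial by blast
qed

lemma P_small:
  assumes "\<eta> > 0"
  shows "\<exists>\<delta>>0. \<forall>x. (\<forall>i<n. \<bar>x i\<bar> \<le> \<delta>) \<longrightarrow> (\<forall>y\<in>F. d (P n x y) y \<le> \<eta>)"
  using assms
proof (induction n arbitrary: \<eta>)
  case 0
  then show ?case using F by (auto intro!: exI[of _ 1])
next
  case (Suc n)
  obtain \<delta>1 where \<delta>1: "\<delta>1 > 0" "\<And>x. \<forall>i<n. \<bar>x i\<bar> \<le> \<delta>1 \<Longrightarrow> \<forall>y\<in>F. d (P n x y) y \<le> \<eta> / 2"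
    using Suc.IH[of "\<eta> / 2"] Suc.prems by auto
  have "eventually (\<lambda>t. \<forall>y\<in>F. d (b n t y) y < \<eta> / 2) (nhds 0)"
  proof (intro eventually_ball_finite ballI F(1))
    fix y assume "y \<in> F"
    then have "((\<lambda>t. d (b n t y) y) \<longlongrightarrow> 0) (nhds 0)"
      using b[of n] F(2) by (auto simp: isometric_flow_def)
    from order_tendstoD(2)[OF this, of "\<eta> / 2"]
    show "eventually (\<lambda>t. d (b n t y) y < \<eta> / 2) (nhds 0)" using Suc.prems by simp
  qed
  then obtain \<delta>2 where \<delta>2: "\<delta>2 > 0" "\<And>t. dist t 0 < \<delta>2 \<Longrightarrow> \<forall>y\<in>F. d (b n t y) y < \<eta> / 2"
    unfolding eventually_nhds_metric by blast
  show ?case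
  proof (intro exI[of _ "min \<delta>1 (\<delta>2 / 2)"] conjI allI impI ballI)
    fix x y assume x: "\<forall>i<Suc n. \<bar>x i\<bar> \<le> min \<delta>1 (\<delta>2 / 2)" and y: "y \<in> F"
    have yM: "y \<in> M" using y F by auto
    have "d (P n x (b n (x n) y)) y \<le> d (P n x (b n (x n) y)) (P n x y) + d (P n x y) y"
      by (rule triangle[OF P_closed[OF ab_closed(2)[OF yM]] P_closed[OF yM] yM])
    also have "d (P n x (b n (x n) y)) (P n x y) = d (b n (x n) y) y"
      by (rule isometries_dist[OF P_isometries ab_closed(2)[OF yM] yM])
    also have "\<bar>x n\<bar> < \<delta>2" using x \<delta>2(1) by (auto dest!: spec[of _ n])
    then have "d (b n (x n) y) y < \<eta> / 2" using \<delta>2(2)[of "x n"] y by simp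
    moreover have "d (P n x y) y \<le> \<eta> / 2" using \<delta>1(2)[of x] x y by auto
    ultimately show "d (P (Suc n) x y) y \<le> \<eta>" by simp
  qed (use \<delta>1 \<delta>2 in auto)
qed

text \<open>The step that doubles the scale in the counting argument; the bound matches the radius
  of the compact balls.\<close>

lemma double_W:
  assumes "P n v \<in> W" "y \<in> F"
  shows "d (P n (\<lambda>i. v i + v i) y) y \<le> 2 * \<epsilon>"
proof -
  have y: "y \<in> M" using assms F by auto
  have "d (P n v (P n v y)) y \<le> d (P n v (P n v y)) (P n v y) + d (P n v y) y"
    by (rule triangle[OF P_closed[OF P_closed[OF y]] P_closed[OF y] y])
  also have "d (P n v (P n v y)) (P n v y) = d (P n v y) y"
    by (rule isometries_dist[OF P_isometries P_closed[OF y] y])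
  finally show ?thesis using assms P_add[OF y, of n v v] by (force simp: W_def)
qed

lemma difference_W:
  assumes "\<And>y. y \<in> F \<Longrightarrow> d (P n v y) (P n v' y) \<le> \<epsilon>"
  shows "P n (\<lambda>i. v i - v' i) \<in> W"
proof -
  have "d (P n (\<lambda>i. v i - v' i) y) y \<le> \<epsilon>" if "y \<in> F" for y
  proof -
    have y: "y \<in> M" using that F by auto
    have "P n v' (P n (\<lambda>i. v i - v' i) y) = P n v y"
      using P_add[OF y, of n v' "\<lambda>i. v i - v' i"] by simp
    then have "d (P n (\<lambda>i. v i - v' i) y) y = d (P n v y) (P n v' y)"
      using isometries_dist[OF P_isometries P_closed[OF y] y, of n v' n "\<lambda>i. v i - v' i"] by simp
    then show ?thesis using assms[OF that] by simp
  qed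
  then show ?thesis using P_isometries by (simp add: W_def)
qed

text \<open>Counting: grid points whose differences, divided by \<open>2 ^ k\<close>, are small displace \<open>F\<close> little.
  Doubling the differences costs a factor \<open>Q\<close> in the number of points, whereas a cube of
  dimension \<open>n\<close> grows by the factor \<open>2 ^ n\<close>.\<close>

theorem affine_family_trivial: "\<exists>i. \<forall>z\<in>reach F. b i 1 z = z"
proof (rule ccontr)
  assume neg: "\<not> ?thesis"
  obtain Q :: nat where Q: "Q > 0" and pigeonhole:
    "\<And>(X :: (nat \<Rightarrow> nat) set) (g :: (nat \<Rightarrow> nat) \<Rightarrow> 'a \<Rightarrow> 'a). \<lbrakk>finite X;
      \<And>x. x \<in> X \<Longrightarrow> g x \<in> isometries \<and> (\<forall>y\<in>F. d (g x y) y \<le> 2 * \<epsilon>)\<rbrakk> \<Longrightarrow>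
      \<exists>X'\<subseteq>X. card X \<le> Q * card X' \<and> (\<forall>x\<in>X'. \<forall>x'\<in>X'. \<forall>y\<in>F. d (g x y) (g x' y) \<le> \<epsilon>)"
    using pigeonhole_isometries[where 'i = "nat \<Rightarrow> nat"] by blast
  \<comment> \<open>\<open>Q\<close> depends on \<open>F\<close> and \<open>\<epsilon>\<close> only,
    so the dimension may be chosen after it; the infinite family supplies enough
    coordinates.\<close>
  define n where "n = 2 * Q"
  have n: "2 * Q \<le> 2 ^ n" using less_exp[of "2 * Q"] by (simp add: n_def less_imp_le)
  obtain \<delta> where \<delta>: "\<delta> > 0" "\<And>x. \<forall>i<n. \<bar>x i\<bar> \<le> \<delta> \<Longrightarrow> P n x \<in> W"
    using P_small[OF \<epsilon>, of n] P_isometries by (auto simp: W_def)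
  have "\<forall>i<n. \<exists>R. \<forall>x. P n x \<in> W \<longrightarrow> \<bar>x i\<bar> \<le> R" using P_proper neg by blast
  then obtain R where R: "\<And>i x. i < n \<Longrightarrow> P n x \<in> W \<Longrightarrow> \<bar>x i\<bar> \<le> R i" by metis
  \<comment> \<open>A bound, in units of \<open>\<delta>\<close>, for every coordinate of a vector
    that acts by an element of \<open>W\<close>.\<close>
  define B :: nat where "B = nat \<lceil>(\<Sum>i<n. \<bar>R i\<bar>) / \<delta>\<rceil>"
  have B: "\<bar>x\<bar> \<le> real B" if "i < n" "\<delta> * \<bar>x\<bar> \<le> R i" for i x
  proof -
    have "R i \<le> (\<Sum>i<n. \<bar>R i\<bar>)" using that(1) member_le_sum[of i "{..<n}" "\<lambda>i. \<bar>R i\<bar>"] by auto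
    then have "\<bar>x\<bar> \<le> (\<Sum>i<n. \<bar>R i\<bar>) / \<delta>" using that(2) \<delta>(1) by (simp add: pos_le_divide_eq mult.commute)
    then show ?thesis unfolding B_def by linarith
  qed
  define grid where "grid k = PiE {..<n} (\<lambda>_. {..<2 ^ k :: nat})" for k
  have grid: "finite (grid k)" "card (grid k) = (2 ^ n) ^ k" for k
    by (auto simp: grid_def finite_PiE card_PiE power_mult[symmetric] mult.commute)
  \<comment> \<open>For \<open>j = 0\<close> the whole grid is shrunk to side at most
    \<open>\<delta>\<close>; each increment of \<open>j\<close> doubles it, and at
    \<open>j = k\<close> the mesh is \<open>\<delta>\<close>.\<close>
  define u where "u k j m m' = (\<lambda>i. \<delta> * 2 ^ j / 2 ^ k * (real (m i) - real (m' i)))"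
    for k j :: nat and m m' :: "nat \<Rightarrow> nat"
  have claim: "\<exists>X\<subseteq>grid k. card (grid k) \<le> Q ^ j * card X \<and> (\<forall>m\<in>X. \<forall>m'\<in>X. P n (u k j m m') \<in> W)" for k j
  proof (induction j)
    case 0
    have "P n (u k 0 m m') \<in> W" if "m \<in> grid k" "m' \<in> grid k" for m m'
    proof (rule \<delta>(2), intro allI impI)
      fix i assume "i < n"
      then have "m i < 2 ^ k" "m' i < 2 ^ k" using that by (auto simp: grid_def PiE_iff)
      then have "real (m i) < 2 ^ k" "real (m' i) < 2 ^ k"
        by (metis of_nat_less_iff of_nat_numeral of_nat_power)+
      then have "\<bar>real (m i) - real (m' i)\<bar> \<le> 2 ^ k" by linarith
      then have "\<delta> / 2 ^ k * \<bar>real (m i) - real (m' i)\<bar> \<le> \<delta> / 2 ^ k * 2 ^ k"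
        using \<delta>(1) by (intro mult_left_mono) auto
      then show "\<bar>u k 0 m m' i\<bar> \<le> \<delta>" using \<delta>(1) by (simp add: u_def abs_mult)
    qed
    then show ?case by auto
  next
    case (Suc j)
    then obtain X where X: "X \<subseteq> grid k" "card (grid k) \<le> Q ^ j * card X"
      "\<And>m m'. m \<in> X \<Longrightarrow> m' \<in> X \<Longrightarrow> P n (u k j m m') \<in> W" by blast
    have "card (grid k) > 0" by (simp add: grid(2))
    then have "card X > 0" using X(2) by (cases "card X = 0") auto
    \<comment> \<open>The pigeonhole needs one isometry per grid point, so differences are taken
      from a base point; \<open>u_diff\<close> recovers the mutual differences.\<close>
    then obtain m0 where m0: "m0 \<in> X" by fastforce
    have u_double: "u k (Suc j) m m' = (\<lambda>i. u k j m m' i + u k j m m' i)" for m m'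
      by (auto simp: u_def)
    have u_diff: "u k (Suc j) m m' = (\<lambda>i. u k (Suc j) m m0 i - u k (Suc j) m' m0 i)" for m m'
      by (rule ext) (simp add: u_def right_diff_distrib diff_divide_distrib)
    have "\<exists>X'\<subseteq>X. card X \<le> Q * card X' \<and>
        (\<forall>m\<in>X'. \<forall>m'\<in>X'. \<forall>y\<in>F. d (P n (u k (Suc j) m m0) y) (P n (u k (Suc j) m' m0) y) \<le> \<epsilon>)"
    proof (rule pigeonhole)
      show "finite X" using X(1) grid(1) finite_subset by blast
      show "P n (u k (Suc j) m m0) \<in> isometries \<and> (\<forall>y\<in>F. d (P n (u k (Suc j) m m0) y) y \<le> 2 * \<epsilon>)"
        if "m \<in> X" for m
        unfolding u_double using double_W[OF X(3)[OF that m0]] P_isometries by blast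
    qed
    then obtain X' where X': "X' \<subseteq> X" "card X \<le> Q * card X'" "\<And>m m' y. m \<in> X' \<Longrightarrow> m' \<in> X' \<Longrightarrow> y \<in> F \<Longrightarrow>
        d (P n (u k (Suc j) m m0) y) (P n (u k (Suc j) m' m0) y) \<le> \<epsilon>"
      by blast
    have "P n (u k (Suc j) m m') \<in> W" if "m \<in> X'" "m' \<in> X'" for m m'
      by (subst u_diff, rule difference_W, rule X'(3)[OF that])
    moreover have "card (grid k) \<le> Q ^ Suc j * card X'"
      using order_trans[OF X(2) mult_le_mono2[OF X'(2)]] by (simp add: mult_ac)
    ultimately show ?case using X' X(1) by (intro exI[of _ X']) auto
  qed
  have "(2::nat) ^ k \<le> (2 * B + 1) ^ n" for k
  proof -
    obtain X where X: "X \<subseteq> grid k" "card (grid k) \<le> Q ^ k * card X"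
      "\<And>m m'. m \<in> X \<Longrightarrow> m' \<in> X \<Longrightarrow> P n (u k k m m') \<in> W" using claim[of k k] by blast
    have "card (grid k) > 0" by (simp add: grid(2))
    then have "card X > 0" using X(2) by (cases "card X = 0") auto
    then obtain m0 where m0: "m0 \<in> X" by fastforce
    \<comment> \<open>Subtraction on \<open>nat\<close> is truncated, which can only shorten these
      intervals; each has at most \<open>2 * B + 1\<close> elements.\<close>
    have "X \<subseteq> PiE {..<n} (\<lambda>i. {m0 i - B..m0 i + B})"
    proof
      fix m assume m: "m \<in> X"
      have "m i \<in> {m0 i - B..m0 i + B}" if "i < n" for i
      proof -
        have "\<delta> * \<bar>real (m i) - real (m0 i)\<bar> \<le> R i"
          using R[OF that X(3)[OF m m0]] \<delta>(1) by (simp add: u_def abs_mult)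
        from B[OF that this] show ?thesis by auto
      qed
      then show "m \<in> PiE {..<n} (\<lambda>i. {m0 i - B..m0 i + B})"
        using m X(1) by (auto simp: grid_def PiE_iff)
    qed
    then have "card X \<le> card (PiE {..<n} (\<lambda>i. {m0 i - B..m0 i + B}))"
      by (intro card_mono finite_PiE) auto
    also have "\<dots> \<le> (2 * B + 1) ^ n"
      using prod_mono[of "{..<n}" "\<lambda>i. Suc (m0 i + B) - (m0 i - B)" "\<lambda>_. 2 * B + 1"]
      by (simp add: card_PiE)
    finally have card_X: "card X \<le> (2 * B + 1) ^ n" .
    \<comment> \<open>The factor \<open>Q ^ k\<close> lost in the doublings cancels, leaving an
      exponential in \<open>k\<close> below a constant.\<close>
    have "Q ^ k * 2 ^ k = (2 * Q) ^ k" by (simp add: power_mult_distrib)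
    also have "\<dots> \<le> (2 ^ n) ^ k" using n by (rule power_mono) simp
    also have "\<dots> \<le> Q ^ k * (2 * B + 1) ^ n"
      using X(2) card_X by (simp add: grid(2) order_trans)
    finally show ?thesis using Q by simp
  qed
  from this[of "(2 * B + 1) ^ n"] show False using less_exp[of "(2 * B + 1) ^ n"] by linarith
qed

end

section \<open>The diffeomorphism group\<close>

lemma smooth_manifold_chart_at:
  assumes "smooth_manifold M A" "x \<in> topspace M"
  obtains c where "c \<in> A" "x \<in> fst c"
proof -
  have "x \<in> (\<Union>(U, \<phi>)\<in>A. U)" using assms by (simp add: smooth_manifold_def)
  then obtain c where "c \<in> A" "x \<in> (case c of (U, \<phi>) \<Rightarrow> U)" by (rule UN_E)
  then show thesis using that by (simp add: case_prod_beta)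
qed

lemma smooth_manifold_is_chart: "smooth_manifold M A \<Longrightarrow> c \<in> A \<Longrightarrow> is_chart M c"
  by (simp add: smooth_manifold_def)

lemma Cr_mapsD:
  assumes "f \<in> Cr_maps M A r"
  shows "continuous_map M M f" "f \<in> extensional (topspace M)"
    and "c \<in> A \<Longrightarrow> c' \<in> A \<Longrightarrow> enat k \<le> r \<Longrightarrow>
      Ck k (snd c ` {x\<in>fst c. f x \<in> fst c'}) (local_rep c c' f)"
proof -
  show "continuous_map M M f" "f \<in> extensional (topspace M)" using assms by (auto simp: Cr_maps_def)
  assume c: "c \<in> A" "c' \<in> A" "enat k \<le> r"
  have "\<forall>(U, \<phi>)\<in>A. \<forall>(V, \<psi>)\<in>A. Cr_on r (\<phi> ` {x\<in>U. f x \<in> V}) (local_rep (U, \<phi>) (V, \<psi>) f)"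
    using assms by (simp add: Cr_maps_def)
  from bspec[OF bspec[OF this c(1), unfolded case_prod_beta] c(2)]
  have "Cr_on r (snd c ` {x\<in>fst c. f x \<in> fst c'}) (local_rep c c' f)" by simp
  then show "Ck k (snd c ` {x\<in>fst c. f x \<in> fst c'}) (local_rep c c' f)"
    using c(3) by (simp add: Cr_on_iff_Ck)
qed

lemma open_local_domain:
  assumes "is_chart M c" "is_chart M c'" "continuous_map M M f"
  shows "open (snd c ` {x\<in>fst c. f x \<in> fst c'})"
proof -
  have c: "is_chart M (fst c, snd c)" "is_chart M (fst c', snd c')" using assms by auto
  have "openin M (fst c \<inter> {x\<in>topspace M. f x \<in> fst c'})"
    using openin_continuous_map_preimage[OF assms(3) is_chartD(1)[OF c(2)]] is_chartD(1)[OF c(1)]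
    by (rule openin_Int[rotated])
  moreover have "fst c \<inter> {x\<in>topspace M. f x \<in> fst c'} = {x\<in>fst c. f x \<in> fst c'}"
    using is_chartD(3)[OF c(1)] by auto
  ultimately show ?thesis using is_chartD(5)[OF c(1)] by auto
qed

text \<open>Near each point the composite is factored through a chart around the image under
  \<open>g\<close>; being C^k is local, so these pieces suffice.\<close>

lemma Cr_maps_compose:
  assumes M: "smooth_manifold M A" and f: "f \<in> Cr_maps M A r" and g: "g \<in> Cr_maps M A r"
  shows "compose (topspace M) f g \<in> Cr_maps M A r"
proof -
  let ?h = "compose (topspace M) f g"
  note charts = smooth_manifold_is_chart[OF M]
  have sub: "fst c \<subseteq> topspace M" and inj: "inj_on (snd c) (fst c)" if "c \<in> A" for c
    using is_chartD(3,4)[of M "fst c" "snd c"] charts[OF that] by auto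
  have gM: "g x \<in> topspace M" if "x \<in> topspace M" for x
    using Cr_mapsD(1)[OF g] that by (auto simp: continuous_map_def)
  have "continuous_map M M (f \<circ> g)"
    using Cr_mapsD(1)[OF f] Cr_mapsD(1)[OF g] continuous_map_compose by blast
  then have cont: "continuous_map M M ?h"
    by (rule continuous_map_eq) (simp add: compose_def)
  have "Ck k (snd c ` {x\<in>fst c. ?h x \<in> fst c'}) (local_rep c c' ?h)"
    if c: "c \<in> A" "c' \<in> A" and k: "enat k \<le> r" for c c' k
  proof (rule Ck_local)
    fix y assume "y \<in> snd c ` {x\<in>fst c. ?h x \<in> fst c'}"
    then obtain x where x: "y = snd c x" "x \<in> fst c" "?h x \<in> fst c'" by blast
    have xM: "x \<in> topspace M" using subsetD[OF sub[OF c(1)] x(2)] .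
    obtain e where e: "e \<in> A" "g x \<in> fst e"
      using smooth_manifold_chart_at[OF M gM[OF xM]] by blast
    let ?S1 = "snd c ` {x\<in>fst c. g x \<in> fst e}" and ?S2 = "snd e ` {x\<in>fst e. f x \<in> fst c'}"
    have S1: "open ?S1" and S2: "open ?S2"
      using open_local_domain charts c e(1) Cr_mapsD(1)[OF f] Cr_mapsD(1)[OF g] by blast+
    have k1: "Ck k ?S1 (local_rep c e g)" and k2: "Ck k ?S2 (local_rep e c' f)"
      using Cr_mapsD(3)[OF g c(1) e(1) k] Cr_mapsD(3)[OF f e(1) c(2) k] .
    define T where "T = {y\<in>?S1. local_rep c e g y \<in> ?S2}"
    have T: "open T" "T \<subseteq> ?S1"
      using continuous_open_preimage[OF Ck_continuous_on[OF k1] S1 S2]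
      by (auto simp: T_def vimage_def Int_def)
    have rep: "local_rep c e g (snd c x) = snd e (g x)" if "x \<in> fst c" for x
      using inj[OF c(1)] that by (simp add: local_rep_def)
    have "Ck k T (\<lambda>y. local_rep e c' f (local_rep c e g y))"
      by (rule Ck_compose[OF T(1) S2 _ Ck_subset[OF k1 T(2)] k2]) (auto simp: T_def)
    then have "Ck k T (local_rep c c' ?h)"
    proof (rule Ck_cong[OF T(1), rotated])
      fix y assume "y \<in> T"
      then obtain x where x: "y = snd c x" "x \<in> fst c" "g x \<in> fst e" by (auto simp: T_def)
      then show "local_rep e c' f (local_rep c e g y) = local_rep c c' ?h y"
        using inj[OF c(1)] inj[OF e(1)] sub[OF c(1)]
        by (auto simp: local_rep_def compose_def)
    qed
    moreover have "y \<in> T"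
      using x e(2) rep xM by (auto simp: T_def compose_def)
    ultimately show "\<exists>T. open T \<and> y \<in> T \<and> Ck k T (local_rep c c' ?h)" using T(1) by blast
  qed
  then have "Cr_on r (snd c ` {x\<in>fst c. ?h x \<in> fst c'}) (local_rep c c' ?h)"
    if "c \<in> A" "c' \<in> A" for c c' using that by (simp add: Cr_on_iff_Ck)
  then show ?thesis
    unfolding Cr_maps_def using cont by fastforce
qed

lemma Diff_compose:
  assumes M: "smooth_manifold M A" and f: "f \<in> Diff M A r" and g: "g \<in> Diff M A r"
  shows "compose (topspace M) f g \<in> Diff M A r"
proof -
  let ?T = "topspace M"
  have B: "f \<in> Bij ?T" "g \<in> Bij ?T" using f g by (auto simp: Diff_def)
  then have bij: "bij_betw f ?T ?T" "bij_betw g ?T ?T" by (auto simp: Bij_def)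
  have fgB: "compose ?T f g \<in> Bij ?T" using compose_Bij B by blast
  have "restrict (inv_into ?T (compose ?T f g)) ?T =
      compose ?T (restrict (inv_into ?T g) ?T) (restrict (inv_into ?T f) ?T)"
  proof
    fix x
    show "restrict (inv_into ?T (compose ?T f g)) ?T x =
      compose ?T (restrict (inv_into ?T g) ?T) (restrict (inv_into ?T f) ?T) x"
    proof (cases "x \<in> ?T")
      case True
      define y where "y = inv_into ?T f x"
      define z where "z = inv_into ?T g y"
      have y: "y \<in> ?T" "f y = x" using bij(1) True unfolding y_def
        by (auto simp: bij_betw_def inv_into_into f_inv_into_f)
      have z: "z \<in> ?T" "g z = y" using bij(2) y(1) unfolding z_def
        by (auto simp: bij_betw_def inv_into_into f_inv_into_f)
      have "inv_into ?T (compose ?T f g) x = z"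
        using fgB z y by (intro inv_into_f_eq) (auto simp: Bij_def bij_betw_def compose_def)
      then show ?thesis using True y(1) by (simp add: compose_def y_def[symmetric] z_def[symmetric])
    qed (simp add: compose_def)
  qed
  then show ?thesis using f g fgB Cr_maps_compose[OF M] by (simp add: Diff_def)
qed

lemma chart_lift_compose:
  assumes "is_chart M (U, \<phi>)" "\<And>y. y \<in> \<phi> ` U \<Longrightarrow> g y \<in> \<phi> ` U"
  shows "compose (topspace M) (chart_lift M U \<phi> f) (chart_lift M U \<phi> g) = chart_lift M U \<phi> (\<lambda>x. f (g x))"
proof
  fix x
  note U = is_chartD[OF assms(1)]
  show "compose (topspace M) (chart_lift M U \<phi> f) (chart_lift M U \<phi> g) x = chart_lift M U \<phi> (\<lambda>x. f (g x)) x"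
  proof (cases "x \<in> U")
    case True
    then have "g (\<phi> x) \<in> \<phi> ` U" using assms(2) by blast
    then have "inv_into U \<phi> (g (\<phi> x)) \<in> U" "\<phi> (inv_into U \<phi> (g (\<phi> x))) = g (\<phi> x)"
      by (simp_all add: inv_into_into f_inv_into_f)
    then show ?thesis using True U(3) by (auto simp: compose_def chart_lift_def)
  qed (auto simp: compose_def chart_lift_def)
qed

text \<open>The identity is the lift of the constant flow with empty support, so the results on
  chart flows apply to it.\<close>

lemma id_Diff:
  assumes "smooth_manifold M A" "Hausdorff_space M" "A \<noteq> {}"
  shows "(\<lambda>x\<in>topspace M. x) \<in> Diff M A r"
proof -
  obtain U \<phi> where c: "(U, \<phi>) \<in> A" using assms(3) by fastforce
  have "Ck k UNIV (\<lambda>y::real \<times> 'b. snd y)" for k by (simp add: Ck_snd)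
  then interpret chart_flow M A U \<phi> "{}" "\<lambda>t x. x"
    by unfold_locales (use assms c in \<open>auto simp: smooth_flow_def\<close>)
  show ?thesis using L_Diff[of r] L_0 by simp
qed

lemma topspace_Diff_topology:
  assumes "A \<noteq> {}"
  shows "topspace (Diff_topology M A r) = Diff M A r"
proof -
  obtain c where c: "c \<in> A" using assms by blast
  have "f \<in> topspace (Cr_topology M A r)" if "f \<in> Diff M A r" for f
  proof -
    have f: "f \<in> Cr_maps M A r" using that by (simp add: Diff_def)
    \<comment> \<open>For an empty compact set both conditions are vacuous and the generating set is
      all of \<open>Cr_maps M A r\<close>.\<close>
    then have "f \<in> Cr_nbhd M A r 0 f c c {} 1" by (simp add: Cr_nbhd_def)
    moreover have "openin (Cr_topology M A r) (Cr_nbhd M A r 0 f c c {} 1)"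
      unfolding Cr_topology_def
      by (rule topology_generated_by_Basis, rule CollectI, rule exI[of _ 0], rule exI[of _ f],
          rule exI[of _ c], rule exI[of _ c], rule exI[of _ "{}"], rule exI[of _ 1])
        (use f c in \<open>auto simp: zero_enat_def[symmetric]\<close>)
    ultimately show ?thesis using openin_subset by blast
  qed
  then show ?thesis by (auto simp: Diff_topology_def topspace_subtopology)
qed

text \<open>In the neighbourhood \<open>W\<close> below, being small is a condition on all points of \<open>M\<close>, so that it is
  violated by a suitable conjugate of any map other than the identity.\<close>

lemma Diff_small_conjugates:
  fixes A :: "('m, 'e::euclidean_space) chart set"
  assumes M: "smooth_manifold M A" "Hausdorff_space M" "compact_space M" and A: "A \<noteq> {}"
  obtains W where "openin (Diff_topology M A r) W" "(\<lambda>x\<in>topspace M. x) \<in> W"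
    and "\<And>g. g \<in> W \<Longrightarrow> g \<noteq> (\<lambda>x\<in>topspace M. x) \<Longrightarrow>
      \<exists>U \<phi> K F t. chart_flow M A U \<phi> K F \<and> compose (topspace M) (chart_lift M U \<phi> (F t))
        (compose (topspace M) g (chart_lift M U \<phi> (F (- t)))) \<notin> W"
proof -
  let ?id = "\<lambda>x\<in>topspace M. x"
  note charts = smooth_manifold_is_chart[OF M(1)]
  \<comment> \<open>The radius \<open>3 * \<rho>\<close> makes room for a flow supported within
    \<open>2 * \<rho>\<close> of any point \<open>p\<close> that lies within \<open>\<rho>\<close>
    of the centre.\<close>
  have "\<exists>U \<phi> \<rho>. (U, \<phi>) \<in> A \<and> x \<in> U \<and> \<rho> > 0 \<and> cball (\<phi> x) (3 * \<rho>) \<subseteq> \<phi> ` U"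
    if x: "x \<in> topspace M" for x
  proof -
    obtain U \<phi> where c: "(U, \<phi>) \<in> A" "x \<in> U"
      using smooth_manifold_chart_at[OF M(1) x] by (metis prod.collapse)
    then obtain e where "e > 0" "cball (\<phi> x) e \<subseteq> \<phi> ` U"
      using is_chartD(2)[OF charts[OF c(1)]] open_contains_cball by blast
    then show ?thesis using c by (intro exI[of _ U] exI[of _ \<phi>] exI[of _ "e / 3"]) auto
  qed
  then have "\<forall>x\<in>topspace M. \<exists>s. (fst s, fst (snd s)) \<in> A \<and> x \<in> fst s \<and> snd (snd s) > 0 \<and>
      cball (fst (snd s) x) (3 * snd (snd s)) \<subseteq> fst (snd s) ` fst s"
    by (metis fst_conv snd_conv)
  from bchoice[OF this] obtain s where s: "\<forall>x\<in>topspace M. (fst (s x), fst (snd (s x))) \<in> A \<and>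
      x \<in> fst (s x) \<and> snd (snd (s x)) > 0 \<and>
      cball (fst (snd (s x)) x) (3 * snd (snd (s x))) \<subseteq> fst (snd (s x)) ` fst (s x)" ..
  define U \<phi> \<rho> where "U x = fst (s x)" and "\<phi> x = fst (snd (s x))" and "\<rho> x = snd (snd (s x))" for x
  have c: "(U x, \<phi> x) \<in> A" and x_in: "x \<in> U x" and \<rho>: "\<rho> x > 0"
    and ball: "cball (\<phi> x x) (3 * \<rho> x) \<subseteq> \<phi> x ` U x" if "x \<in> topspace M" for x
    using bspec[OF s that] unfolding U_def \<phi>_def \<rho>_def by blast+
  define K where "K x = {z\<in>U x. \<phi> x z \<in> cball (\<phi> x x) (\<rho> x)}" for x
  define B where "B x = {z\<in>U x. \<phi> x z \<in> ball (\<phi> x x) (\<rho> x)}" for x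
  have K: "compactin M (K x)" "K x \<subseteq> U x" "B x \<subseteq> K x" "openin M (B x)" "x \<in> B x"
    if x: "x \<in> topspace M" for x
  proof -
    note U = is_chartD[OF charts[OF c[OF x]]]
    have "cball (\<phi> x x) (\<rho> x) \<subseteq> \<phi> x ` U x"
      using ball[OF x] \<rho>[OF x] subset_cball[of "\<rho> x" "3 * \<rho> x" "\<phi> x x"] by auto
    then have "\<phi> x ` K x = cball (\<phi> x x) (\<rho> x)" by (auto simp: K_def)
    then show "compactin M (K x)" using U(7)[of "K x"] by (auto simp: K_def)
    show "openin M (B x)" unfolding B_def by (rule U(6)) simp
    show "x \<in> B x" "K x \<subseteq> U x" "B x \<subseteq> K x" using x_in[OF x] \<rho>[OF x] by (auto simp: B_def K_def)
  qed
  have "topspace M \<subseteq> \<Union>(B ` topspace M)" using K(5) by blast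
  then obtain X where X: "finite X" "X \<subseteq> topspace M" "topspace M \<subseteq> \<Union>(B ` X)"
    using compactinD[of M "topspace M" "B ` topspace M"] M(3) K(4) unfolding compact_space_def
    by (metis (no_types, lifting) finite_subset_image imageE)
  define N where "N x = Cr_nbhd M A r 0 ?id (U x, \<phi> x) (U x, \<phi> x) (K x) (\<rho> x)" for x
  define W where "W = (\<Inter>x\<in>X. N x \<inter> Diff M A r) \<inter> topspace (Diff_topology M A r)"
  have id: "?id \<in> Diff M A r" using id_Diff[OF M(1,2) A] .
  have idK: "?id ` K x = K x" if "x \<in> topspace M" for x
    using K(1)[OF that] compactin_subset_topspace[of M "K x"] by (auto simp: image_iff) 
  have N_open: "openin (Diff_topology M A r) (N x \<inter> Diff M A r)" if "x \<in> X" for x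
  proof -
    have x: "x \<in> topspace M" using that X(2) by auto
    have "openin (Cr_topology M A r) (N x)"
      unfolding N_def Cr_topology_def
      by (rule topology_generated_by_Basis, rule CollectI, rule exI[of _ 0], rule exI[of _ ?id],
          rule exI[of _ "(U x, \<phi> x)"], rule exI[of _ "(U x, \<phi> x)"], rule exI[of _ "K x"], rule exI[of _ "\<rho> x"])
        (use id c[OF x] K[OF x] idK[OF x] \<rho>[OF x] in \<open>auto simp: zero_enat_def[symmetric] Diff_def\<close>)
    then show ?thesis by (auto simp: Diff_topology_def openin_subtopology)
  qed
  have close: "g z \<in> U x \<and> norm (\<phi> x (g z) - \<phi> x z) < \<rho> x" if "g \<in> W" "x \<in> X" "z \<in> K x" for g x z
  proof -
    have x: "x \<in> topspace M" using that X(2) by auto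
    have z: "z \<in> U x" "z \<in> topspace M" using that(3) is_chartD(3)[OF charts[OF c[OF x]]] by (auto simp: K_def)
    have "g \<in> N x" using that unfolding W_def by blast
    then have "g z \<in> U x" "norm (local_rep (U x, \<phi> x) (U x, \<phi> x) g (\<phi> x z) - local_rep (U x, \<phi> x) (U x, \<phi> x) ?id (\<phi> x z)) < \<rho> x"
      using that(3) unfolding N_def Cr_nbhd_def by (auto dest!: bspec[of _ _ z] spec[of _ "[]"])
    then show ?thesis using z is_chartD(4)[OF charts[OF c[OF x]]] by (simp add: local_rep_def)
  qed
  show thesis
  proof (rule that[of W])
    show "openin (Diff_topology M A r) W"
      unfolding W_def by (rule openin_INT[OF X(1) N_open])
    have "?id \<in> N x" if "x \<in> X" for x
      using id that X(2) idK[of x] K(2)[of x] \<rho>[of x] by (auto simp: N_def Cr_nbhd_def Diff_def)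
    then show "?id \<in> W" using id by (auto simp: W_def topspace_Diff_topology[OF A])
    fix g assume g: "g \<in> W" and ne: "g \<noteq> ?id"
    have gD: "g \<in> Diff M A r" using g by (simp add: W_def topspace_Diff_topology[OF A])
    then have "g \<in> extensional (topspace M)" by (auto simp: Diff_def Bij_def)
    then obtain p where p: "p \<in> topspace M" "g p \<noteq> p"
      using ne by (metis extensionalityI restrict_apply' restrict_extensional)
    obtain x where x: "x \<in> X" "p \<in> B x" using X(3) p(1) by blast
    have xM: "x \<in> topspace M" using x X(2) by auto
    note U = is_chartD[OF charts[OF c[OF xM]]]
    have pK: "p \<in> K x" using K(3)[OF xM] x by auto
    then have pU: "p \<in> U x" and pball: "\<phi> x p \<in> cball (\<phi> x x) (\<rho> x)" by (auto simp: K_def)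
    have gp: "g p \<in> U x" "norm (\<phi> x (g p) - \<phi> x p) < \<rho> x" using close[OF g x(1) pK] by auto
    \<comment> \<open>Membership in \<open>W\<close> keeps \<open>g p\<close> at distance less than
      \<open>\<rho>\<close> from \<open>p\<close>. A flow fixing \<open>p\<close> pushes it to
      distance exactly \<open>\<rho>\<close>; the conjugate sends \<open>p\<close> there and so
      violates the strict bound.\<close>
    have "\<phi> x p \<noteq> \<phi> x (g p)" using U(4) pU gp(1) p(2) by (metis inj_onD)
    from exists_smooth_flow_pushing[OF this gp(2)] obtain F t where push: "smooth_flow (cball (\<phi> x p) (2 * \<rho> x)) F"
      "\<And>t. F t (\<phi> x p) = \<phi> x p" "norm (F t (\<phi> x (g p)) - \<phi> x p) = \<rho> x" by metis
    have "cball (\<phi> x p) (2 * \<rho> x) \<subseteq> cball (\<phi> x x) (3 * \<rho> x)"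
    proof
      fix y assume "y \<in> cball (\<phi> x p) (2 * \<rho> x)"
      then show "y \<in> cball (\<phi> x x) (3 * \<rho> x)"
        using pball dist_triangle[of "\<phi> x x" y "\<phi> x p"] by auto
    qed
    then have sub: "cball (\<phi> x p) (2 * \<rho> x) \<subseteq> \<phi> x ` U x" using ball[OF xM] by blast
    then interpret chart_flow M A "U x" "\<phi> x" "cball (\<phi> x p) (2 * \<rho> x)" F
      by unfold_locales (use M c[OF xM] push(1) in auto)
    define k where "k = compose (topspace M) (L t) (compose (topspace M) g (L (- t)))"
    have "\<phi> x (L (- t) p) = \<phi> x p" using L_chart(2)[OF pU] push(2) by simp
    then have "L (- t) p = p" using L_chart(1)[OF pU] pU U(4) by (metis inj_onD)
    then have "k p = L t (g p)" using p(1) by (simp add: k_def compose_def)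
    then have "norm (\<phi> x (k p) - \<phi> x p) = \<rho> x" using L_chart(2)[OF gp(1)] push(3) by simp
    then have "k \<notin> W" using close[OF _ x(1) pK, of k] by auto
    then show "\<exists>U \<phi> K F t. chart_flow M A U \<phi> K F \<and> compose (topspace M) (chart_lift M U \<phi> (F t))
        (compose (topspace M) g (chart_lift M U \<phi> (F (- t)))) \<notin> W"
      using chart_flow_axioms unfolding k_def by blast
  qed
qed

section \<open>Actions of the diffeomorphism group by isometries\<close>

lemma (in Metric_space) compactin_mcball_subset:
  "compactin mtopology (mcball x s) \<Longrightarrow> r \<le> s \<Longrightarrow> compactin mtopology (mcball x r)"
  by (rule closed_compactin[OF _ mcball_subset_concentric closedin_mcball])

lemma (in Metric_space) locally_compact_mcball:
  assumes "locally_compact_space mtopology" "x \<in> M"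
  shows "\<exists>r>0. compactin mtopology (mcball x r)"
proof -
  obtain U K where UK: "openin mtopology U" "compactin mtopology K" "x \<in> U" "U \<subseteq> K"
    using assms unfolding locally_compact_space_def by auto
  then obtain r where r: "r > 0" "mball x r \<subseteq> U" unfolding openin_mtopology by blast
  have "mcball x (r / 2) \<subseteq> K" using mcball_subset_mball_concentric[of "r / 2" r x] r UK(4) by auto
  then have "compactin mtopology (mcball x (r / 2))"
    by (rule closed_compactin[OF UK(2) _ closedin_mcball])
  then show ?thesis using r(1) by (intro exI[of _ "r / 2"]) auto
qed

locale Diff_isometric_action =
  fixes M :: "'m topology" and A :: "('m, 'e::euclidean_space) chart set" and r :: enat
    and Y :: "'y metric" and H :: "('y \<Rightarrow> 'y) set" and h :: "('m \<Rightarrow> 'm) \<Rightarrow> 'y \<Rightarrow> 'y"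
  assumes manifold: "smooth_manifold M A" and compact: "compact_space M"
    and Hausdorff: "Hausdorff_space M" and nonempty: "topspace M \<noteq> {}"
    and locally_compact: "locally_compact_space (mtopology_of Y)"
    and H: "subgroup H (Iso_group Y)"
    and h_iso: "h \<in> iso (Diff_group M A r) (Iso_group Y \<lparr>carrier := H\<rparr>)"
    and h_homeomorphic: "homeomorphic_map (Diff_topology M A r) (subtopology (Iso_topology Y) H) h"
begin

abbreviation "\<D> \<equiv> Diff M A r"
abbreviation "S \<equiv> mspace Y"
abbreviation "\<iota> \<equiv> \<lambda>x\<in>topspace M. x"

sublocale Y: Metric_space S "mdist Y"
  by (rule Metric_space_mspace_mdist)

lemma mtopology_Y: "Y.mtopology = mtopology_of Y"
  by (simp add: mtopology_of_def)

sublocale Y: locally_compact_metric S "mdist Y"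
proof
  show "\<exists>r>0. Y.relc x r" if "x \<in> S" for x
    using Y.locally_compact_mcball[OF _ that] locally_compact Y.compactin_imp_relc
    unfolding mtopology_Y by blast
qed

lemma A_nonempty: "A \<noteq> {}"
  using smooth_manifold_chart_at[OF manifold] nonempty by blast

lemma topspace_Diff: "topspace (Diff_topology M A r) = \<D>"
  by (rule topspace_Diff_topology[OF A_nonempty])

lemma carrier_Diff: "carrier (Diff_group M A r) = \<D>"
  by (simp add: Diff_group_def)

lemma H_Iso: "H \<subseteq> Iso Y"
  using subgroup.subset[OF H] by (simp add: Iso_group_def)

lemma h_bij: "bij_betw h \<D> H"
  using h_iso by (simp add: iso_def carrier_Diff)

lemma h_Iso: "f \<in> \<D> \<Longrightarrow> h f \<in> Iso Y"
  using h_bij H_Iso by (auto simp: bij_betw_def)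

lemma h_isometries: "f \<in> \<D> \<Longrightarrow> h f \<in> Y.isometries"
  using h_Iso[of f] by (auto simp: Iso_def Bij_def bij_betw_def Y.isometries_def)

lemmas h_closed = Y.isometries_closed[OF h_isometries]

lemma h_compose:
  assumes "f \<in> \<D>" "g \<in> \<D>" "y \<in> S"
  shows "h (compose (topspace M) f g) y = h f (h g y)"
proof -
  have B: "f \<in> Bij (topspace M)" "g \<in> Bij (topspace M)" using assms by (auto simp: Diff_def)
  have hB: "h f \<in> Bij S" "h g \<in> Bij S" using h_Iso assms by (auto simp: Iso_def)
  have "h (f \<otimes>\<^bsub>Diff_group M A r\<^esub> g) = h f \<otimes>\<^bsub>Iso_group Y \<lparr>carrier := H\<rparr>\<^esub> h g"
    using h_iso assms unfolding iso_def hom_def carrier_Diff by blast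
  then have "h (compose (topspace M) f g) = compose S (h f) (h g)"
    using B hB by (simp add: Diff_group_def Iso_group_def BijGroup_def)
  then show ?thesis using assms(3) by (simp add: compose_def)
qed

lemma \<iota>_Diff: "\<iota> \<in> \<D>"
  by (rule id_Diff[OF manifold Hausdorff A_nonempty])

lemma h_\<iota>: "y \<in> S \<Longrightarrow> h \<iota> y = y"
proof -
  assume y: "y \<in> S"
  have "compose (topspace M) \<iota> \<iota> = \<iota>" by (auto simp: compose_def)
  then have "h \<iota> (h \<iota> y) = h \<iota> y" using h_compose[OF \<iota>_Diff \<iota>_Diff y] by simp
  moreover have "inj_on (h \<iota>) S" using h_Iso[OF \<iota>_Diff] by (auto simp: Iso_def Bij_def bij_betw_def)
  ultimately show ?thesis using h_closed[OF \<iota>_Diff y] y by (auto dest: inj_onD)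
qed

lemma openin_displacement:
  assumes y: "y \<in> S"
  shows "openin (Diff_topology M A r) {f\<in>\<D>. mdist Y (h f y) y < e}"
proof -
  have "continuous_map (Diff_topology M A r) (product_topology (\<lambda>_. mtopology_of Y) S) h"
    using homeomorphic_imp_continuous_map[OF h_homeomorphic]
    by (simp add: Iso_topology_def continuous_map_in_subtopology)
  then have "continuous_map (Diff_topology M A r) (mtopology_of Y) (\<lambda>f. h f y)"
    using continuous_map_compose[OF _ continuous_map_product_projection[OF y]] by (fastforce simp: o_def)
  moreover have "openin (mtopology_of Y) (Y.mball y e)"
    using Y.openin_mball by (simp add: mtopology_Y)
  ultimately have "openin (Diff_topology M A r) {f\<in>topspace (Diff_topology M A r). h f y \<in> Y.mball y e}"
    by (rule openin_continuous_map_preimage)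
  also have "{f\<in>topspace (Diff_topology M A r). h f y \<in> Y.mball y e} = {f\<in>\<D>. mdist Y (h f y) y < e}"
    using y h_closed by (auto simp: topspace_Diff Y.commute)
  finally show ?thesis .
qed

text \<open>Via \<open>h\<close>, the set \<open>W\<close> is open for pointwise convergence. A
  basic open set of the product constrains only finitely many coordinates, and these points form
  \<open>F\<close>.\<close>

lemma identity_neighbourhood:
  assumes W: "openin (Diff_topology M A r) W" "\<iota> \<in> W"
  obtains F \<epsilon> where "finite F" "F \<subseteq> S" "\<epsilon> > 0"
    "\<And>y. y \<in> F \<Longrightarrow> compactin Y.mtopology (Y.mcball y (2 * \<epsilon>))"
    "\<And>f. f \<in> \<D> \<Longrightarrow> (\<And>y. y \<in> F \<Longrightarrow> mdist Y (h f y) y \<le> \<epsilon>) \<Longrightarrow> f \<in> W"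
proof -
  let ?P = "product_topology (\<lambda>_. mtopology_of Y) S"
  have WD: "W \<subseteq> \<D>" using openin_subset[OF W(1)] by (simp add: topspace_Diff)
  have "openin (subtopology (Iso_topology Y) H) (h ` W)"
    using homeomorphic_map_openness[OF h_homeomorphic] WD W(1) by (simp add: topspace_Diff)
  then obtain V where V: "openin ?P V" "h ` W = V \<inter> Iso Y \<inter> H"
    by (auto simp: Iso_topology_def openin_subtopology Int_assoc)
  have "h \<iota> \<in> V" using W(2) V(2) by blast
  then obtain U where U: "finite {y\<in>S. U y \<noteq> topspace (mtopology_of Y)}"
    "\<forall>y\<in>S. openin (mtopology_of Y) (U y)" "h \<iota> \<in> PiE S U" "PiE S U \<subseteq> V"
    using V(1) unfolding openin_product_topology_alt by meson
  define F where "F = {y\<in>S. U y \<noteq> topspace (mtopology_of Y)}"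
  have F: "finite F" "F \<subseteq> S" using U(1) by (auto simp: F_def)
  have "eventually (\<lambda>e. \<forall>y\<in>F. compactin Y.mtopology (Y.mcball y (2 * e)) \<and> Y.mcball y e \<subseteq> U y) (at_right 0)"
  proof (intro eventually_ball_finite ballI F(1))
    fix y assume "y \<in> F"
    then have y: "y \<in> S" using F by blast
    obtain c where c: "c > 0" "compactin Y.mtopology (Y.mcball y c)"
      using Y.locally_compact_mcball[OF _ y] locally_compact unfolding mtopology_Y by blast
    have "y \<in> U y" using U(3) h_\<iota>[OF y] y by (metis PiE_mem)
    then obtain e where e: "e > 0" "Y.mball y e \<subseteq> U y"
      using bspec[OF U(2) y] unfolding mtopology_Y[symmetric] Y.openin_mtopology by blast
    show "eventually (\<lambda>e. compactin Y.mtopology (Y.mcball y (2 * e)) \<and> Y.mcball y e \<subseteq> U y) (at_right 0)"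
      unfolding eventually_at_right_field
    proof (intro exI[of _ "min (c / 2) e"] conjI allI impI)
      fix x :: real assume x: "0 < x" "x < min (c / 2) e"
      show "compactin Y.mtopology (Y.mcball y (2 * x))"
        by (rule Y.compactin_mcball_subset[OF c(2)]) (use x in auto)
      show "Y.mcball y x \<subseteq> U y"
        using Y.mcball_subset_mball_concentric[of x e y] x e(2) by auto
    qed (use c(1) e(1) in auto)
  qed
  then obtain \<epsilon> where \<epsilon>: "\<epsilon> > 0"
    "\<forall>y\<in>F. compactin Y.mtopology (Y.mcball y (2 * \<epsilon>)) \<and> Y.mcball y \<epsilon> \<subseteq> U y"
    using eventually_happens'[OF trivial_limit_at_right_real eventually_conj[OF eventually_at_right_less]]
    by blast
  show thesis
  proof (rule that[OF F \<epsilon>(1)])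
    show "compactin Y.mtopology (Y.mcball y (2 * \<epsilon>))" if "y \<in> F" for y using \<epsilon>(2) that by blast
    fix f assume f: "f \<in> \<D>" and small: "\<And>y. y \<in> F \<Longrightarrow> mdist Y (h f y) y \<le> \<epsilon>"
    have "h f y \<in> U y" if y: "y \<in> S" for y
    proof (cases "y \<in> F")
      case True
      then have "h f y \<in> Y.mcball y \<epsilon>" using small[OF True] y h_closed[OF f y] by (simp add: Y.commute)
      then show ?thesis using \<epsilon>(2) True by blast
    next
      case False
      then show ?thesis using y h_closed[OF f y] by (simp add: F_def)
    qed
    moreover have "h f \<in> extensional S" using h_Iso[OF f] by (auto simp: Iso_def Bij_def)
    ultimately have "h f \<in> V" using U(4) by (auto simp: PiE_def)
    moreover have "h f \<in> H" using h_bij f by (auto simp: bij_betw_def)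
    ultimately have "h f \<in> h ` W" using V(2) h_Iso[OF f] by blast
    then show "f \<in> W" using h_bij f WD by (auto simp: bij_betw_def dest: inj_onD)
  qed
qed

text \<open>Continuity at time 0 combines the C^r continuity of lifted flows with the pointwise
  topology on the isometries.\<close>

lemma isometric_flow_h:
  assumes "chart_flow M A U \<phi> K F"
  shows "Y.isometric_flow (\<lambda>t. h (chart_lift M U \<phi> (F t)))"
proof -
  interpret chart_flow M A U \<phi> K F by fact
  have "((\<lambda>t. mdist Y (h (L t) y) y) \<longlongrightarrow> 0) (nhds 0)" if y: "y \<in> S" for y
  proof (rule tendstoI)
    fix e :: real assume e: "e > 0"
    have "L 0 \<in> {f\<in>\<D>. mdist Y (h f y) y < e}"
      using \<iota>_Diff h_\<iota>[OF y] y e by (simp add: L_0)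
    from eventually_L_open[OF openin_displacement[OF y] this]
    show "eventually (\<lambda>t. dist (mdist Y (h (L t) y) y) 0 < e) (nhds 0)"
      by (rule eventually_mono) auto
  qed
  moreover have "h (L (s + t)) y = h (L s) (h (L t) y)" if "y \<in> S" for s t y
    using h_compose[OF L_Diff L_Diff that, of s t] by (simp add: L_compose)
  ultimately show ?thesis
    unfolding Y.isometric_flow_def using h_isometries[OF L_Diff] h_\<iota> by (simp add: L_0)
qed

text \<open>By \<open>trivial\<close> the action on \<open>reach F\<close> is faithful. The counting
  theorem makes some translation act trivially there, although this translation moves a point of its
  shell.\<close>

lemma contradiction: False
proof -
  obtain W where W: "openin (Diff_topology M A r) W" "\<iota> \<in> W"
    and conj: "\<And>g. g \<in> W \<Longrightarrow> g \<noteq> \<iota> \<Longrightarrow>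
      \<exists>U \<phi> K F t. chart_flow M A U \<phi> K F \<and> compose (topspace M) (chart_lift M U \<phi> (F t))
        (compose (topspace M) g (chart_lift M U \<phi> (F (- t)))) \<notin> W"
    using Diff_small_conjugates[OF manifold Hausdorff compact A_nonempty, of r] by blast
  obtain F \<epsilon> where small: "finite F" "F \<subseteq> S" "\<epsilon> > 0"
    "\<And>y. y \<in> F \<Longrightarrow> compactin Y.mtopology (Y.mcball y (2 * \<epsilon>))"
    and FW: "\<And>f. f \<in> \<D> \<Longrightarrow> (\<And>y. y \<in> F \<Longrightarrow> mdist Y (h f y) y \<le> \<epsilon>) \<Longrightarrow> f \<in> W"
    using identity_neighbourhood[OF W] by metis
  interpret pseudo_component S "mdist Y" F \<epsilon>
    by unfold_locales (use small in auto)
  have F_reach: "y \<in> Y.reach F" if "y \<in> F" for y using that by (auto simp: Y.reach_def)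
  have trivial: "g = \<iota>" if g: "g \<in> \<D>" and fix_C: "\<And>z. z \<in> Y.reach F \<Longrightarrow> h g z = z" for g
  proof (rule ccontr)
    assume "g \<noteq> \<iota>"
    moreover have "g \<in> W"
      by (rule FW[OF g]) (use fix_C F_reach small in \<open>auto simp: less_imp_le subset_iff\<close>)
    ultimately obtain U \<phi> K \<Phi> t where flow: "chart_flow M A U \<phi> K \<Phi>"
      and k: "compose (topspace M) (chart_lift M U \<phi> (\<Phi> t))
        (compose (topspace M) g (chart_lift M U \<phi> (\<Phi> (- t)))) \<notin> W"
      using conj by blast
    interpret chart_flow M A U \<phi> K \<Phi> by fact
    have gL: "compose (topspace M) g (L (- t)) \<in> \<D>"
      by (rule Diff_compose[OF manifold g L_Diff])
    have "mdist Y (h (compose (topspace M) (L t) (compose (topspace M) g (L (- t)))) y) y \<le> \<epsilon>"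
      if y: "y \<in> F" for y
    proof -
      have yS: "y \<in> S" using y small(2) by auto
      have flow_h: "Y.isometric_flow (\<lambda>t. h (L t))" by (rule isometric_flow_h[OF flow])
      \<comment> \<open>The flow may carry \<open>y\<close> far away, but not out of
        \<open>reach F\<close>, where \<open>g\<close> acts trivially. So the conjugate fixes
        \<open>F\<close> pointwise and must lie in \<open>W\<close>.\<close>
      have "h (L (- t)) y \<in> Y.reach F"
        using isometric_flow_reach[OF flow_h F_reach[OF y]] .
      then have "h (compose (topspace M) (L t) (compose (topspace M) g (L (- t)))) y = h (L t) (h (L (- t)) y)"
        using h_compose[OF L_Diff gL yS] h_compose[OF g L_Diff yS] fix_C by simp
      also have "\<dots> = y"
        using h_compose[OF L_Diff L_Diff yS, of t "- t"] h_\<iota>[OF yS] by (simp add: L_compose L_0)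
      finally show ?thesis using yS small(3) by simp
    qed
    then have "compose (topspace M) (L t) (compose (topspace M) g (L (- t))) \<in> W"
      by (intro FW Diff_compose[OF manifold L_Diff gL])
    with k show False by blast
  qed
  obtain U \<phi> x0 where chart: "(U, \<phi>) \<in> A" "x0 \<in> U"
    using nonempty smooth_manifold_chart_at[OF manifold] by (metis all_not_in_conv prod.collapse)
  note U = is_chartD[OF smooth_manifold_is_chart[OF manifold chart(1)]]
  obtain \<rho> where \<rho>: "\<rho> > 0" "cball (\<phi> x0) \<rho> \<subseteq> \<phi> ` U"
    using U(2) chart(2) open_contains_cball by blast
  define c where "c = \<phi> x0"
  \<comment> \<open>The \<open>i\<close>-th shell occupies the radii from 3/8 to 5/8 of
    \<open>\<sigma> i\<close>; the ratio 4 of consecutive scales keeps the shells disjoint.\<close>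
  define \<sigma> where "\<sigma> i = \<rho> / 4 ^ i" for i :: nat
  define R where "R i = \<sigma> i / 2" for i
  define \<mu> where "\<mu> i = \<sigma> i / (4 * pi)" for i
  have \<sigma>: "\<sigma> i > 0" "\<sigma> i \<le> \<rho>" for i using \<rho>(1) by (simp_all add: \<sigma>_def divide_le_eq)
  have \<mu>: "\<mu> i > 0" "\<mu> i * (pi / 2) = \<sigma> i / 8" for i using \<sigma>(1)[of i] by (auto simp: \<mu>_def)
  have R: "R i > \<mu> i * (pi / 2)" "R i + \<mu> i * (pi / 2) \<le> \<rho>" for i
    using \<sigma>[of i] unfolding \<mu>(2) R_def by - linarith+
  have disjoint: "\<bar>R i - R j\<bar> \<ge> \<mu> i * (pi / 2) + \<mu> j * (pi / 2)" if "i \<noteq> j" for i j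
  proof -
    have *: "\<sigma> j \<le> \<sigma> i / 4" if "i < j" for i j
    proof -
      have "(4::real) ^ Suc i \<le> 4 ^ j" using that by (intro power_increasing) auto
      then show ?thesis using \<rho>(1) by (simp add: \<sigma>_def field_simps)
    qed
    show ?thesis
      using *[of i j] *[of j i] that \<sigma>(1)[of i] \<sigma>(1)[of j] unfolding \<mu>(2) R_def by linarith
  qed
  have shift: "chart_flow M A U \<phi> (cball c \<rho>) (shift_flow c (R i) (\<mu> i))"
    and dilation: "chart_flow M A U \<phi> (cball c \<rho>) (dilation_flow c (R i) (\<mu> i))" for i
    using manifold Hausdorff chart(1) \<rho>(2) smooth_flow_shift[OF \<mu>(1) R] smooth_flow_dilation[OF \<mu>(1) R]
    by (auto intro!: chart_flow.intro simp: c_def)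
  define b where "b i t = chart_lift M U \<phi> (shift_flow c (R i) (\<mu> i) t)" for i t
  define a where "a i s = chart_lift M U \<phi> (dilation_flow c (R i) (\<mu> i) s)" for i s
  have D: "b i t \<in> \<D>" "a i t \<in> \<D>" for i t
    unfolding a_def b_def using chart_flow.L_Diff[OF shift] chart_flow.L_Diff[OF dilation] by blast+
  have image: "shift_flow c (R i) (\<mu> i) t y \<in> \<phi> ` U" "dilation_flow c (R i) (\<mu> i) t y \<in> \<phi> ` U"
    if "y \<in> \<phi> ` U" for i t y
    using chart_flow.F_image[OF shift that] chart_flow.F_image[OF dilation that] by blast+
  have lift_compose: "compose (topspace M) (chart_lift M U \<phi> f) (chart_lift M U \<phi> (shift_flow c (R i) (\<mu> i) t)) =
        chart_lift M U \<phi> (\<lambda>x. f (shift_flow c (R i) (\<mu> i) t x))"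
      "compose (topspace M) (chart_lift M U \<phi> f) (chart_lift M U \<phi> (dilation_flow c (R i) (\<mu> i) t)) =
        chart_lift M U \<phi> (\<lambda>x. f (dilation_flow c (R i) (\<mu> i) t x))" for f i t
    by (intro chart_lift_compose smooth_manifold_is_chart[OF manifold chart(1)] image; assumption)+
  interpret affine_family S "mdist Y" F \<epsilon> "\<lambda>i s. h (a i s)" "\<lambda>i t. h (b i t)"
  proof
    fix i j s t
    show "Y.isometric_flow (\<lambda>s. h (a i s))" "Y.isometric_flow (\<lambda>t. h (b i t))"
      unfolding a_def b_def by (rule isometric_flow_h[OF dilation], rule isometric_flow_h[OF shift])
    have "compose (topspace M) (a i s) (b i t) = compose (topspace M) (b i (exp s * t)) (a i s)" for s t
      unfolding a_def b_def lift_compose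
      by (simp only: dilation_shift_conj[OF \<mu>(1) R(1)])
    then show "Y.affine_relation (\<lambda>s. h (a i s)) (\<lambda>t. h (b i t))"
      unfolding Y.affine_relation_def using h_compose D by metis
    fix x assume "i \<noteq> j" and x: "x \<in> S"
    have "compose (topspace M) (b i s) (b j t) = compose (topspace M) (b j t) (b i s)"
      "compose (topspace M) (a i s) (b j t) = compose (topspace M) (b j t) (a i s)"
      unfolding a_def b_def lift_compose
      by (simp_all only: shell_commute[OF \<mu>(1) \<mu>(1) R(1) R(1) disjoint[OF \<open>i \<noteq> j\<close>]])
    then show "h (b i s) (h (b j t) x) = h (b j t) (h (b i s) x)"
      "h (a i s) (h (b j t) x) = h (b j t) (h (a i s) x)"
      using h_compose D x by metis+
  qed
  obtain i where "\<forall>z\<in>Y.reach F. h (b i 1) z = z" using affine_family_trivial by blast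
  then have "b i 1 = \<iota>" using trivial[OF D(1)] by blast
  moreover obtain x where x: "norm (x - c) = R i" "shift_flow c (R i) (\<mu> i) 1 x \<noteq> x"
    using shift_flow_nontrivial[OF \<mu>(1) R(1)] by blast
  have "norm (x - c) \<le> \<rho>" using x(1) \<sigma>[of i] unfolding R_def by linarith
  then have "x \<in> cball c \<rho>" by (simp add: dist_norm norm_minus_commute)
  then obtain p where p: "p \<in> U" "\<phi> p = x" using \<rho>(2) by (auto simp: c_def)
  have "\<phi> (b i 1 p) = shift_flow c (R i) (\<mu> i) 1 x"
    unfolding b_def using chart_flow.L_chart(2)[OF shift p(1)] p(2) by simp
  ultimately show False using x(2) p U(3) by auto
qed

end

theorem theorem6:
  fixes M :: "'m topology"
    and A :: "('m, 'e::euclidean_space) chart set"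
    and r :: enat
  assumes "smooth_manifold M A"
    and "compact_space M" and "Hausdorff_space M"
    and "connected_space M" and "topspace M \<noteq> {}"
    and "DIM('e) \<ge> 1"
    and "1 \<le> r" and "r \<noteq> enat (DIM('e) + 1)"
  shows "\<not> group_of_isometries_locally_compact TYPE('y) (Diff_group M A r) (Diff_topology M A r)"
proof
  assume "group_of_isometries_locally_compact TYPE('y) (Diff_group M A r) (Diff_topology M A r)"
  then obtain Y :: "'y metric" and H h where "Diff_isometric_action M A r Y H h"
    using assms unfolding group_of_isometries_locally_compact_def Diff_isometric_action_def by blast
  then show False by (rule Diff_isometric_action.contradiction)
qed

end
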